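(* Let $T[1,n]$ be a string, $\epsilon>0$ a constant, and let $\mathcal{G}_\epsilon(T)$ be the pruned graph defined in the context. Suppose there is a dynamic data structure occupying $O(n)$ space that maintains $\log_{1+\epsilon}n$ sliding windows $w_t=T[l,r_t]$ sharing a common start $l$ (with $r_1\le r_2\le\dots$) and supports: $\mathrm{remove}()$ (increment $l$ for all windows) in time $L(n)$; $\mathrm{append}(w_t)$ (increment $r_t$) in time $R(n)$; and $\mathrm{length}(w_t)$ (return $|\mathcal{C}(T[l,r_t])|$) in time $R(n)$. Then the shortest path in $\mathcal{G}_\epsilon(T)$ from $v_1$ to $v_{n+1}$ can be computed in $O(n\,L(n)+(n\log_{1+\epsilon}n)\,R(n))$ time and $O(n)$ space.
   Context: $\mathcal{C}$ is a base compressor producing prefix-free encodings; $|\mathcal{C}(\alpha)|$ is the length in bits of the compressed form of $\alpha$. $\mathcal{G}(T)$ is the weighted DAG on vertices $v_1,\dots,v_{n+1}$ with an edge $(v_i,v_j)$ for each $1\le i<j\le n+1$ of cost $c(v_i,v_j)=|\mathcal{C}(T[i,j-1])|$; costs are assumed monotone: $0<c(v_i,v_{i+1})\le c(v_i,v_{i+2})\le\dots\le c(v_i,v_{n+1})$, and more generally the compressed size of a substring is at most that of any substring containing it. $\mathcal{G}_\epsilon(T)$ is the subgraph keeping exactly those edges $(v_i,v_j)$ such that either there is a positive integer $k$ with $c(v_i,v_j)\le(1+\epsilon)^k<c(v_i,v_{j+1})$, or $j=n+1$.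
   Formalization: Texts are restricted to those whose compressed size is at most d·n^d for an arbitrary fixed constant d (otherwise O(log n) powers of 1+ε need not suffice), and building the window structure is assumed to take at most the stated time bound; comparing a word with a power of 1+ε costs one step. *)

theory Defs
  imports
    Complex_Main
    "HOL-Library.Sublist"
    "Graph_Theory.Shortest_Path"
begin

section \<open>Compressors and the two graphs\<close>

text \<open>Positions are 1-based and both ends are included: \<open>substr T i j\<close> is $T[i,j]$.\<close>

definition substr :: "'a list \<Rightarrow> nat \<Rightarrow> nat \<Rightarrow> 'a list" where
  "substr T i j = take (Suc j - i) (drop (i - 1) T)"

definition prefix_free :: "('a list \<Rightarrow> bool list) \<Rightarrow> bool" where
  "prefix_free C \<longleftrightarrow>
     (\<forall>\<alpha> \<beta>. \<alpha> \<noteq> [] \<longrightarrow> \<beta> \<noteq> [] \<longrightarrow> \<alpha> \<noteq> \<beta> \<longrightarrow> \<not> prefix (C \<alpha>) (C \<beta>))"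

definition monotone_compressor :: "('a list \<Rightarrow> bool list) \<Rightarrow> bool" where
  "monotone_compressor C \<longleftrightarrow>
     (\<forall>\<alpha> \<beta>. \<beta> \<noteq> [] \<longrightarrow> sublist \<beta> \<alpha> \<longrightarrow> 0 < length (C \<beta>) \<and> length (C \<beta>) \<le> length (C \<alpha>))"

definition edge_cost :: "('a list \<Rightarrow> bool list) \<Rightarrow> 'a list \<Rightarrow> nat \<times> nat \<Rightarrow> nat" where
  "edge_cost C T = (\<lambda>(i, j). length (C (substr T i (j - 1))))"

definition text_graph :: "'a list \<Rightarrow> (nat, nat \<times> nat) pre_digraph" where
  "text_graph T =
     \<lparr> verts = {1..length T + 1},
       arcs = {(i, j). 1 \<le> i \<and> i < j \<and> j \<le> length T + 1},
       tail = fst, head = snd \<rparr>"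

definition pruned_graph ::
    "('a list \<Rightarrow> bool list) \<Rightarrow> real \<Rightarrow> 'a list \<Rightarrow> (nat, nat \<times> nat) pre_digraph" where
  "pruned_graph C \<epsilon> T = (text_graph T)
     \<lparr> arcs := {(i, j) \<in> arcs (text_graph T).
         j = length T + 1 \<or>
         (\<exists>k::nat. 0 < k \<and>
            real (edge_cost C T (i, j)) \<le> (1 + \<epsilon>) ^ k \<and>
            (1 + \<epsilon>) ^ k < real (edge_cost C T (i, j + 1)))} \<rparr>"

lemma wf_digraph_pruned_graph: "wf_digraph (pruned_graph C \<epsilon> T)"
  by unfold_locales (auto simp: pruned_graph_def text_graph_def)

text \<open>
  \<open>\<mu>\<close> is the infimum of the costs of all walks, so a path attaining it is a shortest one.  The
  path is described by the list of its vertices, from source to target.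
\<close>

definition shortest_path ::
    "('v, 'e) pre_digraph \<Rightarrow> ('e \<Rightarrow> nat) \<Rightarrow> 'v \<Rightarrow> 'v list \<Rightarrow> 'v \<Rightarrow> bool" where
  "shortest_path G w u vs v \<longleftrightarrow>
     (\<exists>p. pre_digraph.apath G u p v \<and>
          vs = pre_digraph.awalk_verts G u p \<and>
          ereal (wf_digraph.awalk_cost (\<lambda>e. real (w e)) p) =
            wf_digraph.\<mu> G (\<lambda>e. real (w e)) u v)"

text \<open>
  The texts whose compressed size is bounded by a fixed polynomial in their length.  These are
  the texts on which, in the word RAM model with words of $O(\log n)$ bits, an edge cost fits
  in a constant number of words; moreover $O(\log_{1+\epsilon} n)$ powers of $1+\epsilon$ then
  cover the range of the edge costs.
\<close>

definition texts :: "('a list \<Rightarrow> bool list) \<Rightarrow> nat \<Rightarrow> 'a list set" where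
  "texts C d = {T. T \<noteq> [] \<and> length (C T) \<le> d * length T ^ d}"


section \<open>Sliding-window data structures\<close>

text \<open>
  The data structure is a black box with states of type \<open>'s\<close>.  The last component of the
  result of every operation is the number of steps it takes; \<open>ds_space\<close> is the number of words
  a state occupies.  A length query may reorganise the state.
\<close>

record ('a, 's) window_ds =
  ds_new :: "'a list \<Rightarrow> 's \<times> nat"
  ds_remove :: "'s \<Rightarrow> 's \<times> nat"
  ds_append :: "nat \<Rightarrow> 's \<Rightarrow> 's \<times> nat"
  ds_length :: "nat \<Rightarrow> 's \<Rightarrow> nat \<times> 's \<times> nat"
  ds_space :: "'s \<Rightarrow> nat"

definition num_windows :: "real \<Rightarrow> nat \<Rightarrow> nat" where
  "num_windows \<epsilon> n = nat \<lceil>log (1 + \<epsilon>) (real n)\<rceil>"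

definition time_bound :: "real \<Rightarrow> (nat \<Rightarrow> real) \<Rightarrow> (nat \<Rightarrow> real) \<Rightarrow> nat \<Rightarrow> real" where
  "time_bound \<epsilon> L R n = real n * L n + (real n * log (1 + \<epsilon>) (real n)) * R n"

text \<open>
  \<open>rep T s l r\<close> says that the state \<open>s\<close> represents the windows $T[l,r_t]$ for $1 \le t \le m$.
  A window with $r_t = l - 1$ is empty.  Only operations that keep $r_1 \le \dots \le r_m \le n$
  and $l \le r_t + 1$ have to be supported, and only nonempty windows can be queried.  A new
  structure has $l = 1$ and all its windows empty; building it must not take longer than the
  running time in which it is going to be used.
\<close>

definition sliding_windows ::
    "('a list \<Rightarrow> bool list) \<Rightarrow> real \<Rightarrow> 'a list set \<Rightarrow>
     (nat \<Rightarrow> real) \<Rightarrow> (nat \<Rightarrow> real) \<Rightarrow> ('a, 's) window_ds \<Rightarrow> bool" where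
  "sliding_windows C \<epsilon> \<T> L R D \<longleftrightarrow>
     (\<exists>(rep :: 'a list \<Rightarrow> 's \<Rightarrow> nat \<Rightarrow> (nat \<Rightarrow> nat) \<Rightarrow> bool) (K :: nat). \<forall>T \<in> \<T>.
        let n = length T; m = num_windows \<epsilon> n in
        (case ds_new D T of (s, time) \<Rightarrow>
           rep T s 1 (\<lambda>_. 0) \<and> real time \<le> real K * time_bound \<epsilon> L R n) \<and>
        (\<forall>s l r. rep T s l r \<longrightarrow>
           ds_space D s \<le> K * n \<and>
           ((\<forall>t \<in> {1..m}. l \<le> r t) \<and> l \<le> n \<longrightarrow>
             (case ds_remove D s of (s', time) \<Rightarrow>
                rep T s' (l + 1) r \<and> real time \<le> L n)) \<and>
           (\<forall>t \<in> {1..m}. r t < n \<and> (t < m \<longrightarrow> r t < r (t + 1)) \<longrightarrow>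
             (case ds_append D t s of (s', time) \<Rightarrow>
                rep T s' l (r(t := r t + 1)) \<and> real time \<le> R n)) \<and>
           (\<forall>t \<in> {1..m}. l \<le> r t \<longrightarrow>
             (case ds_length D t s of (c, s', time) \<Rightarrow>
                c = length (C (substr T l (r t))) \<and> rep T s' l r \<and> real time \<le> R n))))"


section \<open>A word RAM with access to window data structures\<close>

text \<open>
  Programs are fixed syntactic objects over registers, an array memory and a table of handles
  to instances of the data structure.  The text is accessible only through these instances.
  The parameter \<open>\<epsilon>\<close> may be any real number, so it enters only through the primitive test
  \<open>PowLe\<close>, which compares a word with a power of $1+\epsilon$.
\<close>

datatype aexp =
    Const nat
  | Reg nat
  | Mem aexp
  | Add aexp aexp
  | Sub aexp aexp
  | Mul aexp aexp
  | Div aexp aexp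

datatype bexp =
    Less aexp aexp
  | Equal aexp aexp
  | PowLe aexp aexp
  | Neg bexp
  | Conj bexp bexp

datatype com =
    Skip
  | Assign nat aexp
  | Store aexp aexp
  | Seq com com
  | If bexp com com
  | While bexp com
  | New aexp
  | Remove aexp
  | Append aexp aexp
  | Length nat aexp aexp

record 's state =
  regs :: "nat \<Rightarrow> nat"
  mem :: "nat \<Rightarrow> nat"
  inst :: "nat \<Rightarrow> 's option"

fun aval :: "'s state \<Rightarrow> aexp \<Rightarrow> nat" where
  "aval \<sigma> (Const k) = k"
| "aval \<sigma> (Reg x) = regs \<sigma> x"
| "aval \<sigma> (Mem a) = mem \<sigma> (aval \<sigma> a)"
| "aval \<sigma> (Add a b) = aval \<sigma> a + aval \<sigma> b"
| "aval \<sigma> (Sub a b) = aval \<sigma> a - aval \<sigma> b"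
| "aval \<sigma> (Mul a b) = aval \<sigma> a * aval \<sigma> b"
| "aval \<sigma> (Div a b) = aval \<sigma> a div aval \<sigma> b"

fun bval :: "real \<Rightarrow> 's state \<Rightarrow> bexp \<Rightarrow> bool" where
  "bval \<epsilon> \<sigma> (Less a b) \<longleftrightarrow> aval \<sigma> a < aval \<sigma> b"
| "bval \<epsilon> \<sigma> (Equal a b) \<longleftrightarrow> aval \<sigma> a = aval \<sigma> b"
| "bval \<epsilon> \<sigma> (PowLe a b) \<longleftrightarrow> real (aval \<sigma> a) \<le> (1 + \<epsilon>) ^ aval \<sigma> b"
| "bval \<epsilon> \<sigma> (Neg b) \<longleftrightarrow> \<not> bval \<epsilon> \<sigma> b"
| "bval \<epsilon> \<sigma> (Conj b c) \<longleftrightarrow> bval \<epsilon> \<sigma> b \<and> bval \<epsilon> \<sigma> c"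

text \<open>
  \<open>W\<close> is the largest number that fits in a word and \<open>S\<close> the number of memory cells.  An
  expression is safe if all its intermediate results fit in a word and all its memory accesses
  are within bounds; unsafe computations get stuck.
\<close>

fun asafe :: "nat \<Rightarrow> nat \<Rightarrow> 's state \<Rightarrow> aexp \<Rightarrow> bool" where
  "asafe W S \<sigma> (Const k) \<longleftrightarrow> k \<le> W"
| "asafe W S \<sigma> (Reg x) \<longleftrightarrow> regs \<sigma> x \<le> W"
| "asafe W S \<sigma> (Mem a) \<longleftrightarrow> asafe W S \<sigma> a \<and> aval \<sigma> a < S \<and> aval \<sigma> (Mem a) \<le> W"
| "asafe W S \<sigma> (Add a b) \<longleftrightarrow> asafe W S \<sigma> a \<and> asafe W S \<sigma> b \<and> aval \<sigma> (Add a b) \<le> W"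
| "asafe W S \<sigma> (Sub a b) \<longleftrightarrow> asafe W S \<sigma> a \<and> asafe W S \<sigma> b"
| "asafe W S \<sigma> (Mul a b) \<longleftrightarrow> asafe W S \<sigma> a \<and> asafe W S \<sigma> b \<and> aval \<sigma> (Mul a b) \<le> W"
| "asafe W S \<sigma> (Div a b) \<longleftrightarrow> asafe W S \<sigma> a \<and> asafe W S \<sigma> b"

fun bsafe :: "nat \<Rightarrow> nat \<Rightarrow> 's state \<Rightarrow> bexp \<Rightarrow> bool" where
  "bsafe W S \<sigma> (Less a b) \<longleftrightarrow> asafe W S \<sigma> a \<and> asafe W S \<sigma> b"
| "bsafe W S \<sigma> (Equal a b) \<longleftrightarrow> asafe W S \<sigma> a \<and> asafe W S \<sigma> b"
| "bsafe W S \<sigma> (PowLe a b) \<longleftrightarrow> asafe W S \<sigma> a \<and> asafe W S \<sigma> b"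
| "bsafe W S \<sigma> (Neg b) \<longleftrightarrow> bsafe W S \<sigma> b"
| "bsafe W S \<sigma> (Conj b c) \<longleftrightarrow> bsafe W S \<sigma> b \<and> bsafe W S \<sigma> c"

fun acost :: "aexp \<Rightarrow> nat" where
  "acost (Const k) = 1"
| "acost (Reg x) = 1"
| "acost (Mem a) = 1 + acost a"
| "acost (Add a b) = 1 + acost a + acost b"
| "acost (Sub a b) = 1 + acost a + acost b"
| "acost (Mul a b) = 1 + acost a + acost b"
| "acost (Div a b) = 1 + acost a + acost b"

fun bcost :: "bexp \<Rightarrow> nat" where
  "bcost (Less a b) = 1 + acost a + acost b"
| "bcost (Equal a b) = 1 + acost a + acost b"
| "bcost (PowLe a b) = 1 + acost a + acost b"
| "bcost (Neg b) = 1 + bcost b"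
| "bcost (Conj b c) = 1 + bcost b + bcost c"

text \<open>
  Every handle in use is charged one word in addition to the space of its instance.
\<close>

definition fits :: "('a, 's) window_ds \<Rightarrow> nat \<Rightarrow> (nat \<Rightarrow> 's option) \<Rightarrow> bool" where
  "fits D S I \<longleftrightarrow> (\<Sum>h \<in> dom I. 1 + ds_space D (the (I h))) \<le> S"

text \<open>
  \<open>exec D T \<epsilon> W S c \<sigma> t \<sigma>'\<close>: started in \<open>\<sigma>\<close>, the program \<open>c\<close> terminates after \<open>t\<close> steps in
  \<open>\<sigma>'\<close>, all words staying within \<open>W\<close>, using at most \<open>S\<close> memory cells and with instances that
  never occupy more than \<open>S\<close> words altogether.  (The finitely many registers that occur in \<open>c\<close>
  are not counted, so the total space is \<open>2 * S\<close> plus a constant.)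
\<close>

inductive exec ::
    "('a, 's) window_ds \<Rightarrow> 'a list \<Rightarrow> real \<Rightarrow> nat \<Rightarrow> nat \<Rightarrow>
     com \<Rightarrow> 's state \<Rightarrow> nat \<Rightarrow> 's state \<Rightarrow> bool"
  for D :: "('a, 's) window_ds" and T :: "'a list" and \<epsilon> :: real and W S :: nat
where
  Skip: "exec D T \<epsilon> W S Skip \<sigma> 1 \<sigma>"
| Assign: "asafe W S \<sigma> a \<Longrightarrow>
    exec D T \<epsilon> W S (Assign x a) \<sigma> (1 + acost a) (\<sigma>\<lparr>regs := (regs \<sigma>)(x := aval \<sigma> a)\<rparr>)"
| Store: "asafe W S \<sigma> a \<Longrightarrow> asafe W S \<sigma> b \<Longrightarrow> aval \<sigma> a < S \<Longrightarrow>
    exec D T \<epsilon> W S (Store a b) \<sigma> (1 + acost a + acost b)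
      (\<sigma>\<lparr>mem := (mem \<sigma>)(aval \<sigma> a := aval \<sigma> b)\<rparr>)"
| Seq: "exec D T \<epsilon> W S c\<^sub>1 \<sigma> t\<^sub>1 \<sigma>' \<Longrightarrow> exec D T \<epsilon> W S c\<^sub>2 \<sigma>' t\<^sub>2 \<sigma>'' \<Longrightarrow>
    exec D T \<epsilon> W S (Seq c\<^sub>1 c\<^sub>2) \<sigma> (t\<^sub>1 + t\<^sub>2) \<sigma>''"
| IfTrue: "bsafe W S \<sigma> b \<Longrightarrow> bval \<epsilon> \<sigma> b \<Longrightarrow> exec D T \<epsilon> W S c\<^sub>1 \<sigma> t \<sigma>' \<Longrightarrow>
    exec D T \<epsilon> W S (If b c\<^sub>1 c\<^sub>2) \<sigma> (1 + bcost b + t) \<sigma>'"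
| IfFalse: "bsafe W S \<sigma> b \<Longrightarrow> \<not> bval \<epsilon> \<sigma> b \<Longrightarrow> exec D T \<epsilon> W S c\<^sub>2 \<sigma> t \<sigma>' \<Longrightarrow>
    exec D T \<epsilon> W S (If b c\<^sub>1 c\<^sub>2) \<sigma> (1 + bcost b + t) \<sigma>'"
| WhileFalse: "bsafe W S \<sigma> b \<Longrightarrow> \<not> bval \<epsilon> \<sigma> b \<Longrightarrow>
    exec D T \<epsilon> W S (While b c) \<sigma> (1 + bcost b) \<sigma>"
| WhileTrue: "bsafe W S \<sigma> b \<Longrightarrow> bval \<epsilon> \<sigma> b \<Longrightarrow> exec D T \<epsilon> W S c \<sigma> t\<^sub>1 \<sigma>' \<Longrightarrow>
    exec D T \<epsilon> W S (While b c) \<sigma>' t\<^sub>2 \<sigma>'' \<Longrightarrow>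
    exec D T \<epsilon> W S (While b c) \<sigma> (1 + bcost b + t\<^sub>1 + t\<^sub>2) \<sigma>''"
| New: "asafe W S \<sigma> h \<Longrightarrow> ds_new D T = (s, time) \<Longrightarrow>
    I = (inst \<sigma>)(aval \<sigma> h \<mapsto> s) \<Longrightarrow> fits D S I \<Longrightarrow>
    exec D T \<epsilon> W S (New h) \<sigma> (1 + acost h + time) (\<sigma>\<lparr>inst := I\<rparr>)"
| Remove: "asafe W S \<sigma> h \<Longrightarrow> inst \<sigma> (aval \<sigma> h) = Some s \<Longrightarrow>
    ds_remove D s = (s', time) \<Longrightarrow>
    I = (inst \<sigma>)(aval \<sigma> h \<mapsto> s') \<Longrightarrow> fits D S I \<Longrightarrow>
    exec D T \<epsilon> W S (Remove h) \<sigma> (1 + acost h + time) (\<sigma>\<lparr>inst := I\<rparr>)"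
| Append: "asafe W S \<sigma> h \<Longrightarrow> asafe W S \<sigma> a \<Longrightarrow> inst \<sigma> (aval \<sigma> h) = Some s \<Longrightarrow>
    ds_append D (aval \<sigma> a) s = (s', time) \<Longrightarrow>
    I = (inst \<sigma>)(aval \<sigma> h \<mapsto> s') \<Longrightarrow> fits D S I \<Longrightarrow>
    exec D T \<epsilon> W S (Append h a) \<sigma> (1 + acost h + acost a + time) (\<sigma>\<lparr>inst := I\<rparr>)"
| Length: "asafe W S \<sigma> h \<Longrightarrow> asafe W S \<sigma> a \<Longrightarrow> inst \<sigma> (aval \<sigma> h) = Some s \<Longrightarrow>
    ds_length D (aval \<sigma> a) s = (k, s', time) \<Longrightarrow> k \<le> W \<Longrightarrow>
    I = (inst \<sigma>)(aval \<sigma> h \<mapsto> s') \<Longrightarrow> fits D S I \<Longrightarrow>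
    exec D T \<epsilon> W S (Length x h a) \<sigma> (1 + acost h + acost a + time)
      (\<sigma>\<lparr>regs := (regs \<sigma>)(x := k), inst := I\<rparr>)"

inductive_cases SkipE: "exec D T \<epsilon> W S Skip \<sigma> t \<sigma>'"
inductive_cases AssignE: "exec D T \<epsilon> W S (Assign x a) \<sigma> t \<sigma>'"
inductive_cases StoreE: "exec D T \<epsilon> W S (Store a b) \<sigma> t \<sigma>'"
inductive_cases SeqE: "exec D T \<epsilon> W S (Seq c\<^sub>1 c\<^sub>2) \<sigma> t \<sigma>'"
inductive_cases IfE: "exec D T \<epsilon> W S (If b c\<^sub>1 c\<^sub>2) \<sigma> t \<sigma>'"
inductive_cases WhileE: "exec D T \<epsilon> W S (While b c) \<sigma> t \<sigma>'"
inductive_cases NewE: "exec D T \<epsilon> W S (New h) \<sigma> t \<sigma>'"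
inductive_cases RemoveE: "exec D T \<epsilon> W S (Remove h) \<sigma> t \<sigma>'"
inductive_cases AppendE: "exec D T \<epsilon> W S (Append h a) \<sigma> t \<sigma>'"
inductive_cases LengthE: "exec D T \<epsilon> W S (Length x h a) \<sigma> t \<sigma>'"

lemma exec_deterministic:
  "exec D T \<epsilon> W S c \<sigma> t \<sigma>' \<Longrightarrow> exec D T \<epsilon> W S c \<sigma> u \<sigma>'' \<Longrightarrow> u = t \<and> \<sigma>'' = \<sigma>'"
proof (induction arbitrary: u \<sigma>'' rule: exec.induct)
  case (Skip \<sigma>)
  then show ?case by (rule SkipE) simp
next
  case (Assign \<sigma> a x)
  from Assign.prems show ?case by (rule AssignE) simp
next
  case (Store \<sigma> a b)
  from Store.prems show ?case by (rule StoreE) simp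
next
  case (Seq c\<^sub>1 \<sigma> t\<^sub>1 \<sigma>' c\<^sub>2 t\<^sub>2 \<tau>)
  from Seq.prems show ?case
  proof (rule SeqE)
    fix u\<^sub>1 \<rho> u\<^sub>2
    assume "u = u\<^sub>1 + u\<^sub>2" "exec D T \<epsilon> W S c\<^sub>1 \<sigma> u\<^sub>1 \<rho>" "exec D T \<epsilon> W S c\<^sub>2 \<rho> u\<^sub>2 \<sigma>''"
    with Seq.IH(1)[of u\<^sub>1 \<rho>] Seq.IH(2)[of u\<^sub>2 \<sigma>''] show ?case by simp
  qed
next
  case (IfTrue \<sigma> b c\<^sub>1 t \<sigma>' c\<^sub>2)
  from IfTrue.prems show ?case
    by (rule IfE) (use IfTrue.hyps(2) IfTrue.IH in \<open>force+\<close>)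
next
  case (IfFalse \<sigma> b c\<^sub>2 t \<sigma>' c\<^sub>1)
  from IfFalse.prems show ?case
    by (rule IfE) (use IfFalse.hyps(2) IfFalse.IH in \<open>force+\<close>)
next
  case (WhileFalse \<sigma> b c)
  from WhileFalse.prems show ?case
    by (rule WhileE) (use WhileFalse.hyps(2) in simp_all)
next
  case (WhileTrue \<sigma> b c t\<^sub>1 \<sigma>' t\<^sub>2 \<tau>)
  from WhileTrue.prems show ?case
  proof (rule WhileE)
    assume "\<not> bval \<epsilon> \<sigma> b"
    with WhileTrue.hyps(2) show ?case by simp
  next
    fix u\<^sub>1 \<rho> u\<^sub>2
    assume "u = Suc (bcost b + u\<^sub>1 + u\<^sub>2)" "exec D T \<epsilon> W S c \<sigma> u\<^sub>1 \<rho>"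
      "exec D T \<epsilon> W S (While b c) \<rho> u\<^sub>2 \<sigma>''"
    with WhileTrue.IH(1)[of u\<^sub>1 \<rho>] WhileTrue.IH(2)[of u\<^sub>2 \<sigma>''] show ?case by simp
  qed
next
  case (New \<sigma> h s time I)
  from New.prems show ?case by (rule NewE) (use New.hyps in simp)
next
  case (Remove \<sigma> h s s' time I)
  from Remove.prems show ?case by (rule RemoveE) (use Remove.hyps in simp)
next
  case (Append \<sigma> h a s s' time I)
  from Append.prems show ?case by (rule AppendE) (use Append.hyps in simp)
next
  case (Length \<sigma> h a s k s' time I x)
  from Length.prems show ?case by (rule LengthE) (use Length.hyps in simp)
qed

text \<open>
  Input: register 0 holds \<open>n\<close>.  Output: register 0 holds the number of vertices of the path,
  which are stored in this order in the cells from 0 on.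
\<close>

definition initial_state :: "nat \<Rightarrow> 's state" where
  "initial_state n = \<lparr> regs = (\<lambda>_. 0)(0 := n), mem = (\<lambda>_. 0), inst = (\<lambda>_. None) \<rparr>"

definition output_path :: "'s state \<Rightarrow> nat list" where
  "output_path \<sigma> = map (mem \<sigma>) [0..<regs \<sigma> 0]"

end

theory Submission
  imports Defs
begin

text \<open>
  The left end \<open>i\<close> of the windows moves from 1 to \<open>n\<close>.  For every power of $1+\epsilon$ one
  window is extended until its cost exceeds the power; by monotonicity its right end never moves
  back, so there are at most \<open>n\<close> appends per window, and these right ends (and \<open>n + 1\<close>) are exactly the
  heads of the edges of the pruned graph that leave \<open>v\<^sub>i\<close>.  The edges are relaxed as they are found and are
  not stored.  The costs are bounded by $d n^d$, so a constant number of instances of the data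
  structure provides all windows.  The number of steps is bounded by an amortised argument: every
  append is paid by the distance of the right ends from \<open>n\<close>.
\<close>

section \<open>Single-source distances in the pruned graph\<close>

text \<open>Three obstacles shape the construction. An append must keep r_t \<le> r_(t+1), so for
  every \<open>i\<close> the powers are handled from the largest to the smallest: a window that
  still fits below its power ends strictly before the finished window of the next power. An edge (i,
  j) costs what T[i, j-1] costs, while the window that detects \<open>j\<close> already contains
  T[j] and cannot shrink; a second, lagging window per power supplies the cost, hence 2 H instances
  for H m powers. One instance offers only m = ceil(log n) windows, but costs reach d n^d; with
  (1+\<epsilon>)^k > d and n \<le> (1+\<epsilon>)^m this is at most (1+\<epsilon>)^((k+d) m), so H =
  d + k + 1 suffices. All edges lead to larger vertices, so the distance of \<open>i\<close> is
  final when \<open>i\<close> is reached; several powers may report the same edge, and relaxing it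
  again is harmless. At n = 1 there are no windows and log n = 0, so this length has its own branch;
  for n \<ge> 2 the logarithm is bounded away from 0, which absorbs the rounding in
  \<open>m\<close>.\<close>

text \<open>
  \<open>d\<close> is the distance, \<open>p\<close> the predecessor and \<open>e\<close> the number of vertices of the current path to a
  vertex, with \<open>e j = 0\<close> if no path to \<open>j\<close> is known yet; \<open>R\<close> is the set of relaxed arcs.
\<close>

definition dp_inv where
  "dp_inv A c N i d p e R \<longleftrightarrow>
     e 1 = 1 \<and> d 1 = 0 \<and> p 1 = 0 \<and> (\<forall>j. e j = 0 \<longrightarrow> d j = 0 \<and> p j = 0) \<and>
     (\<forall>j \<in> {2..N}. e j \<noteq> 0 \<longrightarrow>
        1 \<le> p j \<and> p j \<le> i \<and> p j < j \<and> (p j, j) \<in> A \<and> e (p j) \<noteq> 0 \<and>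
        e j = Suc (e (p j)) \<and> d j = d (p j) + c (p j, j)) \<and>
     (\<forall>a b. (a, b) \<in> R \<longrightarrow> a \<le> i \<and> (e a \<noteq> 0 \<longrightarrow> e b \<noteq> 0 \<and> d b \<le> d a + c (a, b)))"
  for A :: "(nat \<times> nat) set" and c d p e :: "_ \<Rightarrow> nat"

lemma dp_inv_init: "dp_inv A c N i (\<lambda>_. 0) (\<lambda>_. 0) (\<lambda>j. if j = 1 then 1 else 0) {}"
  by (simp add: dp_inv_def)

lemma dp_inv_mono:
  assumes "dp_inv A c N i d p e R" "i \<le> i'" "R' \<subseteq> R"
  shows "dp_inv A c N i' d p e R'"
proof -
  have "a \<le> i'" if "a \<le> i" for a
    using that assms(2) by simp
  with assms(1,3) show ?thesis
    unfolding dp_inv_def by blast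
qed

lemma dp_invD:
  assumes "dp_inv A c N i d p e R"
  shows "e 1 = 1" "d 1 = 0" "p 1 = 0"
    and "e j = 0 \<Longrightarrow> d j = 0 \<and> p j = 0"
    and "\<lbrakk>1 < j; j \<le> N; e j \<noteq> 0\<rbrakk> \<Longrightarrow>
        1 \<le> p j \<and> p j \<le> i \<and> p j < j \<and> (p j, j) \<in> A \<and> e (p j) \<noteq> 0 \<and>
        e j = Suc (e (p j)) \<and> d j = d (p j) + c (p j, j)"
    and "(a, b) \<in> R \<Longrightarrow> a \<le> i"
    and "\<lbrakk>(a, b) \<in> R; e a \<noteq> 0\<rbrakk> \<Longrightarrow> e b \<noteq> 0 \<and> d b \<le> d a + c (a, b)"
  using assms by (auto simp: dp_inv_def Suc_le_eq)

text \<open>Only vertex \<open>j\<close> changes, and \<open>j > i\<close>: all predecessors in use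
  and all tails of relaxed arcs are at most \<open>i\<close>. The new values are thus read only
  where \<open>j\<close> is the head of an arc, and there a first or a smaller distance does no
  harm.\<close>

lemma dp_inv_update:
  assumes "dp_inv A c N i d p e R" "1 \<le> i" "i < j" "j \<le> N" "(i, j) \<in> A"
    and "e i \<noteq> 0" "e j = 0 \<or> d i + c (i, j) < d j"
  shows "dp_inv A c N i (d(j := d i + c (i, j))) (p(j := i)) (e(j := Suc (e i)))
           (insert (i, j) R)"
proof -
  have pj: "p k \<noteq> j" if "k \<in> {2..N}" "e k \<noteq> 0" for k
    using dp_invD(5)[OF assms(1), of k] assms(3) that by auto
  have R: "a \<noteq> j" if "(a, b) \<in> R" for a b
    using dp_invD(6)[OF assms(1) that] assms(3) by auto
  from assms(2,3) have [simp]: "j \<noteq> Suc 0" "Suc 0 \<noteq> j" "i \<noteq> j" by auto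
  show ?thesis
    unfolding dp_inv_def
  proof (intro conjI ballI allI impI)
    show "(e(j := Suc (e i))) 1 = 1" "(d(j := d i + c (i, j))) 1 = 0" "(p(j := i)) 1 = 0"
      using dp_invD(1-3)[OF assms(1)] by simp_all
  next
    fix k assume "(e(j := Suc (e i))) k = 0"
    then show "(d(j := d i + c (i, j))) k = 0" "(p(j := i)) k = 0"
      using dp_invD(4)[OF assms(1), of k] by (auto split: if_splits)
  next
    fix k assume k: "k \<in> {2..N}" "(e(j := Suc (e i))) k \<noteq> 0"
    show "1 \<le> (p(j := i)) k" "(p(j := i)) k \<le> i" "(p(j := i)) k < k" "((p(j := i)) k, k) \<in> A"
      "(e(j := Suc (e i))) ((p(j := i)) k) \<noteq> 0"
      "(e(j := Suc (e i))) k = Suc ((e(j := Suc (e i))) ((p(j := i)) k))"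
      "(d(j := d i + c (i, j))) k = (d(j := d i + c (i, j))) ((p(j := i)) k) + c ((p(j := i)) k, k)"
      using dp_invD(5)[OF assms(1), of k] assms(2-6) k pj[of k] by (auto split: if_splits)
  next
    fix a b assume ab: "(a, b) \<in> insert (i, j) R"
    then show "a \<le> i" using dp_invD(6)[OF assms(1)] by auto
    assume "(e(j := Suc (e i))) a \<noteq> 0"
    with ab dp_invD(7)[OF assms(1), of a b] R[of a b] assms(7)
    show "(e(j := Suc (e i))) b \<noteq> 0"
      "(d(j := d i + c (i, j))) b \<le> (d(j := d i + c (i, j))) a + c (a, b)"
      by (auto split: if_splits)
  qed
qed

lemma dp_inv_insert:
  assumes "dp_inv A c N i d p e R" "e i = 0 \<or> e j \<noteq> 0 \<and> d j \<le> d i + c (i, j)"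
  shows "dp_inv A c N i d p e (insert (i, j) R)"
proof -
  have "a \<le> i \<and> (e a \<noteq> 0 \<longrightarrow> e b \<noteq> 0 \<and> d b \<le> d a + c (a, b))"
    if "(a, b) \<in> insert (i, j) R" for a b
    using that assms(2) dp_invD(6,7)[OF assms(1), of a b] by auto
  with assms(1) show ?thesis
    unfolding dp_inv_def by blast
qed

text \<open>Along predecessors the index strictly decreases and every arc adds at most
  \<open>M\<close>. This keeps all table entries within a machine word.\<close>

lemma dp_inv_bounds:
  assumes "dp_inv A c N i d p e R" "\<And>a. a \<in> A \<Longrightarrow> c a \<le> M" "1 \<le> j" "j \<le> N"
  shows "d j \<le> j * M \<and> e j \<le> j \<and> p j \<le> j"
  using assms(3,4)
proof (induction j rule: less_induct)
  case (less j)
  show ?case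
  proof (cases "j = 1 \<or> e j = 0")
    case True
    then show ?thesis using dp_invD(1-4)[OF assms(1)] by auto
  next
    case False
    with less.prems dp_invD(5)[OF assms(1), of j] have *: "1 \<le> p j" "p j < j" "(p j, j) \<in> A" "e (p j) \<noteq> 0"
        "e j = Suc (e (p j))" "d j = d (p j) + c (p j, j)"
      by auto
    have "d (p j) \<le> p j * M \<and> e (p j) \<le> p j"
      using less.IH[of "p j"] * less.prems by simp
    moreover have "c (p j, j) \<le> M"
      using * assms(2) by blast
    moreover have "Suc (p j) * M \<le> j * M"
      using * by (intro mult_le_mono1) simp
    ultimately show ?thesis using * by simp
  qed
qed

definition "pruned_arcs C \<epsilon> T = arcs (pruned_graph C \<epsilon> T)"

lemma tail_pruned [simp]: "tail (pruned_graph C \<epsilon> T) = fst"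
  and head_pruned [simp]: "head (pruned_graph C \<epsilon> T) = snd"
  and verts_pruned [simp]: "verts (pruned_graph C \<epsilon> T) = {1..length T + 1}"
  by (simp_all add: pruned_graph_def text_graph_def)

lemma pruned_arcsD:
  assumes "(i, j) \<in> pruned_arcs C \<epsilon> T"
  shows "1 \<le> i" "i < j" "j \<le> length T + 1"
  using assms by (auto simp: pruned_arcs_def pruned_graph_def text_graph_def)

text \<open>Following predecessors from \<open>j\<close> back to 1 yields the walk. The clause on
  \<open>e\<close> pins every vertex to its place on it, and \<open>p (vs ! 0) = 0\<close> is the
  sentinel on which the output loop stops.\<close>

lemma dp_inv_chain:
  fixes c :: "nat \<times> nat \<Rightarrow> nat"
    and C :: "'a list \<Rightarrow> bool list" and \<epsilon> :: real and T :: "'a list"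
  defines "G \<equiv> pruned_graph C \<epsilon> T"
  assumes inv: "dp_inv (pruned_arcs C \<epsilon> T) c (length T + 1) i d p e R"
    and "1 \<le> j" "j \<le> length T + 1" "e j \<noteq> 0"
  shows "\<exists>vs w. pre_digraph.awalk G 1 w j \<and> vs = pre_digraph.awalk_verts G 1 w \<and>
           wf_digraph.awalk_cost (\<lambda>a. real (c a)) w = real (d j) \<and>
           length vs = e j \<and> vs ! (e j - 1) = j \<and> p (vs ! 0) = 0 \<and>
           (\<forall>q < e j. e (vs ! q) = Suc q \<and> vs ! q \<in> {1..length T + 1}) \<and>
           (\<forall>q. Suc q < e j \<longrightarrow> p (vs ! Suc q) = vs ! q)"
  using assms(3-5)
proof (induction j rule: less_induct)
  case (less j)
  interpret G: wf_digraph G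
    unfolding G_def by (rule wf_digraph_pruned_graph)
  have G [simp]: "tail G = fst" "head G = snd" "verts G = {1..length T + 1}"
      "arcs G = pruned_arcs C \<epsilon> T"
    by (simp_all add: G_def pruned_arcs_def)
  show ?case
  proof (cases "j = 1")
    case True
    with inv have "e j = 1" "p j = 0" "d j = 0" by (simp_all add: dp_inv_def)
    then show ?thesis
      using True by (intro exI[of _ "[1]"] exI[of _ "[]"])
        (auto simp: G.awalk_Nil_iff)
  next
    case False
    with less.prems dp_invD(5)[OF inv, of j] have *: "1 \<le> p j" "p j < j" "(p j, j) \<in> pruned_arcs C \<epsilon> T" "e (p j) \<noteq> 0"
        "e j = Suc (e (p j))" "d j = d (p j) + c (p j, j)"
      by auto
    from less.IH[of "p j"] * less.prems obtain vs w where
      vs: "G.awalk 1 w (p j)" "vs = G.awalk_verts 1 w"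
        "G.awalk_cost (\<lambda>a. real (c a)) w = real (d (p j))"
        "length vs = e (p j)" "vs ! (e (p j) - 1) = p j" "p (vs ! 0) = 0"
        "\<forall>q < e (p j). e (vs ! q) = Suc q \<and> vs ! q \<in> {1..length T + 1}"
        "\<forall>q. Suc q < e (p j) \<longrightarrow> p (vs ! Suc q) = vs ! q"
      by auto
    have arc: "G.awalk (p j) [(p j, j)] j"
      using * less.prems by (auto simp: G.awalk_simps)
    have walk: "G.awalk 1 (w @ [(p j, j)]) j"
      using vs(1) arc by (rule G.awalk_appendI)
    have verts: "G.awalk_verts 1 (w @ [(p j, j)]) = vs @ [j]"
      using G.awalk_verts_append[OF walk] vs(1,2) by simp
    show ?thesis
    proof (intro exI[of _ "vs @ [j]"] exI[of _ "w @ [(p j, j)]"] conjI)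
      show "\<forall>q. Suc q < e j \<longrightarrow> p ((vs @ [j]) ! Suc q) = (vs @ [j]) ! q"
      proof (intro allI impI)
        fix q assume "Suc q < e j"
        then consider "Suc q < e (p j)" | "e (p j) = Suc q" using * by linarith
        then show "p ((vs @ [j]) ! Suc q) = (vs @ [j]) ! q"
          using vs(4,5,8) by cases (auto simp: nth_append)
      qed
    qed (use walk verts vs * less.prems in \<open>auto simp: nth_append less_Suc_eq\<close>)
  qed
qed

text \<open>With every arc relaxed, \<open>d\<close> undercuts every walk: appending a last arc is
  exactly one relaxed inequality, hence the reverse induction.\<close>

lemma dp_inv_walk:
  fixes c :: "nat \<times> nat \<Rightarrow> nat"
    and C :: "'a list \<Rightarrow> bool list" and \<epsilon> :: real and T :: "'a list"
  defines "G \<equiv> pruned_graph C \<epsilon> T"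
  assumes inv: "dp_inv (pruned_arcs C \<epsilon> T) c N i d p e (pruned_arcs C \<epsilon> T)"
    and "pre_digraph.awalk G 1 w j"
  shows "e j \<noteq> 0 \<and> real (d j) \<le> wf_digraph.awalk_cost (\<lambda>a. real (c a)) w"
  using assms(3)
proof (induction w arbitrary: j rule: rev_induct)
  interpret G: wf_digraph G
    unfolding G_def by (rule wf_digraph_pruned_graph)
  have G [simp]: "tail G = fst" "head G = snd" "verts G = {1..length T + 1}"
      "arcs G = pruned_arcs C \<epsilon> T"
    by (simp_all add: G_def pruned_arcs_def)
  case Nil
  then show ?case using dp_invD(1,2)[OF inv] by (auto simp: G.awalk_Nil_iff)
next
  interpret G: wf_digraph G
    unfolding G_def by (rule wf_digraph_pruned_graph)
  have G [simp]: "tail G = fst" "head G = snd" "verts G = {1..length T + 1}"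
      "arcs G = pruned_arcs C \<epsilon> T"
    by (simp_all add: G_def pruned_arcs_def)
  case (snoc a w)
  obtain k where k: "a = (k, j)" and w: "G.awalk 1 w k" and a: "a \<in> arcs G"
    using snoc.prems by (cases a) (auto simp: G.awalk_simps)
  from dp_invD(7)[OF inv, of k j] a k
  have "e k \<noteq> 0 \<longrightarrow> e j \<noteq> 0 \<and> d j \<le> d k + c (k, j)"
    by auto
  with snoc.IH[OF w] show ?case by (auto simp: k)
qed

text \<open>The walk along the predecessors attains \<open>d\<close>, and no walk is cheaper, so it
  realises the infimum \<open>\<mu>\<close>. The additional conclusions are what the output loop
  relies on.\<close>

lemma dp_inv_shortest_path:
  fixes c :: "nat \<times> nat \<Rightarrow> nat"
  assumes inv: "dp_inv (pruned_arcs C \<epsilon> T) c (length T + 1) i d p e (pruned_arcs C \<epsilon> T)"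
    and "T \<noteq> []"
  obtains vs where "shortest_path (pruned_graph C \<epsilon> T) c 1 vs (length T + 1)"
    "length vs = e (length T + 1)" "0 < length vs" "last vs = length T + 1" "p (hd vs) = 0"
    "\<And>q. q < length vs \<Longrightarrow> e (vs ! q) = Suc q \<and> vs ! q \<in> {1..length T + 1}"
    "\<And>q. Suc q < length vs \<Longrightarrow> p (vs ! Suc q) = vs ! q"
proof -
  let ?G = "pruned_graph C \<epsilon> T" and ?n = "length T" and ?c = "\<lambda>a. real (c a)"
  interpret G: wf_digraph ?G by (rule wf_digraph_pruned_graph)
  \<comment> \<open>Arcs into the last vertex are never pruned, so the target is reached.\<close>
  have "(1, ?n + 1) \<in> arcs ?G"
    using \<open>T \<noteq> []\<close> by (cases T) (auto simp: pruned_graph_def text_graph_def)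
  then have "G.awalk 1 [(1, ?n + 1)] (?n + 1)"
    by (auto simp: G.awalk_simps)
  then have "e (?n + 1) \<noteq> 0"
    using dp_inv_walk[OF inv] by blast
  then obtain vs w where vs: "G.awalk 1 w (?n + 1)" "vs = G.awalk_verts 1 w"
      "G.awalk_cost ?c w = real (d (?n + 1))"
      "length vs = e (?n + 1)" "vs ! (e (?n + 1) - 1) = ?n + 1" "p (vs ! 0) = 0"
      "\<forall>q < e (?n + 1). e (vs ! q) = Suc q \<and> vs ! q \<in> {1..?n + 1}"
      "\<forall>q. Suc q < e (?n + 1) \<longrightarrow> p (vs ! Suc q) = vs ! q"
    using dp_inv_chain[OF inv, of "?n + 1"] by auto
  \<comment> \<open>The counts \<open>e\<close> along the walk are 1, 2, 3 and so on, so no vertex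
    repeats and the walk is a path.\<close>
  have "distinct vs"
    unfolding distinct_conv_nth using vs(4,7) by (metis Suc_inject)
  then have "G.apath 1 w (?n + 1)"
    using vs(1,2) by (simp add: G.apath_def)
  moreover have "G.\<mu> ?c 1 (?n + 1) = ereal (G.awalk_cost ?c w)"
    unfolding G.\<mu>_def
  proof (rule antisym)
    show "(INF p\<in>{p. G.awalk 1 p (?n + 1)}. ereal (G.awalk_cost ?c p)) \<le> ereal (G.awalk_cost ?c w)"
      using vs(1) by (auto intro: INF_lower)
    show "ereal (G.awalk_cost ?c w) \<le> (INF p\<in>{p. G.awalk 1 p (?n + 1)}. ereal (G.awalk_cost ?c p))"
      using dp_inv_walk[OF inv] vs(3) by (auto intro!: INF_greatest)
  qed
  ultimately have "shortest_path ?G c 1 vs (?n + 1)"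
    unfolding shortest_path_def using vs(2) by metis
  moreover have "0 < length vs" using vs(4) \<open>e (?n + 1) \<noteq> 0\<close> by simp
  moreover from this have "last vs = ?n + 1" "hd vs = vs ! 0"
    using vs(4,5) by (auto simp: last_conv_nth hd_conv_nth simp flip: length_greater_0_conv)
  ultimately show thesis
    using that[of vs] vs(4,6-8) by simp
qed

section \<open>Compressed sizes of substrings and the arcs of the pruned graph\<close>

lemma substr_antimono_sublist:
  assumes "1 \<le> i'" "i' \<le> i" "r \<le> r'"
  shows "sublist (substr T i r) (substr T i' r')"
proof -
  have "substr T i r = take (Suc r - i) (drop (i - i') (substr T i' r'))"
    using assms by (auto simp: substr_def drop_take min_def)
  then show ?thesis by (metis sublist_order.order_trans sublist_take sublist_drop)
qed

lemma substr_nonempty: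
  assumes "1 \<le> i" "i \<le> r" "r \<le> length T"
  shows "substr T i r \<noteq> []"
  using assms by (simp add: substr_def)

definition substr_cost where
  "substr_cost C T i r = length (C (substr T i r))"

lemma substr_cost_mono:
  assumes "monotone_compressor C" "1 \<le> i'" "i' \<le> i" "i \<le> r" "r \<le> r'" "r' \<le> length T"
  shows "substr_cost C T i r \<le> substr_cost C T i' r'"
  using assms substr_antimono_sublist[of i' i r r' T] substr_nonempty[of i r T]
  by (simp add: monotone_compressor_def substr_cost_def)

lemma substr_cost_le:
  assumes "monotone_compressor C" "1 \<le> i" "i \<le> r" "r \<le> length T"
  shows "substr_cost C T i r \<le> length (C T)"
  using assms substr_nonempty[of i r T]
  by (simp add: monotone_compressor_def substr_cost_def substr_def
      sublist_order.order_trans[OF sublist_take sublist_drop])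

lemma edge_cost_eq: "edge_cost C T (i, j) = substr_cost C T i (j - 1)"
  by (simp add: edge_cost_def substr_cost_def)

text \<open>Exponents must be positive, hence \<open>Suc k\<close>. The edge to \<open>j\<close>
  stands for the letters up to \<open>j - 1\<close>, so the cost that must exceed the power belongs
  to the substring ending at \<open>j\<close>.\<close>

lemma mem_pruned_arcs_iff:
  "(i, j) \<in> pruned_arcs C \<epsilon> T \<longleftrightarrow> 1 \<le> i \<and> i < j \<and> j \<le> length T + 1 \<and>
     (j = length T + 1 \<or> (\<exists>k. real (substr_cost C T i (j - 1)) \<le> (1 + \<epsilon>) ^ Suc k \<and>
        (1 + \<epsilon>) ^ Suc k < real (substr_cost C T i j)))"
  unfolding pruned_arcs_def pruned_graph_def text_graph_def
  by (auto simp: edge_cost_eq gr0_conv_Suc simp del: power_Suc)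

text \<open>Turns the rounded logarithm into comparisons with integer powers, the only kind that
  \<open>PowLe\<close> offers; the program finds the number of windows by counting up to the first
  power that reaches \<open>n\<close>.\<close>

lemma num_windows_le_iff:
  assumes "\<epsilon> > 0" "n \<ge> 1"
  shows "num_windows \<epsilon> n \<le> k \<longleftrightarrow> real n \<le> (1 + \<epsilon>) ^ k"
proof -
  have "num_windows \<epsilon> n \<le> k \<longleftrightarrow> log (1 + \<epsilon>) (real n) \<le> real k"
    unfolding num_windows_def by (simp add: nat_le_iff ceiling_le_iff)
  also have "\<dots> \<longleftrightarrow> real n \<le> (1 + \<epsilon>) powr real k"
    using assms by (simp add: log_le_iff)
  also have "\<dots> \<longleftrightarrow> real n \<le> (1 + \<epsilon>) ^ k"
    using assms by (simp add: powr_realpow)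
  finally show ?thesis .
qed

section \<open>Total correctness with time credits\<close>

text \<open>\<open>\<tau>\<close> is a supply of credits, one per step, and \<open>\<tau>'\<close>
  is what is left. The inequality allows credits to be discarded, so generous round constants can be
  used throughout.\<close>

definition wp ::
    "('a, 's) window_ds \<Rightarrow> 'a list \<Rightarrow> real \<Rightarrow> nat \<Rightarrow> nat \<Rightarrow> com \<Rightarrow>
     ('s state \<Rightarrow> real \<Rightarrow> bool) \<Rightarrow> 's state \<Rightarrow> real \<Rightarrow> bool" where
  "wp D T \<epsilon> W S c P \<sigma> \<tau> \<longleftrightarrow>
     (\<exists>t \<sigma>' \<tau>'. exec D T \<epsilon> W S c \<sigma> t \<sigma>' \<and> 0 \<le> \<tau>' \<and> real t + \<tau>' \<le> \<tau> \<and> P \<sigma>' \<tau>')"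

lemma wpI:
  assumes "exec D T \<epsilon> W S c \<sigma> t \<sigma>'" "real t + \<tau>' \<le> \<tau>" "0 \<le> \<tau>'" "P \<sigma>' \<tau>'"
  shows "wp D T \<epsilon> W S c P \<sigma> \<tau>"
  using assms unfolding wp_def by (intro exI conjI)

lemma wpE:
  assumes "wp D T \<epsilon> W S c P \<sigma> \<tau>"
  obtains t \<sigma>' \<tau>' where "exec D T \<epsilon> W S c \<sigma> t \<sigma>'" "real t + \<tau>' \<le> \<tau>" "0 \<le> \<tau>'" "P \<sigma>' \<tau>'"
  using assms unfolding wp_def by (elim exE conjE)

lemma wp_mono:
  assumes "wp D T \<epsilon> W S c P \<sigma> \<tau>" "\<And>\<sigma>' \<tau>'. P \<sigma>' \<tau>' \<Longrightarrow> 0 \<le> \<tau>' \<Longrightarrow> P' \<sigma>' \<tau>'"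
  shows "wp D T \<epsilon> W S c P' \<sigma> \<tau>"
  using assms(1) by (rule wpE) (blast intro: wpI assms(2))

lemma wp_Skip:
  assumes "1 \<le> \<tau>" "P \<sigma> (\<tau> - 1)"
  shows "wp D T \<epsilon> W S Skip P \<sigma> \<tau>"
  by (rule wpI[where P = P, OF exec.Skip _ _ assms(2)]) (use assms(1) in simp_all)

lemma wp_Assign:
  assumes "asafe W S \<sigma> a" "real (1 + acost a) \<le> \<tau>"
    and "P (\<sigma>\<lparr>regs := (regs \<sigma>)(x := aval \<sigma> a)\<rparr>) (\<tau> - real (1 + acost a))"
  shows "wp D T \<epsilon> W S (Assign x a) P \<sigma> \<tau>"
  by (rule wpI[where P = P, OF exec.Assign[OF assms(1)] _ _ assms(3)]) (use assms in simp_all)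

lemma wp_Store:
  assumes "asafe W S \<sigma> a" "asafe W S \<sigma> b" "aval \<sigma> a < S" "real (1 + acost a + acost b) \<le> \<tau>"
    and "P (\<sigma>\<lparr>mem := (mem \<sigma>)(aval \<sigma> a := aval \<sigma> b)\<rparr>) (\<tau> - real (1 + acost a + acost b))"
  shows "wp D T \<epsilon> W S (Store a b) P \<sigma> \<tau>"
  by (rule wpI[where P = P, OF exec.Store[OF assms(1-3)] _ _ assms(5)]) (use assms in simp_all)

lemma wp_Seq:
  assumes "wp D T \<epsilon> W S c\<^sub>1 (wp D T \<epsilon> W S c\<^sub>2 P) \<sigma> \<tau>"
  shows "wp D T \<epsilon> W S (Seq c\<^sub>1 c\<^sub>2) P \<sigma> \<tau>"
proof -
  from assms obtain t \<sigma>' \<tau>' u \<sigma>'' \<tau>'' where *: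
    "exec D T \<epsilon> W S c\<^sub>1 \<sigma> t \<sigma>'" "real t + \<tau>' \<le> \<tau>"
    "exec D T \<epsilon> W S c\<^sub>2 \<sigma>' u \<sigma>''" "real u + \<tau>'' \<le> \<tau>'" "0 \<le> \<tau>''" "P \<sigma>'' \<tau>''"
    by (elim wpE)
  from * show ?thesis
    by (intro wpI[where P = P, OF exec.Seq[OF *(1,3)] _ *(5,6)]) simp
qed

lemma wp_If:
  assumes "bsafe W S \<sigma> b" "real (1 + bcost b) \<le> \<tau>"
    and "bval \<epsilon> \<sigma> b \<Longrightarrow> wp D T \<epsilon> W S c\<^sub>1 P \<sigma> (\<tau> - real (1 + bcost b))"
    and "\<not> bval \<epsilon> \<sigma> b \<Longrightarrow> wp D T \<epsilon> W S c\<^sub>2 P \<sigma> (\<tau> - real (1 + bcost b))"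
  shows "wp D T \<epsilon> W S (If b c\<^sub>1 c\<^sub>2) P \<sigma> \<tau>"
proof (cases "bval \<epsilon> \<sigma> b")
  case True
  from assms(3)[OF True] show ?thesis
  proof (rule wpE)
    fix t \<sigma>' \<tau>'
    assume *: "exec D T \<epsilon> W S c\<^sub>1 \<sigma> t \<sigma>'" "real t + \<tau>' \<le> \<tau> - real (1 + bcost b)"
      "0 \<le> \<tau>'" "P \<sigma>' \<tau>'"
    then show ?thesis
      by (intro wpI[where P = P, OF exec.IfTrue[OF assms(1) True *(1)] _ *(3,4)]) simp
  qed
next
  case False
  from assms(4)[OF False] show ?thesis
  proof (rule wpE)
    fix t \<sigma>' \<tau>'
    assume *: "exec D T \<epsilon> W S c\<^sub>2 \<sigma> t \<sigma>'" "real t + \<tau>' \<le> \<tau> - real (1 + bcost b)"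
      "0 \<le> \<tau>'" "P \<sigma>' \<tau>'"
    then show ?thesis
      by (intro wpI[where P = P, OF exec.IfFalse[OF assms(1) False *(1)] _ *(3,4)]) simp
  qed
qed

text \<open>No variant is needed: every iteration spends at least one credit.\<close>

lemma wp_While:
  assumes "I \<sigma> \<tau>" "0 \<le> \<tau>"
    and safe: "\<And>\<sigma> \<tau>. I \<sigma> \<tau> \<Longrightarrow> 0 \<le> \<tau> \<Longrightarrow> bsafe W S \<sigma> b \<and> real (1 + bcost b) \<le> \<tau>"
    and body: "\<And>\<sigma> \<tau>. I \<sigma> \<tau> \<Longrightarrow> 0 \<le> \<tau> \<Longrightarrow> bval \<epsilon> \<sigma> b \<Longrightarrow>
        wp D T \<epsilon> W S c I \<sigma> (\<tau> - real (1 + bcost b))"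
    and exit: "\<And>\<sigma> \<tau>. I \<sigma> \<tau> \<Longrightarrow> 0 \<le> \<tau> \<Longrightarrow> \<not> bval \<epsilon> \<sigma> b \<Longrightarrow> P \<sigma> (\<tau> - real (1 + bcost b))"
  shows "wp D T \<epsilon> W S (While b c) P \<sigma> \<tau>"
  using assms(1,2)
proof (induction "nat \<lfloor>\<tau>\<rfloor>" arbitrary: \<sigma> \<tau> rule: less_induct)
  case less
  note sf = safe[OF less.prems]
  show ?case
  proof (cases "bval \<epsilon> \<sigma> b")
    case False
    from sf show ?thesis
      by (intro wpI[where P = P, OF exec.WhileFalse[OF _ False] _ _ exit[OF less.prems False]]) simp_all
  next
    case True
    from body[OF less.prems True] obtain t \<sigma>' \<tau>' where *: "exec D T \<epsilon> W S c \<sigma> t \<sigma>'"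
      "real t + \<tau>' \<le> \<tau> - real (1 + bcost b)" "0 \<le> \<tau>'" "I \<sigma>' \<tau>'"
      by (rule wpE)
    have "\<tau>' + 1 \<le> \<tau>" using *(2) by simp
    then have "\<lfloor>\<tau>'\<rfloor> < \<lfloor>\<tau>\<rfloor>" "0 \<le> \<lfloor>\<tau>'\<rfloor>" using *(3) by linarith+
    then have "nat \<lfloor>\<tau>'\<rfloor> < nat \<lfloor>\<tau>\<rfloor>" by (simp only: nat_less_eq_zless)
    from less.hyps[OF this *(4,3)] obtain u \<sigma>'' \<tau>'' where
      **: "exec D T \<epsilon> W S (While b c) \<sigma>' u \<sigma>''" "real u + \<tau>'' \<le> \<tau>'" "0 \<le> \<tau>''" "P \<sigma>'' \<tau>''"
      by (rule wpE)
    show ?thesis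
      by (rule wpI[where P = P, OF exec.WhileTrue[OF _ True *(1) **(1)] _ **(3,4)])
         (use sf *(2) **(2) in simp_all)
  qed
qed

text \<open>How long an operation of the black box really takes is known only up to a bound, so
  \<open>B\<close> is charged and the surplus dropped. The rules for the other three operations do
  the same.\<close>

lemma wp_New:
  assumes "asafe W S \<sigma> h" "ds_new D T = (s, time)" "fits D S ((inst \<sigma>)(aval \<sigma> h \<mapsto> s))"
    and "real (1 + acost h) + B \<le> \<tau>" "real time \<le> B"
    and "P (\<sigma>\<lparr>inst := (inst \<sigma>)(aval \<sigma> h \<mapsto> s)\<rparr>) (\<tau> - (real (1 + acost h) + B))"
  shows "wp D T \<epsilon> W S (New h) P \<sigma> \<tau>"
  by (rule wpI[where P = P, OF exec.New[OF assms(1,2) refl assms(3)] _ _ assms(6)]) (use assms in simp_all)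

lemma wp_Remove:
  assumes "asafe W S \<sigma> h" "inst \<sigma> (aval \<sigma> h) = Some s" "ds_remove D s = (s', time)"
    and "fits D S ((inst \<sigma>)(aval \<sigma> h \<mapsto> s'))"
    and "real (1 + acost h) + B \<le> \<tau>" "real time \<le> B"
    and "P (\<sigma>\<lparr>inst := (inst \<sigma>)(aval \<sigma> h \<mapsto> s')\<rparr>) (\<tau> - (real (1 + acost h) + B))"
  shows "wp D T \<epsilon> W S (Remove h) P \<sigma> \<tau>"
  by (rule wpI[where P = P, OF exec.Remove[OF assms(1-3) refl assms(4)] _ _ assms(7)]) (use assms in simp_all)

lemma wp_Append:
  assumes "asafe W S \<sigma> h" "asafe W S \<sigma> a" "inst \<sigma> (aval \<sigma> h) = Some s"
    and "ds_append D (aval \<sigma> a) s = (s', time)"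
    and "fits D S ((inst \<sigma>)(aval \<sigma> h \<mapsto> s'))"
    and "real (1 + acost h + acost a) + B \<le> \<tau>" "real time \<le> B"
    and "P (\<sigma>\<lparr>inst := (inst \<sigma>)(aval \<sigma> h \<mapsto> s')\<rparr>) (\<tau> - (real (1 + acost h + acost a) + B))"
  shows "wp D T \<epsilon> W S (Append h a) P \<sigma> \<tau>"
  by (rule wpI[where P = P, OF exec.Append[OF assms(1-4) refl assms(5)] _ _ assms(8)]) (use assms in simp_all)

lemma wp_Length:
  assumes "asafe W S \<sigma> h" "asafe W S \<sigma> a" "inst \<sigma> (aval \<sigma> h) = Some s"
    and "ds_length D (aval \<sigma> a) s = (k, s', time)" "k \<le> W"
    and "fits D S ((inst \<sigma>)(aval \<sigma> h \<mapsto> s'))"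
    and "real (1 + acost h + acost a) + B \<le> \<tau>" "real time \<le> B"
    and "P (\<sigma>\<lparr>regs := (regs \<sigma>)(x := k), inst := (inst \<sigma>)(aval \<sigma> h \<mapsto> s')\<rparr>)
           (\<tau> - (real (1 + acost h + acost a) + B))"
  shows "wp D T \<epsilon> W S (Length x h a) P \<sigma> \<tau>"
  by (rule wpI[where P = P, OF exec.Length[OF assms(1-5) refl assms(6)] _ _ assms(9)]) (use assms in simp_all)

section \<open>The window positions\<close>

text \<open>The windows are treated here as mere right ends, without a machine. \<open>m\<close> is
  the number of windows of one instance and \<open>Q\<close> the number of powers, a multiple of
  \<open>m\<close> so that the powers fill whole instances; \<open>top_power\<close> makes the last
  power a bound on all costs.\<close>

locale window_positions =
  fixes C :: "'a list \<Rightarrow> bool list" and \<epsilon> :: real and T :: "'a list"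
    and n m Q :: nat
  assumes mono_C: "monotone_compressor C" and eps_pos: "\<epsilon> > 0" and n_def: "n = length T"
    and m_pos: "1 \<le> m" and m_dvd_Q: "m dvd Q" and Q_pos: "1 \<le> Q"
    and top_power: "real (length (C T)) \<le> (1 + \<epsilon>) ^ Q"
begin

abbreviation "cst \<equiv> substr_cost C T"
abbreviation "A \<equiv> pruned_arcs C \<epsilon> T"
definition "pw k = (1 + \<epsilon>) ^ Suc k"

lemma pw_strict_mono: "k < k' \<Longrightarrow> pw k < pw k'"
  unfolding pw_def using eps_pos by (intro power_strict_increasing) auto

lemma cst_mono: "\<lbrakk>1 \<le> i'; i' \<le> i; i \<le> r; r \<le> r'; r' \<le> n\<rbrakk> \<Longrightarrow> cst i r \<le> cst i' r'"
  using substr_cost_mono[OF mono_C] n_def by simp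

lemma cst_le: "\<lbrakk>1 \<le> i; i \<le> r; r \<le> n\<rbrakk> \<Longrightarrow> cst i r \<le> length (C T)"
  using substr_cost_le[OF mono_C] n_def by simp

lemma mem_A_iff:
  "(i, j) \<in> A \<longleftrightarrow> 1 \<le> i \<and> i < j \<and> j \<le> n + 1 \<and>
     (j = n + 1 \<or> (\<exists>k. real (cst i (j - 1)) \<le> pw k \<and> pw k < real (cst i j)))"
  unfolding mem_pruned_arcs_iff n_def pw_def by (rule refl)

text \<open>
  Window \<open>k < Q\<close> belongs to the power \<open>Suc k\<close> and stops at the first position where the cost
  exceeds it.  As it is then too long by one letter, window \<open>Q + k\<close> stays one letter behind it,
  so that the cost of the edge can be queried.
\<close>

definition lead_done where
  "lead_done i p k \<longleftrightarrow> i \<le> p k \<and> (p k = n \<or> pw k < real (cst i (p k)))"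

text \<open>Powers are handled downwards: indices from \<open>k\<close> on are finished for the
  start \<open>i\<close>, smaller ones may still stand where the previous start left them, possibly
  empty. The \<open>max i\<close> keeps a lagging window nonempty even if the first letter alone
  exceeds the power; otherwise a removal would not be allowed.\<close>

definition win_inv where
  "win_inv i k p \<longleftrightarrow> (\<forall>k' < Q. p k' \<le> n \<and> i \<le> Suc (p k') \<and>
     (\<forall>r. i \<le> r \<and> r < p k' \<longrightarrow> real (cst i r) \<le> pw k') \<and>
     p (Q + k') \<le> max i (p k' - 1) \<and> i \<le> Suc (p (Q + k')) \<and>
     (k \<le> k' \<longrightarrow> lead_done i p k' \<and> p (Q + k') = max i (p k' - 1)))"

lemma win_invD:
  assumes "win_inv i k p" "k' < Q"
  shows "p k' \<le> n" "i \<le> Suc (p k')" "p (Q + k') \<le> max i (p k' - 1)" "i \<le> Suc (p (Q + k'))"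
    and "\<lbrakk>i \<le> r; r < p k'\<rbrakk> \<Longrightarrow> real (cst i r) \<le> pw k'"
    and "k \<le> k' \<Longrightarrow> lead_done i p k'"
    and "k \<le> k' \<Longrightarrow> p (Q + k') = max i (p k' - 1)"
  using assms unfolding win_inv_def by blast+

text \<open>If window \<open>k'\<close> reached beyond \<open>p k''\<close>, the cost at
  \<open>p k''\<close> would be at most \<open>pw k'\<close>; but the finished window
  \<open>k''\<close> stopped there before the end of the text because the cost exceeds the larger
  \<open>pw k''\<close>.\<close>

lemma lead_done_mono:
  assumes "win_inv i k p" "k' < k''" "k'' < Q" "lead_done i p k''" "1 \<le> i"
  shows "p k' \<le> p k''"
proof (rule ccontr)
  assume *: "\<not> p k' \<le> p k''"
  have "i \<le> p k''" "p k'' < n" "pw k'' < real (cst i (p k''))"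
    using assms(2-4) * win_invD(1)[OF assms(1), of k'] by (auto simp: lead_done_def)
  moreover have "real (cst i (p k'')) \<le> pw k'"
    using * assms(2,3) calculation(1) by (intro win_invD(5)[OF assms(1)]) auto
  ultimately show False using pw_strict_mono[OF assms(2)] by simp
qed

text \<open>The next window of the same instance belongs to the next power: since \<open>m\<close>
  divides \<open>Q\<close>, no instance mixes leading and lagging windows.\<close>

lemma Suc_mod_less:
  assumes "k < Q" "Suc (k mod m) < m"
  shows "Suc k < Q"
proof (rule ccontr)
  assume "\<not> Suc k < Q"
  with assms(1) have "Suc k = Q" by simp
  then have "Suc k mod m = 0" using m_dvd_Q by simp
  then show False using assms(2) by (simp add: mod_Suc split: if_splits)
qed

text \<open>The second claim is the order that an append must respect. Equal right ends are
  impossible: the cost there would be at most \<open>pw k\<close>, yet above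
  \<open>pw (Suc k)\<close> because the finished window \<open>Suc k\<close> stopped before
  \<open>n\<close>.\<close>

lemma lead_step:
  assumes inv: "win_inv i (Suc k) p" and k: "k < Q" and "p k < n" "1 \<le> i" "i \<le> n"
    and adv: "p k < i \<or> real (cst i (p k)) \<le> pw k"
  shows "win_inv i (Suc k) (p(k := Suc (p k)))"
    and "Suc (k mod m) < m \<Longrightarrow> p k < p (Suc k)"
proof -
  let ?p = "p(k := Suc (p k))"
  have "real (cst i r) \<le> pw k" if "i \<le> r" "r < Suc (p k)" for r
  proof (cases "r = p k")
    case True
    with that adv show ?thesis by auto
  next
    case False
    with that show ?thesis using win_invD(5)[OF inv k, of r] by simp
  qed
  moreover have "p (Q + k) \<le> max i (Suc (p k) - 1)"
    using win_invD(3)[OF inv k] by (auto simp: le_max_iff_disj)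
  ultimately show "win_inv i (Suc k) ?p"
    using inv k \<open>p k < n\<close> unfolding win_inv_def lead_done_def by auto
  assume "Suc (k mod m) < m"
  then have Sk: "Suc k < Q" by (rule Suc_mod_less[OF k])
  note ld = win_invD(6)[OF inv Sk order_refl]
  then have "p k \<le> p (Suc k)"
    using lead_done_mono[OF inv, of k "Suc k"] Sk \<open>1 \<le> i\<close> by simp
  moreover have "p k \<noteq> p (Suc k)"
  proof
    assume eq: "p k = p (Suc k)"
    with adv ld have "real (cst i (p k)) \<le> pw k" by (auto simp: lead_done_def)
    moreover have "pw (Suc k) < real (cst i (p k))"
      using ld eq \<open>p k < n\<close> by (auto simp: lead_done_def)
    ultimately show False using pw_strict_mono[of k "Suc k"] by simp
  qed
  ultimately show "p k < p (Suc k)" by simp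
qed

text \<open>The order needed for the append is inherited from the leading windows: the goal
  \<open>max i (p k - 1)\<close> is at most that of the next power, where the next lagging window
  already stands.\<close>

lemma lag_step:
  assumes inv: "win_inv i (Suc k) p" and k: "k < Q" and "1 \<le> i" "i \<le> n"
    and "lead_done i p k" "p (Q + k) < max i (p k - 1)"
  shows "win_inv i (Suc k) (p(Q + k := Suc (p (Q + k))))"
    and "Suc ((Q + k) mod m) < m \<Longrightarrow> p (Q + k) < p (Suc (Q + k))"
    and "p (Q + k) < n"
proof -
  let ?p = "p(Q + k := Suc (p (Q + k)))"
  show "win_inv i (Suc k) ?p"
    using inv k assms(6) unfolding win_inv_def lead_done_def by auto
  show "p (Q + k) < n"
    using assms(4,6) win_invD(1)[OF inv k] by linarith
  assume "Suc ((Q + k) mod m) < m"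
  moreover have "(Q + k) mod m = k mod m" using m_dvd_Q by (auto simp: dvd_def)
  ultimately have Sk: "Suc k < Q" using Suc_mod_less[OF k] by simp
  have "p k \<le> p (Suc k)"
    using lead_done_mono[OF inv, of k "Suc k"] Sk \<open>1 \<le> i\<close> win_invD(6)[OF inv Sk order_refl] by simp
  moreover have "p (Suc (Q + k)) = max i (p (Suc k) - 1)"
    using win_invD(7)[OF inv Sk] by simp
  ultimately show "p (Q + k) < p (Suc (Q + k))" using assms(6) by linarith
qed

lemma win_inv_done:
  assumes inv: "win_inv i (Suc k) p" and "k < Q" "lead_done i p k" "max i (p k - 1) \<le> p (Q + k)"
  shows "win_inv i k p"
proof -
  have "lead_done i p k' \<and> p (Q + k') = max i (p k' - 1)" if "k' < Q" "k \<le> k'" for k'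
  proof (cases "k' = k")
    case True
    with assms(3) le_antisym[OF win_invD(3)[OF inv \<open>k < Q\<close>] assms(4)] show ?thesis by simp
  next
    case False
    with that have "Suc k \<le> k'" by simp
    with win_invD(6,7)[OF inv that(1)] show ?thesis by simp
  qed
  with inv show ?thesis unfolding win_inv_def by blast
qed

text \<open>Nonempty windows are the precondition for removing the first letter.\<close>

lemma win_inv_ge:
  assumes "win_inv i 0 p" "k < 2 * Q"
  shows "i \<le> p k"
proof (cases "k < Q")
  case True
  with win_invD(6)[OF assms(1)] show ?thesis by (simp add: lead_done_def)
next
  case False
  with assms(2) win_invD(7)[OF assms(1), of "k - Q"] show ?thesis by simp
qed

text \<open>Dropping the first letter can only lower costs, so the bounds for all shorter windows
  survive and no right end has to move back. This is where monotonicity of the compressor pays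
  off.\<close>

lemma win_inv_next:
  assumes inv: "win_inv i 0 p" and "1 \<le> i"
  shows "win_inv (Suc i) Q p"
  unfolding win_inv_def
proof (intro allI impI conjI)
  fix k assume k: "k < Q"
  note D = win_invD[OF inv k]
  show "p k \<le> n" "p (Q + k) \<le> max (Suc i) (p k - 1)" using D by auto
  show "Suc i \<le> Suc (p k)" "Suc i \<le> Suc (p (Q + k))"
    using win_inv_ge[OF inv] k by auto
  fix r assume r: "Suc i \<le> r \<and> r < p k"
  then have "cst (Suc i) r \<le> cst i r"
    using \<open>1 \<le> i\<close> D(1) by (intro cst_mono) auto
  with D(5)[of r] r show "real (cst (Suc i) r) \<le> pw k" by simp
qed simp_all

lemma win_inv_init: "win_inv 1 Q (\<lambda>_. 0)"
  by (simp add: win_inv_def)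

text \<open>The share of the arcs leaving \<open>i\<close> for which the windows from
  \<open>k\<close> on are responsible. The arc to \<open>n + 1\<close> is due as soon as
  \<open>k < Q\<close>, because the topmost window, handled first, always produces it.\<close>

definition arcs_from where
  "arcs_from i k = {(a, j). a = i \<and> (a, j) \<in> A \<and>
     (j = n + 1 \<and> k < Q \<or>
      (\<exists>k' < Q. k \<le> k' \<and> j \<le> n \<and> real (cst i (j - 1)) \<le> pw k' \<and> pw k' < real (cst i j)))}"

lemma arcs_from_Q: "arcs_from i Q = {}"
  by (auto simp: arcs_from_def)

lemma arcs_from_0: "arcs_from i 0 = {(a, j). a = i \<and> (a, j) \<in> A}"
proof -
  have "j = n + 1 \<or> (\<exists>k < Q. j \<le> n \<and> real (cst i (j - 1)) \<le> pw k \<and> pw k < real (cst i j))"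
    if "(i, j) \<in> A" for j
  proof (cases "j = n + 1")
    case False
    with that obtain k where k: "real (cst i (j - 1)) \<le> pw k" "pw k < real (cst i j)"
      and j: "1 \<le> i" "i < j" "j \<le> n"
      by (auto simp: mem_A_iff)
    \<comment> \<open>A power below some cost lies below the top power, so its window is among the
      \<open>Q\<close> that exist.\<close>
    from j have "real (cst i j) \<le> (1 + \<epsilon>) ^ Q"
      using cst_le[of i j] top_power by linarith
    with k have "(1 + \<epsilon>) ^ Suc k < (1 + \<epsilon>) ^ Q" by (simp add: pw_def)
    then have "k < Q" using eps_pos by (subst (asm) power_strict_increasing_iff) auto
    with k j show ?thesis by auto
  qed simp
  then show ?thesis unfolding arcs_from_def using Q_pos by auto
qed

text \<open>A finished window still within its power has reached the end of the text and stands for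
  the arc to \<open>n + 1\<close>. Otherwise the head is \<open>p k\<close> and not its successor,
  because an arc to \<open>j\<close> covers only the letters up to \<open>j - 1\<close>.\<close>

definition target where
  "target i p k = (if real (cst i (p k)) \<le> pw k then n + 1 else p k)"

lemma lead_done_last:
  assumes "lead_done i p k" "real (cst i (p k)) \<le> pw k"
  shows "p k = n"
  using assms by (auto simp: lead_done_def)

text \<open>\<open>i < target i p k\<close> excludes the case that the first letter alone exceeds
  the power, where there is no arc. If the head is \<open>p k\<close>, it also turns
  \<open>max i (p k - 1)\<close> into \<open>p k - 1\<close>, so the lagging window is exactly the
  substring of the arc.\<close>

lemma target_arc:
  assumes inv: "win_inv i k p" and k: "k < Q" and "1 \<le> i" "i \<le> n" "i < target i p k"
  shows "(i, target i p k) \<in> A"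
    and "edge_cost C T (i, target i p k) =
           (if real (cst i (p k)) \<le> pw k then cst i (p k) else cst i (p (Q + k)))"
proof -
  note D = win_invD[OF inv k]
  show "edge_cost C T (i, target i p k) =
           (if real (cst i (p k)) \<le> pw k then cst i (p k) else cst i (p (Q + k)))"
    using D(7) lead_done_last[OF D(6)] assms(5) by (auto simp: target_def edge_cost_eq max_def)
  show "(i, target i p k) \<in> A"
  proof (cases "real (cst i (p k)) \<le> pw k")
    case True
    with assms show ?thesis by (simp add: target_def mem_A_iff)
  next
    case False
    with assms have "i < p k" by (simp add: target_def)
    then have "real (cst i (p k - 1)) \<le> pw k" using D(5)[of "p k - 1"] by simp
    with False \<open>i < p k\<close> D(1) \<open>1 \<le> i\<close> show ?thesis
      by (auto simp: target_def mem_A_iff not_le)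
  qed
qed

text \<open>A window reveals at most one new arc: the cost at a position before \<open>p k\<close>
  does not exceed the power, and a head after \<open>p k\<close> would mean that the window stopped
  within its power before the end of the text.\<close>

lemma arcs_from_step:
  assumes inv: "win_inv i k p" and k: "k < Q" and "1 \<le> i" "i \<le> n"
  shows "arcs_from i k \<subseteq> insert (i, target i p k) (arcs_from i (Suc k))"
    and "target i p k \<le> i \<Longrightarrow> arcs_from i k \<subseteq> arcs_from i (Suc k)"
proof -
  note D = win_invD[OF inv k]
  have *: "(i, j) \<in> arcs_from i (Suc k) \<or> j = target i p k" if "(i, j) \<in> arcs_from i k" for j
  proof (cases "j = n + 1")
    case True
    show ?thesis
    proof (cases "Suc k < Q")
      case True
      with \<open>j = n + 1\<close> that show ?thesis by (auto simp: arcs_from_def)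
    next
      case False
      \<comment> \<open>Only the top window has to account for the arc to \<open>n + 1\<close>; its
        power bounds all costs, so its target is \<open>n + 1\<close>.\<close>
      with k have "Q = Suc k" by simp
      then have "pw k = (1 + \<epsilon>) ^ Q"
        by (simp add: pw_def)
      moreover have "cst i (p k) \<le> length (C T)"
        using D(1,6) \<open>1 \<le> i\<close> by (intro cst_le) (auto simp: lead_done_def)
      ultimately show ?thesis using top_power True by (simp add: target_def)
    qed
  next
    case False
    with that obtain k' where k': "k' < Q" "k \<le> k'" "j \<le> n" "real (cst i (j - 1)) \<le> pw k'"
        "pw k' < real (cst i j)" and "(i, j) \<in> A"
      by (auto simp: arcs_from_def)
    show ?thesis
    proof (cases "k' = k")
      case False
      with k' \<open>(i, j) \<in> A\<close> show ?thesis by (auto simp: arcs_from_def)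
    next
      case True
      have "i < j" using \<open>(i, j) \<in> A\<close> by (rule pruned_arcsD)
      have "\<not> j < p k" using D(5)[of j] k'(5) \<open>i < j\<close> True by auto
      moreover have "\<not> p k < j"
      proof
        assume "p k < j"
        then have "cst i (p k) \<le> cst i (j - 1)"
          using D(6) k'(3) \<open>1 \<le> i\<close> by (intro cst_mono) (auto simp: lead_done_def)
        with k'(4) True lead_done_last[OF D(6)] \<open>p k < j\<close> k'(3) show False by auto
      qed
      ultimately show ?thesis using k'(5) True by (simp add: target_def)
    qed
  qed
  have **: "a = i \<and> i < j" if "(a, j) \<in> arcs_from i k" for a j
    using that pruned_arcsD(2) by (auto simp: arcs_from_def)
  show "arcs_from i k \<subseteq> insert (i, target i p k) (arcs_from i (Suc k))"
    using * ** by auto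
  assume "target i p k \<le> i"
  show "arcs_from i k \<subseteq> arcs_from i (Suc k)"
  proof (rule subrelI)
    fix a j assume "(a, j) \<in> arcs_from i k"
    with * ** \<open>target i p k \<le> i\<close> show "(a, j) \<in> arcs_from i (Suc k)" by fastforce
  qed
qed

text \<open>The number of appends still possible. Each append lowers it by one and nothing raises
  it, so all appends can be prepaid.\<close>

definition "potential p = real (\<Sum>k < 2 * Q. n - p k)"

lemma potential_step:
  assumes "k < 2 * Q" "p k < n"
  shows "potential (p(k := Suc (p k))) + 1 = potential p"
proof -
  have "(\<Sum>k' < 2 * Q. n - p k') = (n - p k) + (\<Sum>k' \<in> {..<2 * Q} - {k}. n - p k')"
    using assms(1) by (subst sum.remove[of _ k]) auto
  moreover have "(\<Sum>k' < 2 * Q. n - (p(k := Suc (p k))) k') =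
      (n - Suc (p k)) + (\<Sum>k' \<in> {..<2 * Q} - {k}. n - p k')"
    using assms(1) by (subst sum.remove[of _ k]) auto
  ultimately show ?thesis using assms(2) by (simp add: potential_def)
qed

lemma potential_nonneg: "0 \<le> potential p"
  unfolding potential_def by (rule of_nat_0_le_iff)

end

section \<open>The program\<close>

text \<open>
  The array memory holds four interleaved arrays behind the cells \<open>0..n\<close> of the output: the
  distances, the predecessors, the numbers of vertices on the paths (0 for vertices not reached
  so far) and the positions of the windows.  Registers: 0 holds \<open>n\<close>, 1 the number of windows of
  an instance, 2 the number of powers, 3 the current vertex, 4 a window or handle, 5 and 6 the
  queried costs, 7 the head of the current edge.
\<close>

definition cell :: "nat \<Rightarrow> nat \<Rightarrow> nat \<Rightarrow> nat" where
  "cell n a j = n + (4 * j + Suc a)"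

lemma cell_inject: "\<lbrakk>a < 4; b < 4\<rbrakk> \<Longrightarrow> cell n a j = cell n b k \<longleftrightarrow> a = b \<and> j = k"
  unfolding cell_def by presburger

lemma cell_gt: "n < cell n a j"
  by (simp add: cell_def)

definition elem :: "nat \<Rightarrow> aexp \<Rightarrow> aexp" where
  "elem a e = Add (Reg 0) (Add (Mul (Const 4) e) (Const (Suc a)))"

abbreviation "dist_at e \<equiv> Mem (elem 0 e)"
abbreviation "pred_at e \<equiv> Mem (elem 1 e)"
abbreviation "count_at e \<equiv> Mem (elem 2 e)"
abbreviation "pos_at e \<equiv> Mem (elem 3 e)"

lemma aval_elem [simp]: "aval \<sigma> (elem a e) = cell (regs \<sigma> 0) a (aval \<sigma> e)"
  by (simp add: elem_def cell_def)

lemma acost_elem [simp]: "acost (elem a e) = 6 + acost e"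
  by (simp add: elem_def)

text \<open>Window \<open>k\<close> is number \<open>Suc (k mod m)\<close> of instance
  \<open>k div m\<close>. As \<open>Q = H * m\<close>, the lagging windows occupy the upper half of
  the \<open>2 * H\<close> instances.\<close>

definition handle_of :: "aexp \<Rightarrow> aexp" where
  "handle_of e = Div e (Reg 1)"

definition index_of :: "aexp \<Rightarrow> aexp" where
  "index_of e = Add (Sub e (Mul (Reg 1) (Div e (Reg 1)))) (Const 1)"

lemma aval_handle_of [simp]: "aval \<sigma> (handle_of e) = aval \<sigma> e div regs \<sigma> 1"
  by (simp add: handle_of_def)

lemma aval_index_of [simp]: "aval \<sigma> (index_of e) = Suc (aval \<sigma> e mod regs \<sigma> 1)"
  by (simp add: index_of_def minus_mult_div_eq_mod)

lemma acost_handle_of [simp]: "acost (handle_of e) = 2 + acost e"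
  and acost_index_of [simp]: "acost (index_of e) = 7 + 2 * acost e"
  by (simp_all add: handle_of_def index_of_def)

text \<open>The data structure does not report right ends, so they are mirrored in memory.\<close>

definition append_win :: "aexp \<Rightarrow> com" where
  "append_win e = Seq (Append (handle_of e) (index_of e)) (Store (elem 3 e) (Add (pos_at e) (Const 1)))"

definition length_win :: "nat \<Rightarrow> aexp \<Rightarrow> com" where
  "length_win x e = Length x (handle_of e) (index_of e)"

text \<open>A removal may leave a window empty, and empty windows cannot be queried; hence the
  separate append before the first query.\<close>

definition advance_lead :: com where
  "advance_lead =
     Seq (If (Less (pos_at (Reg 4)) (Reg 3)) (append_win (Reg 4)) Skip)
    (Seq (length_win 5 (Reg 4))
         (While (Conj (Less (pos_at (Reg 4)) (Reg 0)) (PowLe (Reg 5) (Add (Reg 4) (Const 1))))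
            (Seq (append_win (Reg 4)) (length_win 5 (Reg 4)))))"

abbreviation "lag_reg \<equiv> Add (Reg 2) (Reg 4)"

text \<open>The guard is a disjunction, which the language expresses only through \<open>Neg\<close>
  and \<open>Conj\<close>; it says that the lagging position is below
  \<open>max i (p k - 1)\<close>.\<close>

definition advance_lag :: com where
  "advance_lag =
     Seq (While (Neg (Conj (Neg (Less (pos_at lag_reg) (Reg 3)))
                           (Neg (Less (Add (pos_at lag_reg) (Const 1)) (pos_at (Reg 4))))))
            (append_win lag_reg))
         (length_win 6 lag_reg)"

definition set_target :: com where
  "set_target =
     If (PowLe (Reg 5) (Add (Reg 4) (Const 1)))
        (Seq (Assign 7 (Add (Reg 0) (Const 1))) (Assign 6 (Reg 5)))
        (Assign 7 (pos_at (Reg 4)))"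

text \<open>A count of 0 plays the role of an infinite distance, so zeroed memory needs only an
  entry for the source. Comparing registers 3 and 7 discards windows that yield no arc.\<close>

definition relax :: com where
  "relax =
     If (Conj (Less (Reg 3) (Reg 7))
        (Conj (Less (Const 0) (count_at (Reg 3)))
              (Neg (Conj (Less (Const 0) (count_at (Reg 7)))
                         (Neg (Less (Add (dist_at (Reg 3)) (Reg 6)) (dist_at (Reg 7))))))))
        (Seq (Store (elem 0 (Reg 7)) (Add (dist_at (Reg 3)) (Reg 6)))
        (Seq (Store (elem 1 (Reg 7)) (Reg 3))
             (Store (elem 2 (Reg 7)) (Add (count_at (Reg 3)) (Const 1)))))
        Skip"

definition process_windows :: com where
  "process_windows =
     Seq (Assign 4 (Reg 2))
         (While (Less (Const 0) (Reg 4))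
            (Seq (Assign 4 (Sub (Reg 4) (Const 1)))
            (Seq advance_lead (Seq advance_lag (Seq set_target relax)))))"

definition remove_all :: "nat \<Rightarrow> com" where
  "remove_all H =
     Seq (Assign 4 (Const 0))
         (While (Less (Reg 4) (Const (2 * H)))
            (Seq (Remove (Reg 4)) (Assign 4 (Add (Reg 4) (Const 1)))))"

definition process_vertices :: "nat \<Rightarrow> com" where
  "process_vertices H =
     While (Less (Reg 3) (Add (Reg 0) (Const 1)))
       (Seq process_windows
       (Seq (remove_all H) (Assign 3 (Add (Reg 3) (Const 1)))))"

definition initialise :: "nat \<Rightarrow> com" where
  "initialise H =
     Seq (While (Neg (PowLe (Reg 0) (Reg 1))) (Assign 1 (Add (Reg 1) (Const 1))))
    (Seq (Assign 2 (Mul (Const H) (Reg 1)))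
    (Seq (While (Less (Reg 4) (Const (2 * H))) (Seq (New (Reg 4)) (Assign 4 (Add (Reg 4) (Const 1)))))
    (Seq (Store (elem 2 (Const 1)) (Const 1))
         (Assign 3 (Const 1)))))"

text \<open>The count of a vertex is its place on the path, so the backward walk over predecessors
  writes the path in forward order without a reversal.\<close>

definition write_path :: com where
  "write_path =
     Seq (Assign 7 (Add (Reg 0) (Const 1)))
    (Seq (While (Less (Const 0) (Reg 7))
            (Seq (Store (Sub (count_at (Reg 7)) (Const 1)) (Reg 7))
                 (Assign 7 (pred_at (Reg 7)))))
         (Assign 0 (count_at (Add (Reg 0) (Const 1)))))"

text \<open>At length 1 the computed number of windows would be 0 and no arc would ever be found;
  the only path is written directly.\<close>

definition program :: "nat \<Rightarrow> com" where
  "program H =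
     If (Equal (Reg 0) (Const 1))
        (Seq (Store (Const 0) (Const 1)) (Seq (Store (Const 1) (Const 2)) (Assign 0 (Const 2))))
        (Seq (initialise H) (Seq (process_vertices H) write_path))"

section \<open>Verification of the program\<close>

text \<open>\<open>\<rho>\<close>, \<open>\<kappa>\<close> and \<open>\<beta>\<close> bound the time
  of appends and queries, of removals, and of creating an instance. \<open>Z\<close> bounds the
  space of an instance, \<open>M\<close> the costs, and \<open>J\<close> the array indices, which
  range over vertices and windows alike.\<close>

locale window_program = window_positions C \<epsilon> T n m Q
  for C :: "'a list \<Rightarrow> bool list" and \<epsilon> :: real and T :: "'a list" and n m Q :: nat +
  fixes D :: "('a, 's) window_ds" and rep :: "'s \<Rightarrow> nat \<Rightarrow> (nat \<Rightarrow> nat) \<Rightarrow> bool"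
    and H W S M J Z :: nat and \<rho> \<kappa> \<beta> :: real
  assumes n_ge: "2 \<le> n" and m_def: "m = num_windows \<epsilon> n" and Q_def: "Q = H * m" and H_pos: "1 \<le> H"
    and cost_T: "length (C T) \<le> M"
    and ds_new: "\<exists>s time. ds_new D T = (s, time) \<and> rep s 1 (\<lambda>_. 0) \<and> real time \<le> \<beta>"
    and ds_space: "rep s l r \<Longrightarrow> ds_space D s \<le> Z"
    and ds_remove: "\<lbrakk>rep s l r; \<forall>t \<in> {1..m}. l \<le> r t; l \<le> n\<rbrakk> \<Longrightarrow>
      \<exists>s' time. ds_remove D s = (s', time) \<and> rep s' (l + 1) r \<and> real time \<le> \<kappa>"
    and ds_append: "\<lbrakk>rep s l r; t \<in> {1..m}; r t < n; t < m \<longrightarrow> r t < r (t + 1)\<rbrakk> \<Longrightarrow>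
      \<exists>s' time. ds_append D t s = (s', time) \<and> rep s' l (r(t := r t + 1)) \<and> real time \<le> \<rho>"
    and ds_length: "\<lbrakk>rep s l r; t \<in> {1..m}; l \<le> r t\<rbrakk> \<Longrightarrow>
      \<exists>s' time. ds_length D t s = (substr_cost C T l (r t), s', time) \<and> rep s' l r \<and> real time \<le> \<rho>"
    and rho_ge: "1 \<le> \<rho>" and kappa_ge: "1 \<le> \<kappa>" and beta_ge: "0 \<le> \<beta>"
    and fits_bound: "2 * H * (1 + Z) \<le> S" and S_le_W: "S \<le> W"
    and J_ge: "n + 1 \<le> J" "2 * Q \<le> J" and cells: "n + (4 * J + 4) < S"
    and words: "(n + 2) * M \<le> W"
begin

abbreviation "WP \<equiv> wp D T \<epsilon> W S"

lemma cell_less: "a < 4 \<Longrightarrow> j \<le> J \<Longrightarrow> cell n a j < S"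
  using cells by (simp add: cell_def)

lemma asafe_elem:
  assumes "asafe W S \<sigma> e" "regs \<sigma> 0 = n" "aval \<sigma> e \<le> J" "a < 4"
  shows "asafe W S \<sigma> (elem a e)"
  using assms cells S_le_W by (simp add: elem_def)

lemma W_bounds: "n + 2 \<le> W" "J + 4 \<le> W" "m \<le> W" "Q \<le> W" "2 * Q \<le> W" "2 * H \<le> W" "H \<le> W" "4 \<le> W" "M \<le> W"
proof -
  show "n + 2 \<le> W" "J + 4 \<le> W" "2 * Q \<le> W" "Q \<le> W" "4 \<le> W"
    using cells S_le_W J_ge by linarith+
  have "m \<le> Q" using Q_def H_pos by simp
  then show "m \<le> W" using \<open>Q \<le> W\<close> by simp
  have "2 * H \<le> 2 * H * (1 + Z)" by simp
  then show "2 * H \<le> W" "H \<le> W" using fits_bound S_le_W by linarith+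
  have "M \<le> (n + 2) * M" by simp
  then show "M \<le> W" using words by linarith
qed

section \<open>How machine states represent the windows\<close>

definition ok :: "'s state \<Rightarrow> bool" where
  "ok \<sigma> \<longleftrightarrow> regs \<sigma> 0 = n \<and> regs \<sigma> 1 = m \<and> regs \<sigma> 2 = Q"

definition pos :: "'s state \<Rightarrow> nat \<Rightarrow> nat" where
  "pos \<sigma> k = mem \<sigma> (cell n 3 k)"

text \<open>\<open>l\<close> gives each handle its own left end because removals reach the instances
  one after the other. Outside \<open>{1..m}\<close> the function \<open>r\<close> is left
  arbitrary.\<close>

definition windows :: "(nat \<Rightarrow> nat) \<Rightarrow> 's state \<Rightarrow> bool" where
  "windows l \<sigma> \<longleftrightarrow> dom (inst \<sigma>) = {..<2 * H} \<and>
     (\<forall>g < 2 * H. \<exists>s r. inst \<sigma> g = Some s \<and> rep s (l g) r \<and>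
        (\<forall>t \<in> {1..m}. r t = pos \<sigma> (g * m + t - 1)))"

lemma window_index:
  assumes "t \<in> {1..m}"
  shows "g * m + t - 1 = k \<longleftrightarrow> g = k div m \<and> t = Suc (k mod m)"
proof -
  obtain u where u: "t = Suc u" "u < m" using assms by (cases t) auto
  then have "g * m + u = k \<longleftrightarrow> g = k div m \<and> u = k mod m"
    by (auto simp: div_add1_eq)
  with u show ?thesis by simp
qed

lemma window_handle: "k < 2 * Q \<Longrightarrow> k div m < 2 * H"
  using m_pos by (simp add: Q_def div_less_iff_less_mult mult.assoc)

lemma fitsI:
  assumes "dom I \<subseteq> {..<2 * H}" "\<And>g s. I g = Some s \<Longrightarrow> ds_space D s \<le> Z"
  shows "fits D S I"
proof -
  have "(\<Sum>h \<in> dom I. 1 + ds_space D (the (I h))) \<le> (\<Sum>h \<in> dom I. 1 + Z)"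
    using assms(2) by (intro sum_mono) auto
  also have "\<dots> \<le> card {..<2 * H} * (1 + Z)"
    using card_mono[OF _ assms(1)] by (simp del: mult_Suc_right)
  also have "\<dots> \<le> S" using fits_bound by simp
  finally show ?thesis by (simp add: fits_def)
qed

lemma windows_space: "windows l \<sigma> \<Longrightarrow> inst \<sigma> g = Some s \<Longrightarrow> ds_space D s \<le> Z"
  unfolding windows_def using ds_space by (metis domI lessThan_iff option.inject)

lemma fits_update:
  assumes "windows l \<sigma>" "g < 2 * H" "rep s l' r"
  shows "fits D S ((inst \<sigma>)(g \<mapsto> s))"
proof (rule fitsI)
  show "dom ((inst \<sigma>)(g \<mapsto> s)) \<subseteq> {..<2 * H}"
    using assms by (auto simp: windows_def)
  fix g' s' assume "((inst \<sigma>)(g \<mapsto> s)) g' = Some s'"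
  then show "ds_space D s' \<le> Z"
    using ds_space[OF assms(3)] windows_space[OF assms(1)] by (auto split: if_splits)
qed

lemma asafe_window:
  assumes "ok \<sigma>" "asafe W S \<sigma> e" "aval \<sigma> e < 2 * Q"
  shows "asafe W S \<sigma> (handle_of e)" "asafe W S \<sigma> (index_of e)"
    "asafe W S \<sigma> (elem 3 e)" "aval \<sigma> (elem 3 e) < S"
proof -
  show "asafe W S \<sigma> (elem 3 e)" "aval \<sigma> (elem 3 e) < S"
    using assms J_ge(2) asafe_elem[of \<sigma> e 3] cell_less[of 3] by (auto simp: ok_def)
  have "m * (aval \<sigma> e div m) \<le> aval \<sigma> e" "aval \<sigma> e mod m \<le> aval \<sigma> e"
    by simp_all
  then have "m * (aval \<sigma> e div m) \<le> W" "Suc (aval \<sigma> e mod m) \<le> W"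
    using assms(3) W_bounds by linarith+
  then show "asafe W S \<sigma> (handle_of e)" "asafe W S \<sigma> (index_of e)"
    using assms(1,2) W_bounds by (simp_all add: ok_def handle_of_def index_of_def minus_mult_div_eq_mod)
qed

text \<open>Apart from the operation itself the exact price is \<open>26 + 5 * acost e\<close>, and
  \<open>lag_reg\<close> has cost 3; 60 is a round bound. \<open>inv_e\<close> records that
  \<open>e\<close> does not depend on the instances, which the append changes before the
  store.\<close>

lemma wp_append_win:
  assumes "ok \<sigma>" "windows l \<sigma>" "asafe W S \<sigma> e" "aval \<sigma> e = k" "k < 2 * Q" "acost e \<le> 3"
    and "pos \<sigma> k < n" "Suc (k mod m) < m \<Longrightarrow> pos \<sigma> k < pos \<sigma> (Suc k)"
    and "60 + \<rho> \<le> \<tau>"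
    and inv_e: "\<And>I. aval (\<sigma>\<lparr>inst := I\<rparr>) e = k" "\<And>I. asafe W S (\<sigma>\<lparr>inst := I\<rparr>) e"
    and post: "\<And>\<sigma>' \<tau>'. regs \<sigma>' = regs \<sigma> \<Longrightarrow>
      mem \<sigma>' = (mem \<sigma>)(cell n 3 k := Suc (pos \<sigma> k)) \<Longrightarrow> windows l \<sigma>' \<Longrightarrow>
      \<tau> - (60 + \<rho>) \<le> \<tau>' \<Longrightarrow> P \<sigma>' \<tau>'"
  shows "WP (append_win e) P \<sigma> \<tau>"
proof -
  let ?g = "k div m" and ?t = "Suc (k mod m)"
  have g: "?g < 2 * H" using window_handle assms(5) .
  have t: "?t \<in> {1..m}" using m_pos by (simp add: Suc_le_eq)
  from assms(2) g obtain s r where s: "inst \<sigma> ?g = Some s" "rep s (l ?g) r"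
      "\<forall>t \<in> {1..m}. r t = pos \<sigma> (?g * m + t - 1)"
    by (auto simp: windows_def)
  have k: "?g * m + ?t - 1 = k" by simp
  with s(3) t have rt: "r ?t = pos \<sigma> k" by metis
  have "r ?t < r (?t + 1)" if "?t < m"
  proof -
    have "?t + 1 \<in> {1..m}" using that by simp
    then have "r (?t + 1) = pos \<sigma> (?g * m + (?t + 1) - 1)" using s(3) by blast
    also have "?g * m + (?t + 1) - 1 = Suc k" by simp
    finally show ?thesis using rt assms(8) that by simp
  qed
  with ds_append[OF s(2) t] rt assms(7) obtain s' time where
    s': "ds_append D ?t s = (s', time)" "rep s' (l ?g) (r(?t := r ?t + 1))" "real time \<le> \<rho>"
    by auto
  let ?\<sigma> = "\<sigma>\<lparr>inst := (inst \<sigma>)(?g \<mapsto> s')\<rparr>"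
  let ?\<sigma>' = "?\<sigma>\<lparr>mem := (mem ?\<sigma>)(cell n 3 k := Suc (pos \<sigma> k))\<rparr>"
  have ok': "ok ?\<sigma>" using assms(1) by (simp add: ok_def)
  have pos': "pos ?\<sigma>' = (pos \<sigma>)(k := Suc (pos \<sigma> k))"
    by (auto simp: pos_def cell_inject)
  have win: "windows l ?\<sigma>'"
    unfolding windows_def
  proof (intro conjI allI impI)
    show "dom (inst ?\<sigma>') = {..<2 * H}"
      using assms(2) g by (auto simp: windows_def)
    fix g' assume g': "g' < 2 * H"
    show "\<exists>s r. inst ?\<sigma>' g' = Some s \<and> rep s (l g') r \<and>
        (\<forall>t \<in> {1..m}. r t = pos ?\<sigma>' (g' * m + t - 1))"
    proof (cases "g' = ?g")
      case True
      have "(r(?t := r ?t + 1)) t = pos ?\<sigma>' (g' * m + t - 1)" if "t \<in> {1..m}" for t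
        using s(3) rt window_index[OF that, of g' k] that True unfolding pos' by auto
      with s' True show ?thesis by auto
    next
      case False
      from assms(2) g' obtain s1 r1 where s1: "inst \<sigma> g' = Some s1" "rep s1 (l g') r1"
          "\<forall>t \<in> {1..m}. r1 t = pos \<sigma> (g' * m + t - 1)"
        by (auto simp: windows_def)
      have "r1 t = pos ?\<sigma>' (g' * m + t - 1)" if "t \<in> {1..m}" for t
        using s1(3) window_index[OF that, of g' k] that False unfolding pos' by auto
      with s1 False show ?thesis by auto
    qed
  qed
  have safe: "asafe W S \<sigma> (handle_of e)" "asafe W S \<sigma> (index_of e)"
    using asafe_window[OF assms(1,3)] assms(4,5) by auto
  have safe': "asafe W S ?\<sigma> (elem 3 e)" "cell n 3 k < S"
    using asafe_window(3,4)[OF ok', of e] inv_e assms(5) ok' by (auto simp: ok_def)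
  have posn: "mem \<sigma> (cell n 3 k) = pos \<sigma> k" by (simp add: pos_def)
  show ?thesis
    unfolding append_win_def
  proof (rule wp_Seq, rule wp_Append[where B = \<rho> and s = s and s' = s' and time = time])
    show "inst \<sigma> (aval \<sigma> (handle_of e)) = Some s"
      using s(1) assms(1,4) by (simp add: ok_def)
    show "ds_append D (aval \<sigma> (index_of e)) s = (s', time)"
      using s'(1) assms(1,4) by (simp add: ok_def)
    show "fits D S ((inst \<sigma>)(aval \<sigma> (handle_of e) \<mapsto> s'))"
      using fits_update[OF assms(2) g s'(2)] assms(1,4) by (simp add: ok_def)
    have eq: "aval \<sigma> (handle_of e) = ?g" using assms(1,4) by (simp add: ok_def)
    show "WP (Store (elem 3 e) (Add (pos_at e) (Const 1))) P
      (\<sigma>\<lparr>inst := (inst \<sigma>)(aval \<sigma> (handle_of e) \<mapsto> s')\<rparr>)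
      (\<tau> - (real (1 + acost (handle_of e) + acost (index_of e)) + \<rho>))"
      unfolding eq
    proof (rule wp_Store)
      show "asafe W S ?\<sigma> (elem 3 e)" by (rule safe')
      show "asafe W S ?\<sigma> (Add (pos_at e) (Const 1))"
        using safe' ok' inv_e posn assms(7) W_bounds by (simp add: ok_def)
      show "aval ?\<sigma> (elem 3 e) < S" using safe' ok' inv_e by (simp add: ok_def)
      show "P (?\<sigma>\<lparr>mem := (mem ?\<sigma>)(aval ?\<sigma> (elem 3 e) := aval ?\<sigma> (Add (pos_at e) (Const 1)))\<rparr>)
         (\<tau> - (real (1 + acost (handle_of e) + acost (index_of e)) + \<rho>) -
          real (1 + acost (elem 3 e) + acost (Add (pos_at e) (Const 1))))"
        by (rule post) (use win assms(6) inv_e assms(1) posn in \<open>simp_all add: ok_def\<close>)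
    qed (use assms(6,9) in simp)
  qed (use safe assms(6,9) s'(3) in simp_all)
qed

lemma wp_length_win:
  assumes "ok \<sigma>" "windows l \<sigma>" "asafe W S \<sigma> e" "aval \<sigma> e = k" "k < 2 * Q" "acost e \<le> 3"
    and "1 \<le> l (k div m)" "l (k div m) \<le> pos \<sigma> k" "pos \<sigma> k \<le> n"
    and "30 + \<rho> \<le> \<tau>"
    and post: "\<And>\<sigma>' \<tau>'. regs \<sigma>' = (regs \<sigma>)(x := cst (l (k div m)) (pos \<sigma> k)) \<Longrightarrow>
      mem \<sigma>' = mem \<sigma> \<Longrightarrow> windows l \<sigma>' \<Longrightarrow> \<tau> - (30 + \<rho>) \<le> \<tau>' \<Longrightarrow> P \<sigma>' \<tau>'"
  shows "WP (length_win x e) P \<sigma> \<tau>"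
proof -
  let ?g = "k div m" and ?t = "Suc (k mod m)"
  have g: "?g < 2 * H" using window_handle assms(5) .
  have t: "?t \<in> {1..m}" using m_pos by (simp add: Suc_le_eq)
  from assms(2) g obtain s r where s: "inst \<sigma> ?g = Some s" "rep s (l ?g) r"
      "\<forall>t \<in> {1..m}. r t = pos \<sigma> (?g * m + t - 1)"
    by (auto simp: windows_def)
  have k: "?g * m + ?t - 1 = k" by simp
  with s(3) t have rt: "r ?t = pos \<sigma> k" by metis
  with ds_length[OF s(2) t] assms(8) obtain s' time where
    s': "ds_length D ?t s = (cst (l ?g) (pos \<sigma> k), s', time)" "rep s' (l ?g) r" "real time \<le> \<rho>"
    by auto
  let ?\<sigma>' = "\<sigma>\<lparr>regs := (regs \<sigma>)(x := cst (l ?g) (pos \<sigma> k)), inst := (inst \<sigma>)(?g \<mapsto> s')\<rparr>"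
  have pos': "pos ?\<sigma>' = pos \<sigma>" by (auto simp: pos_def)
  have win: "windows l ?\<sigma>'"
    using assms(2) g s' s(3) unfolding windows_def pos' by auto
  have eq: "aval \<sigma> (handle_of e) = ?g" "aval \<sigma> (index_of e) = ?t"
    using assms(1,4) by (simp_all add: ok_def)
  show ?thesis
    unfolding length_win_def
  proof (rule wp_Length[where B = \<rho>], unfold eq)
    show "inst \<sigma> ?g = Some s" by (rule s)
    show "ds_length D ?t s = (cst (l ?g) (pos \<sigma> k), s', time)" by (rule s')
    show "cst (l ?g) (pos \<sigma> k) \<le> W"
      using cst_le[OF assms(7-9)] cost_T W_bounds by linarith
    show "fits D S ((inst \<sigma>)(?g \<mapsto> s'))" using fits_update[OF assms(2) g s'(2)] .
    show "P ?\<sigma>' (\<tau> - (real (1 + acost (handle_of e) + acost (index_of e)) + \<rho>))"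
      by (rule post) (use win assms(6) in simp_all)
  qed (use asafe_window[OF assms(1,3)] assms(4-6,10) s'(3) in simp_all)
qed

lemma ok_regs [simp]: "3 \<le> x \<Longrightarrow> ok (\<sigma>\<lparr>regs := (regs \<sigma>)(x := v)\<rparr>) = ok \<sigma>"
  by (simp add: ok_def)

lemma pos_simps [simp]: "pos (\<sigma>\<lparr>regs := f\<rparr>) = pos \<sigma>" "pos (\<sigma>\<lparr>inst := I\<rparr>) = pos \<sigma>"
  by (auto simp: pos_def)

lemma windows_regs [simp]: "windows l (\<sigma>\<lparr>regs := f\<rparr>) = windows l \<sigma>"
  by (simp add: windows_def)

lemma pos_update: "mem \<sigma>' = (mem \<sigma>)(cell n 3 k := v) \<Longrightarrow> pos \<sigma>' = (pos \<sigma>)(k := v)"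
  by (auto simp: pos_def cell_inject)

lemma pos_cong: "mem \<sigma>' = mem \<sigma> \<Longrightarrow> pos \<sigma>' = pos \<sigma>"
  by (auto simp: pos_def)

section \<open>The shortest-path tables in memory\<close>

abbreviation "cost_of \<equiv> edge_cost C T"

definition dpi :: "'s state \<Rightarrow> nat \<Rightarrow> (nat \<times> nat) set \<Rightarrow> bool" where
  "dpi \<sigma> i R \<longleftrightarrow> dp_inv A cost_of (n + 1) i
     (\<lambda>j. mem \<sigma> (cell n 0 j)) (\<lambda>j. mem \<sigma> (cell n 1 j)) (\<lambda>j. mem \<sigma> (cell n 2 j)) R"

lemma dpi_regs [simp]: "dpi (\<sigma>\<lparr>regs := f\<rparr>) = dpi \<sigma>" "dpi (\<sigma>\<lparr>inst := I\<rparr>) = dpi \<sigma>"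
  by (auto simp: dpi_def fun_eq_iff)

lemma dpi_update: "mem \<sigma>' = (mem \<sigma>)(cell n 3 k := v) \<Longrightarrow> dpi \<sigma>' i R = dpi \<sigma> i R"
  by (simp add: dpi_def cell_inject)

lemma dpi_cong: "mem \<sigma>' = mem \<sigma> \<Longrightarrow> dpi \<sigma>' i R = dpi \<sigma> i R"
  by (simp add: dpi_def)

lemma dpi_mono: "\<lbrakk>dpi \<sigma> i R; i \<le> i'; R' \<subseteq> R\<rbrakk> \<Longrightarrow> dpi \<sigma> i' R'"
  unfolding dpi_def by (rule dp_inv_mono)

lemma cost_of_le:
  assumes "(i, j) \<in> A"
  shows "cost_of (i, j) \<le> M"
proof -
  have "1 \<le> i" "i \<le> j - 1" "j - 1 \<le> n"
    using pruned_arcsD[OF assms] n_def by linarith+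
  from cst_le[OF this] cost_T show ?thesis by (simp add: edge_cost_eq)
qed

lemma dpi_bounds:
  assumes "dpi \<sigma> i R" "1 \<le> j" "j \<le> n + 1"
  shows "mem \<sigma> (cell n 0 j) \<le> j * M" "mem \<sigma> (cell n 2 j) \<le> j" "mem \<sigma> (cell n 1 j) \<le> j"
  using dp_inv_bounds[OF assms(1)[unfolded dpi_def] _ assms(2,3), of M] cost_of_le by auto

lemma asafe_cell:
  assumes "dpi \<sigma> i R" "ok \<sigma>" "asafe W S \<sigma> e" "1 \<le> aval \<sigma> e" "aval \<sigma> e \<le> n + 1"
  shows "a < 4 \<Longrightarrow> asafe W S \<sigma> (elem a e)" "a < 4 \<Longrightarrow> aval \<sigma> (elem a e) < S"
    "asafe W S \<sigma> (dist_at e)" "asafe W S \<sigma> (pred_at e)" "asafe W S \<sigma> (count_at e)"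
proof -
  let ?j = "aval \<sigma> e"
  have r: "regs \<sigma> 0 = n" using assms(2) by (simp add: ok_def)
  show *: "asafe W S \<sigma> (elem a e)" "aval \<sigma> (elem a e) < S" if "a < 4" for a
    using asafe_elem[OF assms(3) r _ that] cell_less[OF that, of ?j] assms(5) J_ge(1) r by simp_all
  have "mem \<sigma> (cell n 0 ?j) \<le> W"
  proof -
    have "?j * M \<le> (n + 2) * M" using assms(5) by (intro mult_le_mono1) simp
    with dpi_bounds(1)[OF assms(1,4,5)] words show ?thesis by linarith
  qed
  moreover have "mem \<sigma> (cell n 1 ?j) \<le> W" "mem \<sigma> (cell n 2 ?j) \<le> W"
    using dpi_bounds[OF assms(1,4,5)] W_bounds assms(5) by linarith+
  ultimately show "asafe W S \<sigma> (dist_at e)" "asafe W S \<sigma> (pred_at e)" "asafe W S \<sigma> (count_at e)"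
    using *[of 0] *[of 1] *[of 2] r by simp_all
qed

lemma asafe_pos:
  assumes "ok \<sigma>" "asafe W S \<sigma> e" "aval \<sigma> e < 2 * Q" "pos \<sigma> (aval \<sigma> e) \<le> n"
  shows "asafe W S \<sigma> (pos_at e)" "aval \<sigma> (pos_at e) = pos \<sigma> (aval \<sigma> e)"
  using asafe_window(3,4)[OF assms(1-3)] assms(1,4) W_bounds by (simp_all add: ok_def pos_def)

section \<open>One power at one vertex: moving its two windows and relaxing its arc\<close>

definition stage :: "'s state \<Rightarrow> nat \<Rightarrow> nat \<Rightarrow> (nat \<times> nat) set \<Rightarrow> bool" where
  "stage \<sigma> i k R \<longleftrightarrow> ok \<sigma> \<and> regs \<sigma> 3 = i \<and> regs \<sigma> 4 = k \<and> 1 \<le> i \<and> i \<le> n \<and>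
     windows (\<lambda>_. i) \<sigma> \<and> dpi \<sigma> i R"

lemma stageD:
  assumes "stage \<sigma> i k R"
  shows "ok \<sigma>" "regs \<sigma> 0 = n" "regs \<sigma> 1 = m" "regs \<sigma> 2 = Q" "regs \<sigma> 3 = i" "regs \<sigma> 4 = k"
    "1 \<le> i" "i \<le> n" "windows (\<lambda>_. i) \<sigma>" "dpi \<sigma> i R"
  using assms by (auto simp: stage_def ok_def)

text \<open>One unit of potential pays for an append, a query after it and the loop test around
  them, hence the two \<open>\<rho>\<close>.\<close>

definition "unit_credit = 200 + 2 * \<rho>"

text \<open>The drop of the potential releases \<open>unit_credit\<close>, of which 60 +
  \<open>\<rho>\<close> pay for the append. The other 140 + \<open>\<rho>\<close> may be missing
  beforehand, which is how the caller funds its loop test and the next query.\<close>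

lemma wp_stage_append:
  assumes st: "stage \<sigma> i k R" and e: "e = Reg 4 \<or> e = lag_reg" "aval \<sigma> e = k'" "asafe W S \<sigma> e"
    and k': "k' < 2 * Q" and "pos \<sigma> k' < n" "Suc (k' mod m) < m \<Longrightarrow> pos \<sigma> k' < pos \<sigma> (Suc k')"
    and "X + unit_credit * potential (pos \<sigma>) \<le> \<tau> + 140 + \<rho>" "0 \<le> X"
  shows "WP (append_win e) (\<lambda>\<sigma>' \<tau>'. stage \<sigma>' i k R \<and> regs \<sigma>' = regs \<sigma> \<and>
           pos \<sigma>' = (pos \<sigma>)(k' := Suc (pos \<sigma> k')) \<and>
           X + unit_credit * potential (pos \<sigma>') \<le> \<tau>') \<sigma> \<tau>"
proof -
  note D = stageD[OF st]
  let ?p = "(pos \<sigma>)(k' := Suc (pos \<sigma> k'))"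
  have pot: "unit_credit * potential (pos \<sigma>) = unit_credit * potential ?p + unit_credit"
    using potential_step[of k' "pos \<sigma>"] k' assms(6) by (simp add: algebra_simps flip: potential_step)
  have "0 \<le> unit_credit * potential ?p"
    using potential_nonneg rho_ge by (simp add: unit_credit_def)
  then have \<tau>: "60 + \<rho> \<le> \<tau>" "X + unit_credit * potential ?p \<le> \<tau> - (60 + \<rho>)"
    using assms(8,9) pot by (simp_all add: unit_credit_def)
  show ?thesis
  proof (rule wp_append_win[OF D(1,9) e(3,2) k' _ assms(6,7) \<tau>(1)])
    fix \<sigma>' \<tau>'
    assume *: "regs \<sigma>' = regs \<sigma>" "mem \<sigma>' = (mem \<sigma>)(cell n 3 k' := Suc (pos \<sigma> k'))"
      "windows (\<lambda>_. i) \<sigma>'" "\<tau> - (60 + \<rho>) \<le> \<tau>'"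
    have "stage \<sigma>' i k R"
      using st * dpi_update[OF *(2)] by (simp add: stage_def ok_def)
    with * \<tau>(2) pos_update[OF *(2)]
    show "stage \<sigma>' i k R \<and> regs \<sigma>' = regs \<sigma> \<and>
           pos \<sigma>' = (pos \<sigma>)(k' := Suc (pos \<sigma> k')) \<and>
           X + unit_credit * potential (pos \<sigma>') \<le> \<tau>'" by simp
  qed (use e in auto)
qed

lemma wp_stage_length:
  assumes st: "stage \<sigma> i k R" and e: "e = Reg 4 \<or> e = lag_reg" "aval \<sigma> e = k'" "asafe W S \<sigma> e"
    and k': "k' < 2 * Q" and "i \<le> pos \<sigma> k'" "pos \<sigma> k' \<le> n" and x: "5 \<le> x"
    and "X + 30 + \<rho> \<le> \<tau>" "0 \<le> X"
  shows "WP (length_win x e) (\<lambda>\<sigma>' \<tau>'. stage \<sigma>' i k R \<and> pos \<sigma>' = pos \<sigma> \<and>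
           regs \<sigma>' = (regs \<sigma>)(x := cst i (pos \<sigma> k')) \<and> X \<le> \<tau>') \<sigma> \<tau>"
proof -
  note D = stageD[OF st]
  show ?thesis
  proof (rule wp_length_win[OF D(1,9) e(3,2) k' _ D(7) assms(6,7)])
    fix \<sigma>' \<tau>'
    assume *: "regs \<sigma>' = (regs \<sigma>)(x := cst i (pos \<sigma> k'))" "mem \<sigma>' = mem \<sigma>"
      "windows (\<lambda>_. i) \<sigma>'" "\<tau> - (30 + \<rho>) \<le> \<tau>'"
    have "stage \<sigma>' i k R"
      using st * x dpi_cong[OF *(2)] by (simp add: stage_def ok_def)
    with * assms(9) pos_cong[OF *(2)]
    show "stage \<sigma>' i k R \<and> pos \<sigma>' = pos \<sigma> \<and> regs \<sigma>' = (regs \<sigma>)(x := cst i (pos \<sigma> k')) \<and> X \<le> \<tau>'"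
      by simp
  qed (use e assms(9,10) in auto)
qed

text \<open>The fixed credit pays for the first test, the first query and leaving the loop;
  iterations are paid by the potential.\<close>

lemma wp_advance_lead:
  assumes st: "stage \<sigma> i k R" and k: "k < Q" and inv: "win_inv i (Suc k) (pos \<sigma>)"
    and \<tau>: "F + 300 + 2 * \<rho> + unit_credit * potential (pos \<sigma>) \<le> \<tau>" "0 \<le> F"
  shows "WP advance_lead (\<lambda>\<sigma>' \<tau>'. stage \<sigma>' i k R \<and> win_inv i (Suc k) (pos \<sigma>') \<and>
           lead_done i (pos \<sigma>') k \<and> regs \<sigma>' 5 = cst i (pos \<sigma>' k) \<and>
           F + unit_credit * potential (pos \<sigma>') \<le> \<tau>') \<sigma> \<tau>"
    (is "WP _ ?P \<sigma> \<tau>")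
proof -
  \<comment> \<open>\<open>c\<close> is the reserve besides the potential: 130 +
    \<open>\<rho>\<close> before a query, hence 100 after it and at the loop test.\<close>
  define I where "I c = (\<lambda>\<sigma> \<tau>. stage \<sigma> i k R \<and> win_inv i (Suc k) (pos \<sigma>) \<and> i \<le> pos \<sigma> k \<and>
    F + c + unit_credit * potential (pos \<sigma>) \<le> \<tau>)" for c
  define I' where "I' = (\<lambda>\<sigma> \<tau>. I 100 \<sigma> \<tau> \<and> regs \<sigma> 5 = cst i (pos \<sigma> k))"
  have pot: "0 \<le> unit_credit * potential p" for p
    using potential_nonneg rho_ge by (simp add: unit_credit_def)
  have k2: "k < 2 * Q" using k by simp
  have append: "WP (append_win (Reg 4)) (I c) \<sigma> \<tau>"
    if "stage \<sigma> i k R" "win_inv i (Suc k) (pos \<sigma>)" "pos \<sigma> k < n"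
      "pos \<sigma> k < i \<or> real (cst i (pos \<sigma> k)) \<le> pw k"
      "F + c + unit_credit * potential (pos \<sigma>) \<le> \<tau> + 140 + \<rho>" "0 \<le> c" for \<sigma> \<tau> c
  proof -
    note D = stageD[OF that(1)]
    note L = lead_step[OF that(2) k that(3) D(7,8) that(4)]
    have "i \<le> Suc (pos \<sigma> k)" using win_invD(2)[OF that(2) k] .
    show ?thesis
      unfolding I_def
      by (rule wp_mono[OF wp_stage_append[OF that(1) disjI1[OF refl] _ _ k2 that(3) L(2) that(5)]])
         (use L(1) D(6) \<tau>(2) that(6) k W_bounds \<open>i \<le> Suc (pos \<sigma> k)\<close> in auto)
  qed
  have length: "WP (length_win 5 (Reg 4)) I' \<sigma> \<tau>" if "I (130 + \<rho>) \<sigma> \<tau>" for \<sigma> \<tau>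
  proof -
    from that have *: "stage \<sigma> i k R" "win_inv i (Suc k) (pos \<sigma>)" "i \<le> pos \<sigma> k"
      "F + 100 + unit_credit * potential (pos \<sigma>) + 30 + \<rho> \<le> \<tau>"
      by (simp_all add: I_def)
    show ?thesis
      unfolding I'_def I_def
      by (rule wp_mono[OF wp_stage_length[OF *(1) disjI1[OF refl] _ _ k2 *(3) win_invD(1)[OF *(2) k] _ *(4)]])
         (use * stageD(6)[OF *(1)] W_bounds k \<tau>(2) pot in auto)
  qed
  have pos_safe: "asafe W S \<sigma> (pos_at (Reg 4))" "aval \<sigma> (pos_at (Reg 4)) = pos \<sigma> k"
    if "stage \<sigma> i k R" "win_inv i (Suc k) (pos \<sigma>)" for \<sigma>
    using asafe_pos[of \<sigma> "Reg 4"] stageD[OF that(1)] win_invD(1)[OF that(2) k] k W_bounds by auto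
  have W: "Suc k \<le> W" using k W_bounds by simp
  let ?b = "Less (pos_at (Reg 4)) (Reg 3)"
  let ?c = "Conj (Less (pos_at (Reg 4)) (Reg 0)) (PowLe (Reg 5) (Add (Reg 4) (Const 1)))"
  have first: "WP (If ?b (append_win (Reg 4)) Skip) (I (130 + \<rho>)) \<sigma> \<tau>"
  proof (rule wp_If)
    note D = stageD[OF st]
    note ps = pos_safe[OF st inv]
    show "bsafe W S \<sigma> ?b"
      using ps(1) D W_bounds by simp
    show "real (1 + bcost ?b) \<le> \<tau>"
      using \<tau> pot[of "pos \<sigma>"] rho_ge by simp
    show "WP (append_win (Reg 4)) (I (130 + \<rho>)) \<sigma> (\<tau> - real (1 + bcost ?b))" if "bval \<epsilon> \<sigma> ?b"
    proof -
      have "pos \<sigma> k < i" using that ps(2) D by simp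
      with D \<tau> rho_ge show ?thesis by (intro append st inv) auto
    qed
    show "WP Skip (I (130 + \<rho>)) \<sigma> (\<tau> - real (1 + bcost ?b))" if "\<not> bval \<epsilon> \<sigma> ?b"
    proof -
      have "i \<le> pos \<sigma> k" using that ps(2) D by simp
      with st inv \<tau> pot[of "pos \<sigma>"] rho_ge show ?thesis by (intro wp_Skip) (auto simp: I_def)
    qed
  qed
  have loop: "WP (While ?c (Seq (append_win (Reg 4)) (length_win 5 (Reg 4)))) ?P \<sigma> \<tau>"
    if "I' \<sigma> \<tau>" "0 \<le> \<tau>" for \<sigma> \<tau>
  proof (rule wp_While[where I = I'])
    fix \<sigma> \<tau> assume I': "I' \<sigma> \<tau>"
    then have st: "stage \<sigma> i k R" and inv: "win_inv i (Suc k) (pos \<sigma>)" and i: "i \<le> pos \<sigma> k"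
      and cr: "F + 100 + unit_credit * potential (pos \<sigma>) \<le> \<tau>" and r5: "regs \<sigma> 5 = cst i (pos \<sigma> k)"
      by (auto simp: I'_def I_def)
    note D = stageD[OF st]
    note ps = pos_safe[OF st inv]
    have pn: "pos \<sigma> k \<le> n" using win_invD(1)[OF inv k] .
    have "cst i (pos \<sigma> k) \<le> W" using cst_le[OF D(7) i pn] cost_T W_bounds by linarith
    then show "bsafe W S \<sigma> ?c \<and> real (1 + bcost ?c) \<le> \<tau>"
      using ps(1) D W_bounds W r5 cr pot[of "pos \<sigma>"] \<tau>(2) by simp
    have bval: "bval \<epsilon> \<sigma> ?c \<longleftrightarrow> pos \<sigma> k < n \<and> real (cst i (pos \<sigma> k)) \<le> pw k"
      using ps(2) D r5 by (simp add: pw_def)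
    show "WP (Seq (append_win (Reg 4)) (length_win 5 (Reg 4))) I' \<sigma> (\<tau> - real (1 + bcost ?c))"
      if "bval \<epsilon> \<sigma> ?c"
    proof (rule wp_Seq, rule wp_mono[OF append length])
      show "F + (130 + \<rho>) + unit_credit * potential (pos \<sigma>)
          \<le> \<tau> - real (1 + bcost ?c) + 140 + \<rho>"
        using cr by simp
    qed (use st inv that bval rho_ge in auto)
    show "?P \<sigma> (\<tau> - real (1 + bcost ?c))" if "\<not> bval \<epsilon> \<sigma> ?c"
      using that bval st inv r5 cr i pn by (auto simp: lead_done_def)
  qed (use that in auto)
  show ?thesis
    unfolding advance_lead_def
    by (rule wp_Seq, rule wp_mono[OF first], rule wp_Seq, rule wp_mono[OF length], assumption,
        rule loop)
qed

lemma wp_advance_lag: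
  assumes st: "stage \<sigma> i k R" and k: "k < Q" and inv: "win_inv i (Suc k) (pos \<sigma>)"
    and "lead_done i (pos \<sigma>) k" "regs \<sigma> 5 = cst i (pos \<sigma> k)"
    and \<tau>: "F + 200 + \<rho> + unit_credit * potential (pos \<sigma>) \<le> \<tau>" "0 \<le> F"
  shows "WP advance_lag (\<lambda>\<sigma>' \<tau>'. stage \<sigma>' i k R \<and> win_inv i k (pos \<sigma>') \<and>
           regs \<sigma>' 5 = cst i (pos \<sigma>' k) \<and> regs \<sigma>' 6 = cst i (pos \<sigma>' (Q + k)) \<and>
           F + unit_credit * potential (pos \<sigma>') \<le> \<tau>') \<sigma> \<tau>"
    (is "WP _ ?P \<sigma> \<tau>")
proof -
  define I where "I = (\<lambda>\<sigma> \<tau>. stage \<sigma> i k R \<and> win_inv i (Suc k) (pos \<sigma>) \<and>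
    lead_done i (pos \<sigma>) k \<and> regs \<sigma> 5 = cst i (pos \<sigma> k) \<and>
    F + 150 + \<rho> + unit_credit * potential (pos \<sigma>) \<le> \<tau>)"
  define I' where "I' = (\<lambda>\<sigma> \<tau>. stage \<sigma> i k R \<and> win_inv i k (pos \<sigma>) \<and>
    regs \<sigma> 5 = cst i (pos \<sigma> k) \<and> F + 30 + \<rho> + unit_credit * potential (pos \<sigma>) \<le> \<tau>)"
  have pot: "0 \<le> unit_credit * potential p" for p
    using potential_nonneg rho_ge by (simp add: unit_credit_def)
  have Qk: "Q + k < 2 * Q" "k < 2 * Q" using k by simp_all
  let ?c = "Neg (Conj (Neg (Less (pos_at lag_reg) (Reg 3)))
                      (Neg (Less (Add (pos_at lag_reg) (Const 1)) (pos_at (Reg 4)))))"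
  have loop: "WP (While ?c (append_win lag_reg)) I' \<sigma> \<tau>" if "I \<sigma> \<tau>" "0 \<le> \<tau>" for \<sigma> \<tau>
  proof (rule wp_While[where I = I])
    fix \<sigma> \<tau> assume "I \<sigma> \<tau>"
    then have st: "stage \<sigma> i k R" and inv: "win_inv i (Suc k) (pos \<sigma>)" and ld: "lead_done i (pos \<sigma>) k"
      and cr: "F + 150 + \<rho> + unit_credit * potential (pos \<sigma>) \<le> \<tau>" and r5: "regs \<sigma> 5 = cst i (pos \<sigma> k)"
      by (auto simp: I_def)
    note D = stageD[OF st]
    note V = win_invD[OF inv k]
    have lag: "aval \<sigma> lag_reg = Q + k" "asafe W S \<sigma> lag_reg"
      using D k W_bounds by simp_all
    have "pos \<sigma> (Q + k) \<le> n" using V(1,3) D(8) by linarith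
    then have ps: "asafe W S \<sigma> (pos_at lag_reg)" "aval \<sigma> (pos_at lag_reg) = pos \<sigma> (Q + k)"
      using asafe_pos[OF D(1) lag(2)] Qk unfolding lag(1) by blast+
    have ps': "asafe W S \<sigma> (pos_at (Reg 4))" "aval \<sigma> (pos_at (Reg 4)) = pos \<sigma> k"
      using asafe_pos[OF D(1), of "Reg 4"] D(6) V(1) k W_bounds by auto
    show "bsafe W S \<sigma> ?c \<and> real (1 + bcost ?c) \<le> \<tau>"
    proof
      show "bsafe W S \<sigma> ?c"
        using ps ps' D W_bounds \<open>pos \<sigma> (Q + k) \<le> n\<close>
        by (simp del: aval.simps(3) asafe.simps(3))
      show "real (1 + bcost ?c) \<le> \<tau>" using cr pot[of "pos \<sigma>"] \<tau>(2) rho_ge by simp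
    qed
    have bval: "bval \<epsilon> \<sigma> ?c \<longleftrightarrow> pos \<sigma> (Q + k) < max i (pos \<sigma> k - 1)"
      using ps(2) ps'(2) D(5) by (auto simp: less_max_iff_disj simp del: aval.simps(3))
    show "WP (append_win lag_reg) I \<sigma> (\<tau> - real (1 + bcost ?c))" if "bval \<epsilon> \<sigma> ?c"
    proof -
      note L = lag_step[OF inv k D(7,8) ld that[unfolded bval]]
      show ?thesis
        unfolding I_def
      proof (rule wp_mono[OF wp_stage_append[OF st disjI2[OF refl] lag Qk(1) L(3,2)]])
        show "F + 150 + \<rho> + unit_credit * potential (pos \<sigma>) \<le> \<tau> - real (1 + bcost ?c) + 140 + \<rho>"
          using cr rho_ge by simp
      qed (use L(1) ld r5 \<tau>(2) rho_ge Q_pos in \<open>auto simp: lead_done_def\<close>)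
    qed
    show "I' \<sigma> (\<tau> - real (1 + bcost ?c))" if "\<not> bval \<epsilon> \<sigma> ?c"
      using win_inv_done[OF inv k ld] that[unfolded bval not_less] st r5 cr by (simp add: I'_def)
  qed (use that in auto)
  have length: "WP (length_win 6 lag_reg) ?P \<sigma> \<tau>" if "I' \<sigma> \<tau>" for \<sigma> \<tau>
  proof -
    from that have st: "stage \<sigma> i k R" and inv: "win_inv i k (pos \<sigma>)" and r5: "regs \<sigma> 5 = cst i (pos \<sigma> k)"
      and cr: "F + unit_credit * potential (pos \<sigma>) + 30 + \<rho> \<le> \<tau>"
      by (simp_all add: I'_def)
    note D = stageD[OF st]
    note V = win_invD[OF inv k]
    have lag: "aval \<sigma> lag_reg = Q + k" "asafe W S \<sigma> lag_reg"
      using D k W_bounds by simp_all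
    have "i \<le> pos \<sigma> (Q + k)" "pos \<sigma> (Q + k) \<le> n" using V(1,3,7) D(8) by auto
    from wp_stage_length[OF st disjI2[OF refl] lag Qk(1) this _ cr, of 6] show ?thesis
      by (rule wp_mono) (use \<tau>(2) pot inv r5 in auto)
  qed
  have "I \<sigma> \<tau>" "0 \<le> \<tau>"
    using assms pot[of "pos \<sigma>"] rho_ge by (simp_all add: I_def)
  from loop[OF this] show ?thesis
    unfolding advance_lag_def
    by (intro wp_Seq, elim wp_mono) (rule length)
qed

lemma wp_set_target:
  assumes st: "stage \<sigma> i k R" and k: "k < Q" and inv: "win_inv i k (pos \<sigma>)"
    and r5: "regs \<sigma> 5 = cst i (pos \<sigma> k)" and r6: "regs \<sigma> 6 = cst i (pos \<sigma> (Q + k))"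
    and \<tau>: "X + 50 \<le> \<tau>" "0 \<le> X"
  shows "WP set_target (\<lambda>\<sigma>' \<tau>'. stage \<sigma>' i k R \<and> pos \<sigma>' = pos \<sigma> \<and>
           regs \<sigma>' 7 = target i (pos \<sigma>) k \<and>
           regs \<sigma>' 6 = (if real (cst i (pos \<sigma> k)) \<le> pw k then cst i (pos \<sigma> k)
             else cst i (pos \<sigma> (Q + k))) \<and> X \<le> \<tau>') \<sigma> \<tau>"
    (is "WP _ ?P \<sigma> \<tau>")
proof -
  note D = stageD[OF st]
  note V = win_invD[OF inv k]
  let ?b = "PowLe (Reg 5) (Add (Reg 4) (Const 1))"
  have "i \<le> pos \<sigma> k" using V(6) by (simp add: lead_done_def)
  then have W: "regs \<sigma> 5 \<le> W" "Suc k \<le> W" "Suc n \<le> W"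
    using cst_le[OF D(7) _ V(1)] cost_T W_bounds r5 k by linarith+
  have ps: "asafe W S \<sigma> (pos_at (Reg 4))" "aval \<sigma> (pos_at (Reg 4)) = pos \<sigma> k"
    using asafe_pos[OF D(1), of "Reg 4"] D(6) V(1) k W_bounds by auto
  have bval: "bval \<epsilon> \<sigma> ?b \<longleftrightarrow> real (cst i (pos \<sigma> k)) \<le> pw k"
    using r5 D(6) by (simp add: pw_def)
  show ?thesis
    unfolding set_target_def
  proof (rule wp_If)
    show "bsafe W S \<sigma> ?b" using W D W_bounds by simp
    show "real (1 + bcost ?b) \<le> \<tau>" using \<tau> by simp
    show "WP (Seq (Assign 7 (Add (Reg 0) (Const 1))) (Assign 6 (Reg 5))) ?P \<sigma>
        (\<tau> - real (1 + bcost ?b))" if "bval \<epsilon> \<sigma> ?b"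
      by (intro wp_Seq wp_Assign)
         (use that[unfolded bval] \<tau> W D W_bounds r5 st in \<open>simp_all add: stage_def target_def ok_def\<close>)
    show "WP (Assign 7 (pos_at (Reg 4))) ?P \<sigma> (\<tau> - real (1 + bcost ?b))" if "\<not> bval \<epsilon> \<sigma> ?b"
    proof (rule wp_Assign, rule ps(1))
      show "?P (\<sigma>\<lparr>regs := (regs \<sigma>)(7 := aval \<sigma> (pos_at (Reg 4)))\<rparr>)
         (\<tau> - real (1 + bcost ?b) - real (1 + acost (pos_at (Reg 4))))"
        unfolding ps(2) using that[unfolded bval] \<tau> r6 st by (simp add: stage_def target_def)
    qed (use \<tau> in simp)
  qed
qed

lemma windows_cong: "\<lbrakk>windows l \<sigma>; inst \<sigma>' = inst \<sigma>; pos \<sigma>' = pos \<sigma>\<rbrakk> \<Longrightarrow> windows l \<sigma>'"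
  by (simp add: windows_def)

text \<open>\<open>regs \<sigma> 6 \<le> M\<close> is demanded even if there is no arc: a
  conjunction is safe only if both conjuncts are, so the sum in the test has to fit in a word in any
  case.\<close>

lemma wp_relax:
  assumes st: "stage \<sigma> i k R" and j: "regs \<sigma> 7 = j" "1 \<le> j" "j \<le> n + 1"
    and y: "regs \<sigma> 6 \<le> M" "i < j \<Longrightarrow> (i, j) \<in> A \<and> regs \<sigma> 6 = cost_of (i, j)"
    and \<tau>: "X + 400 \<le> \<tau>" "0 \<le> X"
  shows "WP relax (\<lambda>\<sigma>' \<tau>'. stage \<sigma>' i k (if i < j then insert (i, j) R else R) \<and>
           pos \<sigma>' = pos \<sigma> \<and> X \<le> \<tau>') \<sigma> \<tau>"
    (is "WP _ ?P \<sigma> \<tau>")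
proof -
  note D = stageD[OF st]
  let ?d = "\<lambda>j. mem \<sigma> (cell n 0 j)" and ?p = "\<lambda>j. mem \<sigma> (cell n 1 j)"
    and ?e = "\<lambda>j. mem \<sigma> (cell n 2 j)"
  note inv = D(10)[unfolded dpi_def]
  have ij: "asafe W S \<sigma> (Reg 3)" "1 \<le> aval \<sigma> (Reg 3)" "aval \<sigma> (Reg 3) \<le> n + 1"
    "asafe W S \<sigma> (Reg 7)" "1 \<le> aval \<sigma> (Reg 7)" "aval \<sigma> (Reg 7) \<le> n + 1"
    using D j W_bounds by simp_all
  note si = asafe_cell[OF D(10,1) ij(1-3)]
  note sj = asafe_cell[OF D(10,1) ij(4-6)]
  have "(i + 1) * M \<le> (n + 2) * M" using D(8) by (intro mult_le_mono1) simp
  then have "i * M + M \<le> (n + 2) * M" by simp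
  then have dW: "?d i + regs \<sigma> 6 \<le> W"
    using dpi_bounds(1)[OF D(10), of i] D(7,8) y(1) words by linarith
  have eW: "?e i + 1 \<le> W"
    using dpi_bounds(2)[OF D(10), of i] D(7,8) W_bounds by linarith
  let ?b = "Conj (Less (Reg 3) (Reg 7))
        (Conj (Less (Const 0) (count_at (Reg 3)))
              (Neg (Conj (Less (Const 0) (count_at (Reg 7)))
                         (Neg (Less (Add (dist_at (Reg 3)) (Reg 6)) (dist_at (Reg 7)))))))"
  have bval: "bval \<epsilon> \<sigma> ?b \<longleftrightarrow> i < j \<and> ?e i \<noteq> 0 \<and> (?e j = 0 \<or> ?d i + regs \<sigma> 6 < ?d j)"
    using D j by auto
  show ?thesis
    unfolding relax_def
  proof (rule wp_If)
    show "bsafe W S \<sigma> ?b" using si sj ij dW y W_bounds D j by simp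
    show "real (1 + bcost ?b) \<le> \<tau>" using \<tau> by simp
    show "WP Skip ?P \<sigma> (\<tau> - real (1 + bcost ?b))" if "\<not> bval \<epsilon> \<sigma> ?b"
    proof (rule wp_Skip)
      have "dpi \<sigma> i (if i < j then insert (i, j) R else R)"
        unfolding dpi_def
        using inv that[unfolded bval] y(2) by (auto intro!: dp_inv_insert)
      with st \<tau> show "?P \<sigma> (\<tau> - real (1 + bcost ?b) - 1)" by (simp add: stage_def)
    qed (use \<tau> in simp)
    assume b: "bval \<epsilon> \<sigma> ?b"
    let ?m = "(mem \<sigma>)(cell n 0 j := ?d i + regs \<sigma> 6)"
    let ?m' = "?m(cell n 1 j := i)"
    let ?m'' = "?m'(cell n 2 j := Suc (?e i))"
    let ?\<sigma> = "\<sigma>\<lparr>mem := ?m''\<rparr>"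
    have A: "(i, j) \<in> A" "regs \<sigma> 6 = cost_of (i, j)" "i < j"
      using b[unfolded bval] y(2) by auto
    have "dpi ?\<sigma> i (insert (i, j) R)"
      using dp_inv_update[OF inv D(7) A(3) _ A(1)] b[unfolded bval] j A
      by (simp add: dpi_def cell_inject fun_upd_def cong del: if_weak_cong)
    moreover have pos: "pos ?\<sigma> = pos \<sigma>" by (auto simp: pos_def cell_inject)
    moreover have "windows (\<lambda>_. i) ?\<sigma>" by (rule windows_cong[OF D(9) _ pos]) simp
    ultimately have P: "?P ?\<sigma> (\<tau> - 300)"
      using st \<tau> A(3) by (simp add: stage_def ok_def)
    let ?c = "Seq (Store (elem 0 (Reg 7)) (Add (dist_at (Reg 3)) (Reg 6)))
        (Seq (Store (elem 1 (Reg 7)) (Reg 3))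
             (Store (elem 2 (Reg 7)) (Add (count_at (Reg 3)) (Const 1))))"
    have cs: "cell n 0 j < S" "cell n 1 j < S" "cell n 2 j < S"
      using sj(2)[of 0] sj(2)[of 1] sj(2)[of 2] D(2) j(1) by simp_all
    have sj': "asafe W S (\<sigma>\<lparr>mem := f\<rparr>) (elem a (Reg 7))" if "a < 4" for f a
      using sj(1)[OF that] by (simp add: elem_def)
    have si': "asafe W S (\<sigma>\<lparr>mem := f\<rparr>) (elem a (Reg 3))" if "a < 4" for f a
      using si(1)[OF that] by (simp add: elem_def)
    \<comment> \<open>The three stores are run to one explicit final state, for which the
      postcondition is already settled; the states in between need not satisfy the
      invariant.\<close>
    have "WP ?c (\<lambda>\<sigma>' \<tau>'. \<sigma>' = ?\<sigma> \<and> \<tau> - 300 \<le> \<tau>') \<sigma> (\<tau> - real (1 + bcost ?b))"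
      by (intro wp_Seq wp_Store)
         (use si sj sj' si' ij dW eW y W_bounds D j cs \<tau> in \<open>simp_all add: cell_inject\<close>)
    then show "WP ?c ?P \<sigma> (\<tau> - real (1 + bcost ?b))"
      by (rule wp_mono) (use P \<tau> in auto)
  qed
qed

section \<open>All powers at one vertex\<close>

definition "done_before i = {(a, b) \<in> A. a < i}"

abbreviation "window_credit \<equiv> 1000 + 4 * \<rho>"

text \<open>As \<open>k\<close> falls, the relaxed arcs grow from \<open>arcs_from i Q\<close>,
  which is empty, to \<open>arcs_from i 0\<close>, which contains all arcs leaving
  \<open>i\<close>.\<close>

lemma wp_process_windows:
  assumes st: "stage \<sigma> i k (done_before i)" and inv: "win_inv i Q (pos \<sigma>)"
    and \<tau>: "F + 50 + Q * window_credit + unit_credit * potential (pos \<sigma>) \<le> \<tau>" "0 \<le> F"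
  shows "WP process_windows (\<lambda>\<sigma>' \<tau>'. stage \<sigma>' i 0 (done_before (Suc i)) \<and> win_inv i 0 (pos \<sigma>') \<and>
           F + unit_credit * potential (pos \<sigma>') \<le> \<tau>') \<sigma> \<tau>"
    (is "WP _ ?P \<sigma> \<tau>")
proof -
  define I where "I = (\<lambda>\<sigma> \<tau>. \<exists>k \<le> Q. stage \<sigma> i k (done_before i \<union> arcs_from i k) \<and>
    win_inv i k (pos \<sigma>) \<and> F + 10 + k * window_credit + unit_credit * potential (pos \<sigma>) \<le> \<tau>)"
  have pot: "0 \<le> unit_credit * potential p" for p
    using potential_nonneg rho_ge by (simp add: unit_credit_def)
  have kw: "0 \<le> real k * window_credit" for k using rho_ge by simp
  let ?b = "Less (Const 0) (Reg 4)"
  let ?c = "Seq (Assign 4 (Sub (Reg 4) (Const 1)))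
            (Seq advance_lead (Seq advance_lag (Seq set_target relax)))"
  have loop: "WP (While ?b ?c) ?P \<sigma> \<tau>" if "I \<sigma> \<tau>" "0 \<le> \<tau>" for \<sigma> \<tau>
  proof (rule wp_While[where I = I])
    fix \<sigma> \<tau> assume "I \<sigma> \<tau>"
    then obtain k where k: "k \<le> Q" and st: "stage \<sigma> i k (done_before i \<union> arcs_from i k)"
      and inv: "win_inv i k (pos \<sigma>)"
      and cr: "F + 10 + k * window_credit + unit_credit * potential (pos \<sigma>) \<le> \<tau>"
      by (auto simp: I_def)
    note D = stageD[OF st]
    show "bsafe W S \<sigma> ?b \<and> real (1 + bcost ?b) \<le> \<tau>"
      using D(6) k W_bounds cr pot[of "pos \<sigma>"] kw[of k] \<tau>(2) by simp
    show "?P \<sigma> (\<tau> - real (1 + bcost ?b))" if "\<not> bval \<epsilon> \<sigma> ?b"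
    proof -
      have "k = 0" using that D(6) by simp
      moreover have "done_before i \<union> arcs_from i 0 = done_before (Suc i)"
        by (auto simp: done_before_def arcs_from_0)
      ultimately show ?thesis using st inv cr by simp
    qed
    show "WP ?c I \<sigma> (\<tau> - real (1 + bcost ?b))" if "bval \<epsilon> \<sigma> ?b"
    proof -
      have "k \<noteq> 0" using that D(6) by simp
      then obtain k' where k': "k = Suc k'" by (cases k) auto
      have kQ: "k' < Q" using k k' by simp
      let ?R = "done_before i \<union> arcs_from i k"
      \<comment> \<open>What must remain for the smaller powers. On top of it, the leading phase
        leaves 650 + \<open>\<rho>\<close>, the lagging phase 450 and the choice of the target
        400.\<close>
      let ?F = "F + 10 + k' * window_credit"
      let ?\<sigma> = "\<sigma>\<lparr>regs := (regs \<sigma>)(4 := k')\<rparr>" and ?\<tau> = "\<tau> - 10"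
      have F: "0 \<le> ?F" using \<tau>(2) kw[of k'] by simp
      have st': "stage ?\<sigma> i k' ?R" using st by (simp add: stage_def)
      have inv': "win_inv i (Suc k') (pos ?\<sigma>)" using inv k' by simp
      have lead: "WP advance_lead (\<lambda>\<sigma>' \<tau>'. stage \<sigma>' i k' ?R \<and> win_inv i (Suc k') (pos \<sigma>') \<and>
           lead_done i (pos \<sigma>') k' \<and> regs \<sigma>' 5 = cst i (pos \<sigma>' k') \<and>
           (?F + 650 + \<rho>) + unit_credit * potential (pos \<sigma>') \<le> \<tau>') ?\<sigma> \<tau>'"
        if "\<tau> - 20 \<le> \<tau>'" for \<tau>'
        by (rule wp_advance_lead[OF st' kQ inv'])
           (use cr F that rho_ge in \<open>simp_all add: k' algebra_simps\<close>)
      have lag: "WP advance_lag (\<lambda>\<sigma>' \<tau>'. stage \<sigma>' i k' ?R \<and> win_inv i k' (pos \<sigma>') \<and>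
           regs \<sigma>' 5 = cst i (pos \<sigma>' k') \<and> regs \<sigma>' 6 = cst i (pos \<sigma>' (Q + k')) \<and>
           (?F + 450) + unit_credit * potential (pos \<sigma>') \<le> \<tau>') \<sigma>' \<tau>'"
        if "stage \<sigma>' i k' ?R \<and> win_inv i (Suc k') (pos \<sigma>') \<and>
           lead_done i (pos \<sigma>') k' \<and> regs \<sigma>' 5 = cst i (pos \<sigma>' k') \<and>
           (?F + 650 + \<rho>) + unit_credit * potential (pos \<sigma>') \<le> \<tau>'" for \<sigma>' \<tau>'
        by (rule wp_advance_lag[where k = k'])
           (use that F kQ in \<open>simp_all add: algebra_simps\<close>)
      have rest: "WP (Seq set_target relax) I \<sigma>' \<tau>'"
        if "stage \<sigma>' i k' ?R \<and> win_inv i k' (pos \<sigma>') \<and>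
           regs \<sigma>' 5 = cst i (pos \<sigma>' k') \<and> regs \<sigma>' 6 = cst i (pos \<sigma>' (Q + k')) \<and>
           (?F + 450) + unit_credit * potential (pos \<sigma>') \<le> \<tau>'" for \<sigma>' \<tau>'
      proof -
        from that have st: "stage \<sigma>' i k' ?R" and inv: "win_inv i k' (pos \<sigma>')"
          and r: "regs \<sigma>' 5 = cst i (pos \<sigma>' k')" "regs \<sigma>' 6 = cst i (pos \<sigma>' (Q + k'))"
          and cr: "(?F + 450) + unit_credit * potential (pos \<sigma>') \<le> \<tau>'" by auto
        note D = stageD[OF st]
        note V = win_invD[OF inv kQ]
        let ?j = "target i (pos \<sigma>') k'"
        let ?y = "if real (cst i (pos \<sigma>' k')) \<le> pw k' then cst i (pos \<sigma>' k')
                  else cst i (pos \<sigma>' (Q + k'))"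
        have ip: "i \<le> pos \<sigma>' k'" using V(6) by (simp add: lead_done_def)
        have j: "1 \<le> ?j" "?j \<le> n + 1" using ip D(7) V(1) by (auto simp: target_def)
        have "i \<le> pos \<sigma>' (Q + k')" "pos \<sigma>' (Q + k') \<le> n" using V(1,7) D(8) by auto
        then have y: "?y \<le> M"
          using cst_le[OF D(7) ip V(1)] cst_le[OF D(7), of "pos \<sigma>' (Q + k')"] cost_T by auto
        have fin: "I \<sigma>'' \<tau>''"
          if "stage \<sigma>'' i k' (if i < ?j then insert (i, ?j) ?R else ?R)" "pos \<sigma>'' = pos \<sigma>'"
            "?F + unit_credit * potential (pos \<sigma>') \<le> \<tau>''" for \<sigma>'' \<tau>''
        proof -
          have "arcs_from i k' \<subseteq> (if i < ?j then insert (i, ?j) (arcs_from i k) else arcs_from i k)"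
            using arcs_from_step[OF inv kQ D(7,8)] k' by auto
          then have "done_before i \<union> arcs_from i k' \<subseteq> (if i < ?j then insert (i, ?j) ?R else ?R)"
            by auto
          with that(1) have "stage \<sigma>'' i k' (done_before i \<union> arcs_from i k')"
            unfolding stage_def using dpi_mono by blast
          with that(2,3) inv kQ show ?thesis
            unfolding I_def by (intro exI[of _ k']) simp
        qed
        show ?thesis
        proof (rule wp_Seq, rule wp_mono[OF wp_set_target[OF st kQ inv r]])
          show "?F + 400 + unit_credit * potential (pos \<sigma>') + 50 \<le> \<tau>'" using cr by simp
          show "0 \<le> ?F + 400 + unit_credit * potential (pos \<sigma>')" using F pot[of "pos \<sigma>'"] by simp
          fix \<sigma>'' \<tau>''
          assume *: "stage \<sigma>'' i k' ?R \<and> pos \<sigma>'' = pos \<sigma>' \<and> regs \<sigma>'' 7 = ?j \<and> regs \<sigma>'' 6 = ?y \<and>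
            ?F + 400 + unit_credit * potential (pos \<sigma>') \<le> \<tau>''"
          then have r6: "regs \<sigma>'' 6 = ?y" and r7: "regs \<sigma>'' 7 = ?j" by blast+
          show "WP relax I \<sigma>'' \<tau>''"
          proof (rule wp_mono[OF wp_relax[where j = ?j]])
            show "stage \<sigma>'' i k' ?R" using * by blast
            show "regs \<sigma>'' 7 = ?j" by (rule r7)
            show "regs \<sigma>'' 6 \<le> M" unfolding r6 by (rule y)
            show "(i, ?j) \<in> A \<and> regs \<sigma>'' 6 = cost_of (i, ?j)" if "i < ?j"
              using target_arc[OF inv kQ D(7,8) that] r6 by simp
            show "?F + unit_credit * potential (pos \<sigma>') + 400 \<le> \<tau>''" using * by simp
            show "0 \<le> ?F + unit_credit * potential (pos \<sigma>')" using F pot[of "pos \<sigma>'"] by simp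
          qed (use j fin * in auto)
        qed
      qed
      show ?thesis
      proof (rule wp_Seq, rule wp_Assign)
        show "asafe W S \<sigma> (Sub (Reg 4) (Const 1))" using D(6) k W_bounds by simp
        have "10 \<le> \<tau>" using cr F pot[of "pos \<sigma>"] kw[of k] \<tau>(2) by linarith
        then show "real (1 + acost (Sub (Reg 4) (Const 1))) \<le> \<tau> - real (1 + bcost ?b)" by simp
        have eq: "aval \<sigma> (Sub (Reg 4) (Const 1)) = k'" using D(6) k' by simp
        show "WP (Seq advance_lead (Seq advance_lag (Seq set_target relax))) I
          (\<sigma>\<lparr>regs := (regs \<sigma>)(4 := aval \<sigma> (Sub (Reg 4) (Const 1)))\<rparr>)
          (\<tau> - real (1 + bcost ?b) - real (1 + acost (Sub (Reg 4) (Const 1))))"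
          unfolding eq
          by (rule wp_Seq, rule wp_mono[OF lead], simp, rule wp_Seq, rule wp_mono[OF lag], assumption,
              rule rest)
      qed
    qed
  qed (use that in auto)
  note D = stageD[OF st]
  have \<tau>50: "50 \<le> \<tau>" using \<tau> pot[of "pos \<sigma>"] kw[of Q] by linarith
  show ?thesis
    unfolding process_windows_def
  proof (rule wp_Seq, rule wp_Assign)
    show "WP (While ?b ?c) ?P (\<sigma>\<lparr>regs := (regs \<sigma>)(4 := aval \<sigma> (Reg 2))\<rparr>)
        (\<tau> - real (1 + acost (Reg 2)))"
    proof (rule loop)
      show "I (\<sigma>\<lparr>regs := (regs \<sigma>)(4 := aval \<sigma> (Reg 2))\<rparr>) (\<tau> - real (1 + acost (Reg 2)))"
        unfolding I_def using st inv \<tau> D(4)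
        by (intro exI[of _ Q]) (simp add: stage_def arcs_from_Q)
    qed (use \<tau>50 in simp)
  qed (use D(4) W_bounds \<tau>50 in simp_all)
qed

section \<open>Advancing the left end and the sweep over all vertices\<close>

lemma window_less:
  assumes "g < 2 * H" "t \<in> {1..m}"
  shows "g * m + t - 1 < 2 * Q"
proof -
  have "Suc g * m \<le> 2 * H * m" using assms(1) by (intro mult_le_mono1) simp
  with assms(2) show ?thesis by (auto simp: Q_def)
qed

text \<open>The loop invariant splits the handles at \<open>k\<close> into those that already start
  at \<open>Suc i\<close> and those still at \<open>i\<close>; right ends do not move.
  \<open>ge\<close> supplies the nonemptiness that each removal needs.\<close>

lemma wp_remove_all:
  assumes st: "stage \<sigma> i k R" and ge: "\<And>k. k < 2 * Q \<Longrightarrow> i \<le> pos \<sigma> k"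
    and \<tau>: "F + 50 + 2 * H * (20 + \<kappa>) \<le> \<tau>" "0 \<le> F"
  shows "WP (remove_all H) (\<lambda>\<sigma>' \<tau>'. ok \<sigma>' \<and> regs \<sigma>' 3 = i \<and> windows (\<lambda>_. Suc i) \<sigma>' \<and>
           dpi \<sigma>' i R \<and> pos \<sigma>' = pos \<sigma> \<and> F \<le> \<tau>') \<sigma> \<tau>"
    (is "WP _ ?P \<sigma> \<tau>")
proof -
  define p where "p = pos \<sigma>"
  define I where "I = (\<lambda>\<sigma> \<tau>. \<exists>k \<le> 2 * H. ok \<sigma> \<and> regs \<sigma> 3 = i \<and> regs \<sigma> 4 = k \<and>
    windows (\<lambda>g. if g < k then Suc i else i) \<sigma> \<and> dpi \<sigma> i R \<and> pos \<sigma> = p \<and>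
    F + 10 + (2 * H - k) * (20 + \<kappa>) \<le> \<tau>)"
  note D = stageD[OF st]
  have kw: "0 \<le> real (2 * H - k) * (20 + \<kappa>)" for k using kappa_ge by simp
  let ?b = "Less (Reg 4) (Const (2 * H))"
  let ?c = "Seq (Remove (Reg 4)) (Assign 4 (Add (Reg 4) (Const 1)))"
  have loop: "WP (While ?b ?c) ?P \<sigma> \<tau>" if "I \<sigma> \<tau>" "0 \<le> \<tau>" for \<sigma> \<tau>
  proof (rule wp_While[where I = I])
    fix \<sigma> \<tau> assume "I \<sigma> \<tau>"
    then obtain k where k: "k \<le> 2 * H" and ok: "ok \<sigma>" and r: "regs \<sigma> 3 = i" "regs \<sigma> 4 = k"
      and win: "windows (\<lambda>g. if g < k then Suc i else i) \<sigma>" and dpi: "dpi \<sigma> i R" and p: "pos \<sigma> = p"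
      and cr: "F + 10 + (2 * H - k) * (20 + \<kappa>) \<le> \<tau>"
      by (auto simp: I_def)
    have kW: "k \<le> W" using k W_bounds by simp
    show "bsafe W S \<sigma> ?b \<and> real (1 + bcost ?b) \<le> \<tau>"
      using r kW W_bounds cr kw[of k] \<tau>(2) by simp
    show "?P \<sigma> (\<tau> - real (1 + bcost ?b))" if "\<not> bval \<epsilon> \<sigma> ?b"
    proof -
      have "k = 2 * H" using that r k by simp
      then have "windows (\<lambda>_. Suc i) \<sigma>" using win by (auto simp: windows_def)
      with ok r dpi p cr kw[of k] show ?thesis by (simp add: p_def)
    qed
    show "WP ?c I \<sigma> (\<tau> - real (1 + bcost ?b))" if b: "bval \<epsilon> \<sigma> ?b"
    proof -
      have k: "k < 2 * H" using b r by simp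
      then obtain s f where s: "inst \<sigma> k = Some s" "rep s i f"
          "\<forall>t \<in> {1..m}. f t = pos \<sigma> (k * m + t - 1)"
        using win by (auto simp: windows_def)
      have "\<forall>t \<in> {1..m}. i \<le> f t"
        using s(3) ge window_less[OF k] p by (auto simp: p_def)
      from ds_remove[OF s(2) this D(8)] obtain s' time where
        s': "ds_remove D s = (s', time)" "rep s' (Suc i) f" "real time \<le> \<kappa>" by auto
      have eq: "aval \<sigma> (Reg 4) = k" using r by simp
      let ?\<sigma> = "\<sigma>\<lparr>inst := (inst \<sigma>)(k \<mapsto> s')\<rparr>"
      have win': "windows (\<lambda>g. if g < Suc k then Suc i else i) ?\<sigma>"
        unfolding windows_def
      proof (intro conjI allI impI)
        show "dom (inst ?\<sigma>) = {..<2 * H}" using win k by (auto simp: windows_def)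
        fix g assume g: "g < 2 * H"
        show "\<exists>s r. inst ?\<sigma> g = Some s \<and> rep s (if g < Suc k then Suc i else i) r \<and>
          (\<forall>t \<in> {1..m}. r t = pos ?\<sigma> (g * m + t - 1))"
        proof (cases "g = k")
          case True
          with s s' show ?thesis by auto
        next
          case False
          then have "(g < Suc k) = (g < k)" by auto
          with False win g show ?thesis by (auto simp: windows_def simp del: less_Suc_eq)
        qed
      qed
      have step: "real (2 * H - k) * (20 + \<kappa>) = real (2 * H - Suc k) * (20 + \<kappa>) + (20 + \<kappa>)"
      proof -
        have "2 * H - k = Suc (2 * H - Suc k)" using k by simp
        then show ?thesis by (simp add: algebra_simps)
      qed
      have c20: "F + 10 + real (2 * H - Suc k) * (20 + \<kappa>) + (20 + \<kappa>) \<le> \<tau>"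
        using cr step by simp
      have c20': "30 + \<kappa> \<le> \<tau>" using c20 kw[of "Suc k"] \<tau>(2) by linarith
      show ?thesis
      proof (rule wp_Seq, rule wp_Remove[where B = \<kappa>], unfold eq)
        show "fits D S ((inst \<sigma>)(k \<mapsto> s'))" using fits_update[OF win k s'(2)] .
        show "WP (Assign 4 (Add (Reg 4) (Const 1))) I ?\<sigma>
          (\<tau> - real (1 + bcost ?b) - (real (1 + acost (Reg 4)) + \<kappa>))"
        proof (rule wp_Assign)
          show "asafe W S ?\<sigma> (Add (Reg 4) (Const 1))" using r k W_bounds by simp
          have "aval ?\<sigma> (Add (Reg 4) (Const 1)) = Suc k" using r by simp
          then show "I (?\<sigma>\<lparr>regs := (regs ?\<sigma>)(4 := aval ?\<sigma> (Add (Reg 4) (Const 1)))\<rparr>)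
            (\<tau> - real (1 + bcost ?b) - (real (1 + acost (Reg 4)) + \<kappa>) -
              real (1 + acost (Add (Reg 4) (Const 1))))"
            using ok r win' dpi p c20 k unfolding I_def
            by (intro exI[of _ "Suc k"]) (simp add: ok_def windows_def)
        qed (use c20' in simp)
      qed (use s(1) s' kW r c20' in simp_all)
    qed
  qed (use that in auto)
  have \<tau>50: "50 \<le> \<tau>" using \<tau> kw[of 0] by simp
  show ?thesis
    unfolding remove_all_def
  proof (rule wp_Seq, rule wp_Assign)
    show "WP (While ?b ?c) ?P (\<sigma>\<lparr>regs := (regs \<sigma>)(4 := aval \<sigma> (Const 0))\<rparr>)
        (\<tau> - real (1 + acost (Const 0)))"
    proof (rule loop)
      show "I (\<sigma>\<lparr>regs := (regs \<sigma>)(4 := aval \<sigma> (Const 0))\<rparr>) (\<tau> - real (1 + acost (Const 0)))"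
        unfolding I_def using D \<tau> by (intro exI[of _ 0]) (simp add: p_def)
    qed (use \<tau>50 in simp)
  qed (use \<tau>50 in simp_all)
qed

definition "stage_credit = Q * window_credit + 2 * H * (20 + \<kappa>) + 200"

definition vertex_inv :: "'s state \<Rightarrow> nat \<Rightarrow> bool" where
  "vertex_inv \<sigma> i \<longleftrightarrow> 1 \<le> i \<and> i \<le> n + 1 \<and> ok \<sigma> \<and> regs \<sigma> 3 = i \<and> windows (\<lambda>_. i) \<sigma> \<and>
     dpi \<sigma> i (done_before i) \<and> win_inv i Q (pos \<sigma>)"

lemma stage_credit_nonneg: "0 \<le> stage_credit"
  using rho_ge kappa_ge by (simp add: stage_credit_def)

text \<open>The potential is carried through the whole sweep and not charged per vertex: a single
  vertex may cause many appends, and only their sum is bounded well.\<close>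

lemma wp_process_vertices:
  assumes "vertex_inv \<sigma> 1"
    and \<tau>: "F + 10 + n * stage_credit + unit_credit * potential (pos \<sigma>) \<le> \<tau>" "0 \<le> F"
  shows "WP (process_vertices H) (\<lambda>\<sigma>' \<tau>'. ok \<sigma>' \<and> dpi \<sigma>' (n + 1) A \<and> F \<le> \<tau>') \<sigma> \<tau>"
    (is "WP _ ?P \<sigma> \<tau>")
proof -
  define I where "I = (\<lambda>\<sigma> \<tau>. \<exists>i. vertex_inv \<sigma> i \<and>
    F + 10 + (n + 1 - i) * stage_credit + unit_credit * potential (pos \<sigma>) \<le> \<tau>)"
  have pot: "0 \<le> unit_credit * potential p" for p
    using potential_nonneg rho_ge by (simp add: unit_credit_def)
  have kw: "0 \<le> real k * stage_credit" for k
    using stage_credit_nonneg by simp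
  show ?thesis
    unfolding process_vertices_def
  proof (rule wp_While[where I = I])
    show "I \<sigma> \<tau>" using assms by (auto simp: I_def intro!: exI[of _ 1])
    show "0 \<le> \<tau>" using \<tau> pot[of "pos \<sigma>"] kw[of n] by linarith
  next
    let ?b = "Less (Reg 3) (Add (Reg 0) (Const 1))"
    fix \<sigma> \<tau> assume "I \<sigma> \<tau>"
    then obtain i where inv: "vertex_inv \<sigma> i"
      and cr: "F + 10 + (n + 1 - i) * stage_credit + unit_credit * potential (pos \<sigma>) \<le> \<tau>"
      by (auto simp: I_def)
    have i: "1 \<le> i" "i \<le> n + 1" "regs \<sigma> 3 = i" "regs \<sigma> 0 = n"
      using inv by (auto simp: vertex_inv_def ok_def)
    show "bsafe W S \<sigma> ?b \<and> real (1 + bcost ?b) \<le> \<tau>"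
      using i W_bounds cr pot[of "pos \<sigma>"] kw[of "n + 1 - i"] \<tau>(2) by simp
    show "?P \<sigma> (\<tau> - real (1 + bcost ?b))" if "\<not> bval \<epsilon> \<sigma> ?b"
    proof -
      have eq: "i = n + 1" using that i by simp
      \<comment> \<open>No arc leaves the last vertex.\<close>
      have "done_before (n + 1) = A"
        unfolding done_before_def using pruned_arcsD[of _ _ C \<epsilon> T] by (force simp: n_def)
      with inv cr pot[of "pos \<sigma>"] show ?thesis by (simp add: vertex_inv_def eq)
    qed
    show "WP (Seq process_windows (Seq (remove_all H) (Assign 3 (Add (Reg 3) (Const 1))))) I \<sigma>
        (\<tau> - real (1 + bcost ?b))" if "bval \<epsilon> \<sigma> ?b"
    proof -
      have "i \<le> n" using that i by simp
      then have st: "stage \<sigma> i (regs \<sigma> 4) (done_before i)" and win: "win_inv i Q (pos \<sigma>)"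
        using inv by (auto simp: vertex_inv_def stage_def)
      let ?F = "F + 10 + (n - i) * stage_credit"
      have F: "0 \<le> ?F" using \<tau>(2) kw[of "n - i"] by linarith
      have "n + 1 - i = Suc (n - i)" using \<open>i \<le> n\<close> by simp
      then have cr': "?F + stage_credit + unit_credit * potential (pos \<sigma>) \<le> \<tau>"
        using cr by (simp add: algebra_simps)
      let ?F' = "?F + 60 + 2 * H * (20 + \<kappa>)"
      have last: "WP (Assign 3 (Add (Reg 3) (Const 1))) I \<sigma>'' \<tau>''"
        if "ok \<sigma>''" "regs \<sigma>'' 3 = i" "windows (\<lambda>_. Suc i) \<sigma>''" "dpi \<sigma>'' i (done_before (Suc i))"
          "win_inv (Suc i) Q (pos \<sigma>'')" "?F + 10 + unit_credit * potential (pos \<sigma>'') \<le> \<tau>''"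
        for \<sigma>'' \<tau>''
      proof (rule wp_Assign)
        have "10 \<le> \<tau>''" using that(6) F pot[of "pos \<sigma>''"] by linarith
        then show "real (1 + acost (Add (Reg 3) (Const 1))) \<le> \<tau>''" by simp
        have "dpi \<sigma>'' (Suc i) (done_before (Suc i))" using dpi_mono[OF that(4)] by simp
        then show "I (\<sigma>''\<lparr>regs := (regs \<sigma>'')(3 := aval \<sigma>'' (Add (Reg 3) (Const 1)))\<rparr>)
            (\<tau>'' - real (1 + acost (Add (Reg 3) (Const 1))))"
          unfolding I_def using that \<open>i \<le> n\<close>
          by (intro exI[of _ "Suc i"]) (simp add: vertex_inv_def)
      qed (use that \<open>i \<le> n\<close> W_bounds in simp)
      have "WP process_windows (\<lambda>\<sigma>' \<tau>'. stage \<sigma>' i 0 (done_before (Suc i)) \<and>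
          win_inv i 0 (pos \<sigma>') \<and> ?F' + unit_credit * potential (pos \<sigma>') \<le> \<tau>') \<sigma>
          (\<tau> - real (1 + bcost ?b))"
        using cr' F kappa_ge
        by (intro wp_process_windows[OF st win]) (simp_all add: stage_credit_def)
      then show ?thesis
      proof (intro wp_Seq, elim wp_mono)
        fix \<sigma>' \<tau>'
        assume *: "stage \<sigma>' i 0 (done_before (Suc i)) \<and>
          win_inv i 0 (pos \<sigma>') \<and> ?F' + unit_credit * potential (pos \<sigma>') \<le> \<tau>'"
        then have st': "stage \<sigma>' i 0 (done_before (Suc i))" and win': "win_inv i 0 (pos \<sigma>')" by auto
        show "WP (Seq (remove_all H) (Assign 3 (Add (Reg 3) (Const 1)))) I \<sigma>' \<tau>'"
        proof (rule wp_Seq, rule wp_mono[OF wp_remove_all[OF st' win_inv_ge[OF win']]])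
          show "?F + 10 + unit_credit * potential (pos \<sigma>') + 50 + 2 * H * (20 + \<kappa>) \<le> \<tau>'"
            using * by simp
          show "0 \<le> ?F + 10 + unit_credit * potential (pos \<sigma>')" using F pot[of "pos \<sigma>'"] by linarith
        qed (use last win_inv_next[OF win' i(1)] in auto)
      qed
    qed
  qed
qed

section \<open>Writing the path\<close>

lemma wp_write_path:
  assumes "ok \<sigma>" "dpi \<sigma> (n + 1) A" and \<tau>: "real (60 * (n + 2)) \<le> \<tau>"
  shows "WP write_path (\<lambda>\<sigma>' _. shortest_path (pruned_graph C \<epsilon> T) cost_of 1 (output_path \<sigma>') (n + 1)) \<sigma> \<tau>"
    (is "WP _ ?P \<sigma> \<tau>")
proof -
  let ?e = "\<lambda>j. mem \<sigma> (cell n 2 j)" and ?p = "\<lambda>j. mem \<sigma> (cell n 1 j)"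
  have "T \<noteq> []" using n_ge n_def by auto
  have inv: "dp_inv A cost_of (length T + 1) (n + 1) (\<lambda>j. mem \<sigma> (cell n 0 j)) ?p ?e A"
    using assms(2) unfolding dpi_def n_def[symmetric] .
  obtain vs where sp: "shortest_path (pruned_graph C \<epsilon> T) cost_of 1 vs (n + 1)"
    and len: "length vs = ?e (n + 1)" "0 < length vs" and vs: "last vs = n + 1" "?p (hd vs) = 0"
    and e: "\<And>q. q < length vs \<Longrightarrow> ?e (vs ! q) = Suc q \<and> vs ! q \<in> {1..n + 1}"
    and p: "\<And>q. Suc q < length vs \<Longrightarrow> ?p (vs ! Suc q) = vs ! q"
    using dp_inv_shortest_path[OF inv \<open>T \<noteq> []\<close>] unfolding n_def[symmetric] by blast
  have len_le: "length vs \<le> n + 1"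
    using len(1) dpi_bounds(2)[OF assms(2), of "n + 1"] by simp
  \<comment> \<open>The vertex in place \<open>q\<close>, counted from 1, with the sentinel
    \<open>v 0 = 0\<close>; register 7 holds \<open>v q\<close> while \<open>q\<close> runs down
    from the number of vertices.\<close>
  define v where "v q = (if q = 0 then 0 else vs ! (q - 1))" for q
  have v: "1 \<le> v q" "v q \<le> n + 1" "?e (v q) = q" "?p (v q) = v (q - 1)" if "0 < q" "q \<le> length vs" for q
  proof -
    obtain r where "q = Suc r" using \<open>0 < q\<close> by (cases q) auto
    with e[of r] that(2) show "1 \<le> v q" "v q \<le> n + 1" "?e (v q) = q" by (simp_all add: v_def)
    show "?p (v q) = v (q - 1)"
    proof (cases "q = 1")
      case True
      with vs(2) len(2) show ?thesis by (simp add: v_def hd_conv_nth)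
    next
      case False
      with that(1) have "q = Suc (Suc (q - 2))" by simp
      then obtain r where "q = Suc (Suc r)" ..
      with p[of r] that(2) show ?thesis by (simp add: v_def)
    qed
  qed
  have v0: "v q = 0 \<longleftrightarrow> q = 0" if "q \<le> length vs" for q
    using v(1)[of q] that by (cases "q = 0") (auto simp: v_def)
  have vW: "v q \<le> W" if "q \<le> length vs" for q
  proof (cases "q = 0")
    case False
    then have "v q \<le> n + 1" using v(2) that by simp
    then show ?thesis using W_bounds by linarith
  qed (simp add: v_def)
  define I where "I = (\<lambda>(\<sigma>' :: 's state) \<tau>. \<exists>q \<le> length vs. regs \<sigma>' 0 = n \<and> regs \<sigma>' 7 = v q \<and>
    (\<forall>x. n < x \<longrightarrow> mem \<sigma>' x = mem \<sigma> x) \<and> (\<forall>r. q \<le> r \<and> r < length vs \<longrightarrow> mem \<sigma>' r = vs ! r) \<and>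
    60 * real q + 30 \<le> \<tau>)"
  let ?b = "Less (Const 0) (Reg 7)"
  let ?c = "Seq (Store (Sub (count_at (Reg 7)) (Const 1)) (Reg 7)) (Assign 7 (pred_at (Reg 7)))"
  let ?Q = "\<lambda>(\<sigma>' :: 's state) \<tau> :: real. regs \<sigma>' 0 = n \<and> (\<forall>x. n < x \<longrightarrow> mem \<sigma>' x = mem \<sigma> x) \<and>
    (\<forall>r < length vs. mem \<sigma>' r = vs ! r) \<and> 20 \<le> \<tau>"
  have cells_v: "asafe W S \<sigma>' (elem a e)" "cell n a (aval \<sigma>' e) < S"
    if "regs \<sigma>' 0 = n" "asafe W S \<sigma>' e" "aval \<sigma>' e \<le> n + 1" "a < 4" for \<sigma>' :: "'s state" and a e
    using asafe_elem[OF that(2,1) _ that(4)] that(3) J_ge cell_less[OF that(4)] by auto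
  have loop: "WP (While ?b ?c) ?Q \<sigma>' \<tau>" if "I \<sigma>' \<tau>" "0 \<le> \<tau>" for \<sigma>' \<tau>
  proof (rule wp_While[where I = I])
    fix \<sigma>' \<tau> assume "I \<sigma>' \<tau>"
    then obtain q where q: "q \<le> length vs" and r: "regs \<sigma>' 0 = n" "regs \<sigma>' 7 = v q"
      and same: "\<forall>x. n < x \<longrightarrow> mem \<sigma>' x = mem \<sigma> x"
      and out: "\<forall>r. q \<le> r \<and> r < length vs \<longrightarrow> mem \<sigma>' r = vs ! r"
      and cr: "60 * real q + 30 \<le> \<tau>"
      by (auto simp: I_def)
    note vW = vW[OF q] and vW' = vW[of "q - 1"]
    show "bsafe W S \<sigma>' ?b \<and> real (1 + bcost ?b) \<le> \<tau>"
      using r vW cr by simp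
    show "?Q \<sigma>' (\<tau> - real (1 + bcost ?b))" if "\<not> bval \<epsilon> \<sigma>' ?b"
      using that r same out cr v0[OF q] by simp
    show "WP ?c I \<sigma>' (\<tau> - real (1 + bcost ?b))" if b: "bval \<epsilon> \<sigma>' ?b"
    proof -
      have q0: "0 < q" using b r v0[OF q] by auto
      note v' = v[OF q0 q]
      have q1: "q - 1 \<le> n" "q - 1 < S" using q len_le cells by auto
      have c7: "asafe W S \<sigma>' (elem a (Reg 7))" "cell n a (v q) < S" if "a < 4" for a
        using cells_v[OF r(1), of "Reg 7" a] that r(2) vW v'(2) by simp_all
      have m: "mem \<sigma>' (cell n 2 (v q)) = q" "mem \<sigma>' (cell n 1 (v q)) = v (q - 1)"
        using same cell_gt v'(3,4) by auto
      have vW': "v (q - 1) \<le> W" using vW' q by simp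
      \<comment> \<open>Output cells end at \<open>n\<close> and the arrays lie above, so the store
        leaves intact the predecessor that is read next.\<close>
      have ne: "cell n 1 (v q) \<noteq> q - 1" using cell_gt[of n 1 "v q"] q1(1) by linarith
      let ?\<sigma> = "\<sigma>'\<lparr>mem := (mem \<sigma>')(q - 1 := v q)\<rparr>"
      have c7': "asafe W S ?\<sigma> (elem 1 (Reg 7))"
        using c7(1)[of 1] by (simp add: elem_def)
      have I: "I (?\<sigma>\<lparr>regs := (regs ?\<sigma>)(7 := v (q - 1))\<rparr>) (\<tau> - 60)"
        unfolding I_def
      proof (intro exI[of _ "q - 1"] conjI allI impI)
        show "60 * real (q - 1) + 30 \<le> \<tau> - 60" using cr q0 by (simp add: algebra_simps of_nat_diff)
        fix r assume "q - 1 \<le> r \<and> r < length vs"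
        then show "mem (?\<sigma>\<lparr>regs := (regs ?\<sigma>)(7 := v (q - 1))\<rparr>) r = vs ! r"
          using out q0 by (auto simp: v_def)
      qed (use q r same q1(1) in auto)
      have \<tau>60: "60 \<le> \<tau>"
      proof -
        have "1 \<le> real q" using q0 by simp
        with cr show ?thesis by linarith
      qed
      have "WP ?c (\<lambda>\<sigma>'' \<tau>''. \<sigma>'' = ?\<sigma>\<lparr>regs := (regs ?\<sigma>)(7 := v (q - 1))\<rparr> \<and> \<tau> - 60 \<le> \<tau>'') \<sigma>'
          (\<tau> - real (1 + bcost ?b))"
        by (intro wp_Seq wp_Store wp_Assign)
           (use c7 c7' r vW vW' m q1 ne \<tau>60 W_bounds q len_le in simp_all)
      then show ?thesis
      proof (rule wp_mono)
        fix \<sigma>'' \<tau>''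
        assume "\<sigma>'' = ?\<sigma>\<lparr>regs := (regs ?\<sigma>)(7 := v (q - 1))\<rparr> \<and> \<tau> - 60 \<le> \<tau>''"
        then have "I \<sigma>'' (\<tau> - 60)" "\<tau> - 60 \<le> \<tau>''" using I by simp_all
        then show "I \<sigma>'' \<tau>''"
          unfolding I_def by (elim exE conjE, intro exI conjI) (assumption | linarith)+
      qed
    qed
  qed (use that in auto)
  have \<tau>': "60 * real (length vs) + 40 \<le> \<tau>"
  proof -
    have "real (length vs) \<le> real n + 1" using len_le by linarith
    with \<tau> show ?thesis by simp
  qed
  have r0: "regs \<sigma> 0 = n" using assms(1) by (simp add: ok_def)
  show ?thesis
    unfolding write_path_def
  proof (rule wp_Seq, rule wp_Assign)
    show "asafe W S \<sigma> (Add (Reg 0) (Const 1))" using r0 W_bounds by simp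
    show "real (1 + acost (Add (Reg 0) (Const 1))) \<le> \<tau>" using \<tau>' by simp
    have "I (\<sigma>\<lparr>regs := (regs \<sigma>)(7 := n + 1)\<rparr>) (\<tau> - 4)"
      unfolding I_def using r0 \<tau>' vs(1) len(2)
      by (intro exI[of _ "length vs"]) (auto simp: v_def last_conv_nth)
    then have "WP (While ?b ?c) ?Q (\<sigma>\<lparr>regs := (regs \<sigma>)(7 := n + 1)\<rparr>) (\<tau> - 4)"
      using \<tau>' by (intro loop) auto
    then have "WP (Seq (While ?b ?c) (Assign 0 (count_at (Add (Reg 0) (Const 1))))) ?P
      (\<sigma>\<lparr>regs := (regs \<sigma>)(7 := n + 1)\<rparr>) (\<tau> - 4)"
    proof (intro wp_Seq, elim wp_mono)
      fix \<sigma>' \<tau>' assume Q: "?Q \<sigma>' \<tau>'"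
      have m: "mem \<sigma>' (cell n 2 (Suc n)) = length vs" using Q cell_gt len(1) by simp
      have c: "asafe W S \<sigma>' (elem 2 (Add (Reg 0) (Const 1)))" "cell n 2 (Suc n) < S"
        using cells_v[of \<sigma>' "Add (Reg 0) (Const 1)" 2] Q W_bounds by simp_all
      show "WP (Assign 0 (count_at (Add (Reg 0) (Const 1)))) ?P \<sigma>' \<tau>'"
      proof (rule wp_Assign)
        show "asafe W S \<sigma>' (count_at (Add (Reg 0) (Const 1)))"
          using c m len_le W_bounds Q by simp
        show "real (1 + acost (count_at (Add (Reg 0) (Const 1)))) \<le> \<tau>'" using Q by simp
        have "map (mem \<sigma>') [0..<length vs] = vs" using Q by (intro nth_equalityI) auto
        then have "output_path (\<sigma>'\<lparr>regs := (regs \<sigma>')(0 := aval \<sigma>' (count_at (Add (Reg 0) (Const 1))))\<rparr>) = vs"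
          using m Q by (simp add: output_path_def)
        then show "shortest_path (pruned_graph C \<epsilon> T) cost_of 1 (output_path
            (\<sigma>'\<lparr>regs := (regs \<sigma>')(0 := aval \<sigma>' (count_at (Add (Reg 0) (Const 1))))\<rparr>)) (n + 1)"
          using sp by simp
      qed
    qed
    then show "WP (Seq (While ?b ?c) (Assign 0 (count_at (Add (Reg 0) (Const 1))))) ?P
      (\<sigma>\<lparr>regs := (regs \<sigma>)(7 := aval \<sigma> (Add (Reg 0) (Const 1)))\<rparr>)
      (\<tau> - real (1 + acost (Add (Reg 0) (Const 1))))"
      using r0 by simp
  qed
qed

section \<open>Initialisation\<close>

lemma fits_initial:
  assumes "dom I = {..<k}" "k < 2 * H" "\<forall>g < k. \<exists>s. I g = Some s \<and> rep s 1 f" "rep s 1 f"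
  shows "fits D S (I(k \<mapsto> s))"
proof (rule fitsI)
  show "dom (I(k \<mapsto> s)) \<subseteq> {..<2 * H}" using assms(1,2) by auto
  fix g s' assume *: "(I(k \<mapsto> s)) g = Some s'"
  show "ds_space D s' \<le> Z"
  proof (cases "g = k")
    case True
    with * ds_space[OF assms(4)] show ?thesis by simp
  next
    case False
    with * have "I g = Some s'" by simp
    moreover from this have "g < k" using assms(1) by blast
    ultimately have "rep s' 1 f" using assms(3) by fastforce
    then show ?thesis by (rule ds_space)
  qed
qed

definition "init_credit = m * 20 + 2 * H * (20 + \<beta>) + 100"

lemma wp_initialise:
  assumes \<tau>: "F + init_credit \<le> \<tau>" "0 \<le> F"
  shows "WP (initialise H) (\<lambda>\<sigma>' \<tau>'. vertex_inv \<sigma>' 1 \<and> potential (pos \<sigma>') \<le> 2 * Q * n \<and> F \<le> \<tau>')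
    (initial_state n) \<tau>"
    (is "WP _ ?P _ \<tau>")
proof -
  let ?w = "20 + \<beta>"
  let ?F1 = "F + 2 * H * ?w + 60"
  \<comment> \<open>The first loop changes nothing but register 1, so its states can be written down
    in full.\<close>
  let ?s = "\<lambda>a. \<lparr>regs = (\<lambda>_. 0)(0 := n, 1 := a), mem = \<lambda>_. 0, inst = \<lambda>_. None\<rparr> :: 's state"
  have kw: "0 \<le> real k * ?w" for k using beta_ge by simp
  have F1: "60 \<le> ?F1" using kw[of "2 * H"] \<tau>(2) by simp
  let ?b = "Neg (PowLe (Reg 0) (Reg 1))" and ?c = "Assign 1 (Add (Reg 1) (Const 1))"
  let ?I = "\<lambda>\<sigma> \<tau>. \<exists>a \<le> m. \<sigma> = ?s a \<and> ?F1 + 10 + (m - a) * 20 \<le> \<tau>"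
  have first: "WP (While ?b ?c) (\<lambda>\<sigma> \<tau>. \<sigma> = ?s m \<and> ?F1 \<le> \<tau>) (initial_state n) \<tau>"
  proof (rule wp_While[where I = ?I])
    have eq: "initial_state n = ?s 0" by (auto simp: initial_state_def)
    show "?I (initial_state n) \<tau>"
      using \<tau> unfolding eq by (intro exI[of _ 0]) (simp add: init_credit_def)
    show "0 \<le> \<tau>" using F1 \<tau> by (simp add: init_credit_def)
  next
    fix \<sigma> \<tau> assume "?I \<sigma> \<tau>"
    then obtain a where a: "a \<le> m" "\<sigma> = ?s a" and cr: "?F1 + 10 + (m - a) * 20 \<le> \<tau>" by auto
    show "bsafe W S \<sigma> ?b \<and> real (1 + bcost ?b) \<le> \<tau>"
      using a W_bounds cr F1 by simp
    have b: "bval \<epsilon> \<sigma> ?b \<longleftrightarrow> a < m"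
      using num_windows_le_iff[OF eps_pos, of n a] n_ge a(2) by (auto simp: m_def not_le)
    show "\<sigma> = ?s m \<and> ?F1 \<le> \<tau> - real (1 + bcost ?b)" if "\<not> bval \<epsilon> \<sigma> ?b"
      using that[unfolded b] a cr by simp
    show "WP ?c ?I \<sigma> (\<tau> - real (1 + bcost ?b))" if "bval \<epsilon> \<sigma> ?b"
    proof (rule wp_Assign)
      have am: "a < m" using that b by simp
      then have "real (m - a) = real (m - Suc a) + 1" by linarith
      then have cr': "?F1 + 10 + (m - Suc a) * 20 + 20 \<le> \<tau>" using cr by simp
      show "asafe W S \<sigma> (Add (Reg 1) (Const 1))" using a am W_bounds by simp
      show "real (1 + acost (Add (Reg 1) (Const 1))) \<le> \<tau> - real (1 + bcost ?b)" using cr' F1 by simp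
      have "\<sigma>\<lparr>regs := (regs \<sigma>)(1 := aval \<sigma> (Add (Reg 1) (Const 1)))\<rparr> = ?s (Suc a)"
        using a(2) by simp
      with cr' am show "?I (\<sigma>\<lparr>regs := (regs \<sigma>)(1 := aval \<sigma> (Add (Reg 1) (Const 1)))\<rparr>)
        (\<tau> - real (1 + bcost ?b) - real (1 + acost (Add (Reg 1) (Const 1))))"
        by (intro exI[of _ "Suc a"]) simp
    qed
  qed
  define J' where "J' = (\<lambda>\<sigma> \<tau>. \<exists>k \<le> 2 * H. ok \<sigma> \<and> regs \<sigma> 4 = k \<and> mem \<sigma> = (\<lambda>_. 0) \<and>
    dom (inst \<sigma>) = {..<k} \<and> (\<forall>g < k. \<exists>s. inst \<sigma> g = Some s \<and> rep s 1 (\<lambda>_. 0)) \<and>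
    F + 40 + (2 * H - k) * ?w \<le> \<tau>)"
  let ?b' = "Less (Reg 4) (Const (2 * H))"
  let ?c' = "Seq (New (Reg 4)) (Assign 4 (Add (Reg 4) (Const 1)))"
  let ?Q = "\<lambda>\<sigma> \<tau>. ok \<sigma> \<and> mem \<sigma> = (\<lambda>_. 0) \<and> dom (inst \<sigma>) = {..<2 * H} \<and>
    (\<forall>g < 2 * H. \<exists>s. inst \<sigma> g = Some s \<and> rep s 1 (\<lambda>_. 0)) \<and> F + 36 \<le> \<tau>"
  have create: "WP (While ?b' ?c') ?Q \<sigma> \<tau>" if "J' \<sigma> \<tau>" "0 \<le> \<tau>" for \<sigma> \<tau>
  proof (rule wp_While[where I = J'])
    fix \<sigma> \<tau> assume "J' \<sigma> \<tau>"
    then obtain k where k: "k \<le> 2 * H" and r: "ok \<sigma>" "regs \<sigma> 4 = k" "mem \<sigma> = (\<lambda>_. 0)"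
      and d: "dom (inst \<sigma>) = {..<k}" and g: "\<forall>g < k. \<exists>s. inst \<sigma> g = Some s \<and> rep s 1 (\<lambda>_. 0)"
      and cr: "F + 40 + (2 * H - k) * ?w \<le> \<tau>"
      by (auto simp: J'_def)
    show "bsafe W S \<sigma> ?b' \<and> real (1 + bcost ?b') \<le> \<tau>"
      using k r W_bounds cr kw[of "2 * H - k"] \<tau>(2) by simp
    show "?Q \<sigma> (\<tau> - real (1 + bcost ?b'))" if "\<not> bval \<epsilon> \<sigma> ?b'"
    proof -
      have "k = 2 * H" using that k r by simp
      with r d g cr show ?thesis by simp
    qed
    show "WP ?c' J' \<sigma> (\<tau> - real (1 + bcost ?b'))" if b: "bval \<epsilon> \<sigma> ?b'"
    proof -
      have k': "k < 2 * H" using b r by simp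
      obtain s time where s: "ds_new D T = (s, time)" "rep s 1 (\<lambda>_. 0)" "real time \<le> \<beta>"
        using ds_new by blast
      have "2 * H - k = Suc (2 * H - Suc k)" using k' by simp
      then have cr': "F + 40 + (2 * H - Suc k) * ?w + ?w \<le> \<tau>"
        using cr by (simp add: algebra_simps)
      have \<tau>w: "40 + ?w \<le> \<tau>" using cr' kw[of "2 * H - Suc k"] \<tau>(2) by linarith
      have eq: "aval \<sigma> (Reg 4) = k" using r by simp
      let ?\<sigma> = "\<sigma>\<lparr>inst := (inst \<sigma>)(k \<mapsto> s)\<rparr>"
      show ?thesis
      proof (rule wp_Seq, rule wp_New[where B = \<beta>], unfold eq)
        show "fits D S ((inst \<sigma>)(k \<mapsto> s))"
          by (rule fits_initial[OF d k' g s(2)])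
        show "WP (Assign 4 (Add (Reg 4) (Const 1))) J' ?\<sigma>
          (\<tau> - real (1 + bcost ?b') - (real (1 + acost (Reg 4)) + \<beta>))"
        proof (rule wp_Assign)
          show "asafe W S ?\<sigma> (Add (Reg 4) (Const 1))" using r k' W_bounds by simp
          have "aval ?\<sigma> (Add (Reg 4) (Const 1)) = Suc k" using r by simp
          then show "J' (?\<sigma>\<lparr>regs := (regs ?\<sigma>)(4 := aval ?\<sigma> (Add (Reg 4) (Const 1)))\<rparr>)
            (\<tau> - real (1 + bcost ?b') - (real (1 + acost (Reg 4)) + \<beta>) -
              real (1 + acost (Add (Reg 4) (Const 1))))"
            unfolding J'_def using r d g s(2) k' cr'
            by (intro exI[of _ "Suc k"]) (auto simp: ok_def less_Suc_eq)
        qed (use \<tau>w in simp)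
      qed (use s r k' W_bounds \<tau>w in simp_all)
    qed
  qed (use that in auto)
  have finish: "WP (Seq (Store (elem 2 (Const 1)) (Const 1)) (Assign 3 (Const 1))) ?P \<sigma> \<tau>"
    if Q: "?Q \<sigma> \<tau>" for \<sigma> \<tau>
  proof -
    let ?\<sigma> = "\<sigma>\<lparr>mem := (\<lambda>_. 0)(cell n 2 1 := 1), regs := (regs \<sigma>)(3 := 1)\<rparr>"
    have r0: "regs \<sigma> 0 = n" using Q by (simp add: ok_def)
    have pos': "pos (\<sigma>\<lparr>mem := (\<lambda>_. 0)(cell n 2 (Suc 0) := Suc 0)\<rparr>) = (\<lambda>_. 0)"
      by (auto simp: pos_def cell_inject)
    then have pos: "pos ?\<sigma> = (\<lambda>_. 0)" by simp
    have "windows (\<lambda>_. 1) ?\<sigma>"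
      unfolding windows_def pos using Q by fastforce
    moreover have "dpi ?\<sigma> 1 (done_before 1)"
    proof -
      have "done_before 1 = {}"
        unfolding done_before_def using pruned_arcsD[of _ _ C \<epsilon> T] by fastforce
      then show ?thesis
        using dp_inv_init[of A cost_of "n + 1" 1] by (simp add: dpi_def cell_inject fun_upd_def cong del: if_weak_cong)
    qed
    moreover have "potential (pos ?\<sigma>) \<le> 2 * Q * n"
      unfolding pos by (simp add: potential_def)
    ultimately have "vertex_inv ?\<sigma> 1" "potential (pos ?\<sigma>) \<le> 2 * Q * n"
      using Q win_inv_init by (simp_all add: vertex_inv_def pos' ok_def)
    moreover have "asafe W S \<sigma> (elem 2 (Const 1))" "cell n 2 1 < S"
      using asafe_elem[of \<sigma> "Const 1" 2] r0 W_bounds J_ge cell_less[of 2 1] by simp_all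
    ultimately show ?thesis
      using r0 Q W_bounds \<tau>(2) by (intro wp_Seq wp_Store wp_Assign) simp_all
  qed
  have second: "WP (Seq (Assign 2 (Mul (Const H) (Reg 1)))
    (Seq (While ?b' ?c')
    (Seq (Store (elem 2 (Const 1)) (Const 1)) (Assign 3 (Const 1))))) ?P \<sigma> \<tau>"
    if "\<sigma> = ?s m \<and> ?F1 \<le> \<tau>" for \<sigma> \<tau>
  proof (rule wp_Seq, rule wp_Assign)
    show "asafe W S \<sigma> (Mul (Const H) (Reg 1))"
      using that W_bounds by (simp flip: Q_def)
    show "real (1 + acost (Mul (Const H) (Reg 1))) \<le> \<tau>" using that F1 by simp
    have eq: "aval \<sigma> (Mul (Const H) (Reg 1)) = Q"
      using that by (simp add: Q_def)
    let ?\<sigma> = "\<sigma>\<lparr>regs := (regs \<sigma>)(2 := Q)\<rparr>" and ?\<tau> = "\<tau> - real (1 + acost (Mul (Const H) (Reg 1)))"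
    have "J' ?\<sigma> ?\<tau>"
      unfolding J'_def using that by (intro exI[of _ 0]) (simp add: ok_def)
    from create[OF this] have "WP (While ?b' ?c') ?Q ?\<sigma> ?\<tau>"
      using that F1 by simp
    then show "WP (Seq (While ?b' ?c')
      (Seq (Store (elem 2 (Const 1)) (Const 1)) (Assign 3 (Const 1)))) ?P
      (\<sigma>\<lparr>regs := (regs \<sigma>)(2 := aval \<sigma> (Mul (Const H) (Reg 1)))\<rparr>) ?\<tau>"
      unfolding eq
      by (intro wp_Seq, elim wp_mono) (rule finish)
  qed
  show ?thesis
    unfolding initialise_def by (rule wp_Seq, rule wp_mono[OF first], rule second)
qed

section \<open>The whole program, its total credit and asymptotic bounds\<close>

definition "total_credit = init_credit + n * stage_credit + unit_credit * (2 * Q * n) + 60 * (n + 2) + 30"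

text \<open>All positions start at 0, so a potential of at most \<open>2 * Q * n\<close> prepays
  every append of the run.\<close>

lemma wp_program:
  "WP (program H) (\<lambda>\<sigma> _. shortest_path (pruned_graph C \<epsilon> T) cost_of 1 (output_path \<sigma>) (n + 1))
     (initial_state n) total_credit"
proof -
  let ?P = "\<lambda>\<sigma> _. shortest_path (pruned_graph C \<epsilon> T) cost_of 1 (output_path \<sigma>) (n + 1)"
  let ?F = "n * stage_credit + unit_credit * (2 * Q * n) + 60 * (n + 2) + 20"
  have nonneg: "0 \<le> n * stage_credit" "0 \<le> unit_credit * (2 * Q * n)" "0 \<le> init_credit" "0 \<le> unit_credit"
    using stage_credit_nonneg rho_ge beta_ge by (simp_all add: unit_credit_def init_credit_def)
  have main: "WP (Seq (process_vertices H) write_path) ?P \<sigma> \<tau>"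
    if *: "vertex_inv \<sigma> 1 \<and> potential (pos \<sigma>) \<le> 2 * Q * n \<and> ?F \<le> \<tau>" for \<sigma> \<tau>
  proof -
    have "unit_credit * potential (pos \<sigma>) \<le> unit_credit * (2 * Q * n)"
      using * nonneg(4) by (intro mult_left_mono) auto
    with * have "real (60 * (n + 2)) + 10 + n * stage_credit + unit_credit * potential (pos \<sigma>) \<le> \<tau>" by simp
    from wp_process_vertices[OF conjunct1[OF *] this of_nat_0_le_iff] show ?thesis
      by (intro wp_Seq, elim wp_mono) (use wp_write_path in auto)
  qed
  show ?thesis
    unfolding program_def
  proof (rule wp_If)
    let ?b = "Equal (Reg 0) (Const 1)"
    show "bsafe W S (initial_state n) ?b" using W_bounds by (simp add: initial_state_def)
    show "real (1 + bcost ?b) \<le> total_credit" using nonneg by (simp add: total_credit_def)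
    show "WP (Seq (initialise H) (Seq (process_vertices H) write_path)) ?P (initial_state n)
      (total_credit - real (1 + bcost ?b))"
    proof (rule wp_Seq, rule wp_mono[OF wp_initialise])
      show "?F + init_credit \<le> total_credit - real (1 + bcost ?b)" by (simp add: total_credit_def)
      show "0 \<le> ?F" using nonneg by simp
    qed (rule main)
  qed (use n_ge in \<open>simp add: initial_state_def\<close>)
qed

end

text \<open>\<open>Y\<close> will be the term n log n R(n). The factor 1408 collects the multiples
  of \<open>H * n * m * \<rho>\<close>: 1004 from the fixed work per vertex and power, 404 from the
  potential. Lower terms are absorbed by \<open>1 \<le> \<rho>\<close> and
  \<open>1 \<le> \<kappa>\<close>, and \<open>2 * H * c\<close> pays for creating the
  instances.\<close>

lemma (in window_program) total_credit_le:
  assumes \<beta>: "\<beta> = c * (n * \<kappa> + Y)" and m_le: "n * m * \<rho> \<le> b * Y" and "0 \<le> Y" "0 \<le> b" "0 \<le> c"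
  shows "total_credit \<le> (1408 * H * b + 20 * b + 82 * H + 510 + 2 * H * c) * (n * \<kappa> + Y)"
proof -
  define X where "X = n * \<kappa>"
  define p where "p = n * m * \<rho>"
  define h where "h = real H"
  have h: "0 \<le> h" by (simp add: h_def)
  have Q: "real Q = h * real m" by (simp add: h_def Q_def)
  have n1: "1 \<le> real n" using n_ge by simp
  have X: "real n \<le> X"
    using mult_left_mono[OF kappa_ge, of "real n"] by (simp add: X_def)
  with n1 have X1: "1 \<le> X" by linarith
  have nm: "real n * real m \<le> p"
    using mult_left_mono[OF rho_ge, of "real n * real m"] by (simp add: p_def)
  moreover have "real m \<le> real n * real m"
    using mult_right_mono[OF n1, of "real m"] by simp
  ultimately have m: "real m \<le> p" by linarith
  have p: "p \<le> b * Y" using m_le by (simp add: p_def)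
  have "0 \<le> p" using m by (meson of_nat_0_le_iff order_trans)
  have hs: "h * (real n * real m) \<le> h * p" "h * p \<le> h * (b * Y)" "h * real n \<le> h * X" "h \<le> h * X"
    using mult_left_mono[OF nm h] mult_left_mono[OF p h] mult_left_mono[OF X h]
      mult_left_mono[OF X1 h] by simp_all
  have "total_credit = 20 * m + 2 * h * (20 + \<beta>) + 100 + (1000 * (h * (n * m)) + 4 * (h * p)) +
      40 * (h * n) + 2 * (h * X) + 200 * n + (400 * (h * (n * m)) + 4 * (h * p)) + 60 * n + 150"
    unfolding total_credit_def init_credit_def stage_credit_def unit_credit_def X_def p_def
    by (simp add: Q algebra_simps flip: h_def)
  also have "\<dots> \<le> 20 * (b * Y) + (40 * (h * X) + 2 * h * \<beta>) + 100 * X + 1004 * (h * (b * Y)) +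
      42 * (h * X) + 200 * X + 404 * (h * (b * Y)) + 210 * X"
    using hs m p X X1 by (simp add: algebra_simps)
  also have "\<dots> = (1408 * h * b + 20 * b) * Y + (82 * h + 510) * X + 2 * h * c * (X + Y)"
    unfolding \<beta> X_def[symmetric] by (simp add: algebra_simps)
  also have "\<dots> \<le> (1408 * h * b + 20 * b) * (X + Y) + (82 * h + 510) * (X + Y) + 2 * h * c * (X + Y)"
    using assms(3-5) h X1 by (intro add_mono mult_left_mono) auto
  also have "\<dots> = (1408 * h * b + 20 * b + 82 * h + 510 + 2 * h * c) * (X + Y)"
    by (simp add: algebra_simps)
  finally show ?thesis by (simp add: h_def X_def)
qed

text \<open>Rounding up adds at most 1, which for \<open>2 \<le> n\<close> is at most log n / log 2
  and so disappears in the factor \<open>b\<close>.\<close>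

lemma num_windows_le_log:
  assumes "\<epsilon> > 0"
  obtains b :: nat where "\<And>n. 2 \<le> n \<Longrightarrow> real (num_windows \<epsilon> n) \<le> b * log (1 + \<epsilon>) (real n)"
proof -
  let ?g = "log (1 + \<epsilon>) 2"
  obtain b :: nat where b: "1 + 1 / ?g \<le> real b" using real_arch_simple by blast
  have g: "0 < ?g" using assms by simp
  show thesis
  proof (rule that)
    fix n :: nat assume "2 \<le> n"
    let ?l = "log (1 + \<epsilon>) (real n)"
    have l: "?g \<le> ?l" using assms \<open>2 \<le> n\<close> by simp
    with g have "1 \<le> ?l * (1 / ?g)" by (simp add: field_simps)
    moreover have "real (num_windows \<epsilon> n) \<le> ?l + 1"
      using l g unfolding num_windows_def by linarith
    moreover have "(1 + 1 / ?g) * ?l \<le> b * ?l"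
      using b l g by (intro mult_right_mono) auto
    ultimately show "real (num_windows \<epsilon> n) \<le> b * ?l" by (simp add: algebra_simps)
  qed
qed

text \<open>By Bernoulli's inequality (1+\<epsilon>)^(a n) reaches \<open>n\<close> as soon as a
  \<epsilon> \<ge> 1. This keeps the array of window positions within linear space.\<close>

lemma num_windows_le_linear:
  assumes "\<epsilon> > 0"
  obtains a :: nat where "\<And>n. 1 \<le> n \<Longrightarrow> num_windows \<epsilon> n \<le> a * n"
proof -
  obtain a :: nat where "1 / \<epsilon> \<le> real a" using real_arch_simple by blast
  then have a: "1 \<le> real a * \<epsilon>" using assms by (simp add: field_simps)
  show thesis
  proof (rule that)
    fix n :: nat assume n: "1 \<le> n"
    have "real n \<le> real n * (real a * \<epsilon>)" using mult_left_mono[OF a, of "real n"] by simp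
    also have "\<dots> \<le> 1 + real (a * n) * \<epsilon>" by (simp add: algebra_simps)
    also have "\<dots> \<le> (1 + \<epsilon>) ^ (a * n)" using assms by (intro Bernoulli_inequality) simp
    finally show "num_windows \<epsilon> n \<le> a * n" using num_windows_le_iff[OF assms n] by simp
  qed
qed

text \<open>Relaxing the only arc once is already a complete run of the dynamic program, so the
  general extraction lemma applies.\<close>

lemma shortest_path_single:
  fixes C :: "'a list \<Rightarrow> bool list"
  assumes "length T = 1"
  shows "shortest_path (pruned_graph C \<epsilon> T) c 1 [1, 2] 2"
proof -
  let ?e = "(\<lambda>j. if j = 1 then 1 else 0 :: nat)(2 := Suc 1)"
  have A: "pruned_arcs C \<epsilon> T = {(1, 2)}"
    using assms by (auto simp: mem_pruned_arcs_iff)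
  have "dp_inv (pruned_arcs C \<epsilon> T) c (length T + 1) 1
      ((\<lambda>_. 0)(2 := 0 + c (1, 2))) ((\<lambda>_. 0)(2 := 1)) ?e (pruned_arcs C \<epsilon> T)"
    using dp_inv_update[OF dp_inv_init, of 1 2 "length T + 1" "pruned_arcs C \<epsilon> T" c] assms
    by (simp add: A)
  then obtain vs where vs: "shortest_path (pruned_graph C \<epsilon> T) c 1 vs (length T + 1)"
    "length vs = ?e (length T + 1)" "last vs = length T + 1"
    "\<And>q. q < length vs \<Longrightarrow> ?e (vs ! q) = Suc q \<and> vs ! q \<in> {1..length T + 1}"
    by (rule dp_inv_shortest_path) (use assms in auto)
  from vs(2) assms obtain x y where xy: "vs = [x, y]"
    by (auto simp: length_Suc_conv numeral_2_eq_2)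
  with vs(3) vs(4)[of 0] assms have "y = 2" "x = 1" by (auto split: if_splits)
  with vs(1) xy assms show ?thesis by (simp add: numeral_2_eq_2)
qed

lemma exec_program_single:
  assumes "2 \<le> S" "2 \<le> W"
  shows "wp D T \<epsilon> W S (program H) (\<lambda>\<sigma> _. output_path \<sigma> = [1, 2]) (initial_state 1) 30"
  unfolding program_def
  by (intro wp_If wp_Seq wp_Store wp_Assign)
     (use assms in \<open>simp_all add: initial_state_def output_path_def upt_conv_Cons\<close>)

theorem theorem2:
  fixes C :: "'a list \<Rightarrow> bool list"
    and D :: "('a, 's) window_ds"
    and \<epsilon> :: real
    and L R :: "nat \<Rightarrow> real"
    and d :: nat
  assumes "prefix_free C"
    and "monotone_compressor C"
    and "\<epsilon> > 0"
    and "\<And>n. n \<ge> 1 \<Longrightarrow> L n \<ge> 1"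
    and "\<And>n. n \<ge> 1 \<Longrightarrow> R n \<ge> 1"
    and "sliding_windows C \<epsilon> (texts C d) L R D"
  shows "\<exists>(prog :: com) (K :: nat). \<forall>T \<in> texts C d.
           let n = length T in
           \<exists>t \<sigma>. exec D T \<epsilon> (K * n ^ K) (K * n) prog (initial_state n) t \<sigma> \<and>
             shortest_path (pruned_graph C \<epsilon> T) (edge_cost C T) 1 (output_path \<sigma>) (n + 1) \<and>
             real t \<le> real K * (real n * L n + (real n * log (1 + \<epsilon>) (real n)) * R n)"
proof -
  from assms(6) obtain rep :: "'a list \<Rightarrow> 's \<Rightarrow> nat \<Rightarrow> (nat \<Rightarrow> nat) \<Rightarrow> bool" and c :: nat
    where ds: "\<forall>T \<in> texts C d.
        let n = length T; m = num_windows \<epsilon> n in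
        (case ds_new D T of (s, time) \<Rightarrow>
           rep T s 1 (\<lambda>_. 0) \<and> real time \<le> real c * time_bound \<epsilon> L R n) \<and>
        (\<forall>s l r. rep T s l r \<longrightarrow>
           ds_space D s \<le> c * n \<and>
           ((\<forall>t \<in> {1..m}. l \<le> r t) \<and> l \<le> n \<longrightarrow>
             (case ds_remove D s of (s', time) \<Rightarrow>
                rep T s' (l + 1) r \<and> real time \<le> L n)) \<and>
           (\<forall>t \<in> {1..m}. r t < n \<and> (t < m \<longrightarrow> r t < r (t + 1)) \<longrightarrow>
             (case ds_append D t s of (s', time) \<Rightarrow>
                rep T s' l (r(t := r t + 1)) \<and> real time \<le> R n)) \<and>
           (\<forall>t \<in> {1..m}. l \<le> r t \<longrightarrow>
             (case ds_length D t s of (c, s', time) \<Rightarrow>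
                c = length (C (substr T l (r t))) \<and> rep T s' l r \<and> real time \<le> R n)))"
    unfolding sliding_windows_def by blast
  obtain a :: nat where a: "\<And>n. 1 \<le> n \<Longrightarrow> num_windows \<epsilon> n \<le> a * n"
    by (rule num_windows_le_linear[OF assms(3)]) blast
  obtain b :: nat where b: "\<And>n. 2 \<le> n \<Longrightarrow> real (num_windows \<epsilon> n) \<le> b * log (1 + \<epsilon>) (real n)"
    by (rule num_windows_le_log[OF assms(3)]) blast
  obtain k where k: "real d < (1 + \<epsilon>) ^ k"
    using real_arch_pow[of "1 + \<epsilon>" "real d"] assms(3) by auto
  \<comment> \<open>Every \<open>m\<close> powers gain a factor of at least \<open>n\<close>:
    \<open>d\<close> groups reach n^d, \<open>k\<close> groups cover the coefficient
    \<open>d\<close>, and the 1 keeps \<open>H\<close> positive.\<close>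
  define H where "H = d + k + 1"
  \<comment> \<open>One summand per obligation: running time, space of the instances, array cells,
    size of the distances, and the exponent in the word bound.\<close>
  define K where "K = (1408 * H * b + 20 * b + 82 * H + 510 + 2 * H * c) +
    (2 * H * (1 + c)) + (14 + 8 * H * a) + 3 * d + (d + 1)"
  have "\<exists>t \<sigma>. exec D T \<epsilon> (K * n ^ K) (K * n) (program H) (initial_state n) t \<sigma> \<and>
      shortest_path (pruned_graph C \<epsilon> T) (edge_cost C T) 1 (output_path \<sigma>) (n + 1) \<and>
      real t \<le> real K * (real n * L n + (real n * log (1 + \<epsilon>) (real n)) * R n)"
    if T: "T \<in> texts C d" and n: "n = length T" for T n
  proof (cases "n = 1")
    case True
    have "wp D T \<epsilon> K K (program H) (\<lambda>\<sigma> _. output_path \<sigma> = [1, 2]) (initial_state 1) 30"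
      by (rule exec_program_single) (simp_all add: K_def)
    then obtain t \<sigma> where t: "exec D T \<epsilon> K K (program H) (initial_state 1) t \<sigma>"
        "output_path \<sigma> = [1, 2]" "real t \<le> 30"
      by (elim wpE) auto
    \<comment> \<open>The logarithm vanishes at 1, so the term with \<open>L\<close> alone has to
      pay for this branch.\<close>
    have "30 * 1 \<le> real K * L 1"
      using assms(4)[of 1] by (intro mult_mono) (simp_all add: K_def)
    moreover have "shortest_path (pruned_graph C \<epsilon> T) (edge_cost C T) 1 [1, 2] 2"
      using n True by (intro shortest_path_single) simp
    ultimately show ?thesis
      unfolding True using t by (intro exI[of _ t] exI[of _ \<sigma>]) (simp flip: numeral_2_eq_2)
  next
    case False
    have "T \<noteq> []" and len: "length (C T) \<le> d * n ^ d" using T n by (auto simp: texts_def)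
    with False n have n2: "2 \<le> n" by (cases T) (auto simp: Suc_le_eq)
    define m where "m = num_windows \<epsilon> n"
    let ?l = "log (1 + \<epsilon>) (real n)"
    have pow_m: "real n \<le> (1 + \<epsilon>) ^ m"
      using num_windows_le_iff[OF assms(3), of n m] n2 by (simp add: m_def)
    have m1: "1 \<le> m"
    proof (rule ccontr)
      assume "\<not> 1 \<le> m"
      then have "m = 0" by simp
      with pow_m n2 show False by simp
    qed
    have LR: "1 \<le> L n" "1 \<le> R n" using assms(4,5) n2 by simp_all
    have l0: "0 \<le> ?l" using n2 assms(3) by simp
    note dsT = bspec[OF ds T, unfolded Let_def, folded n, folded m_def]
    note ops = conjunct2[OF dsT, THEN spec, THEN spec, THEN spec, THEN mp]
    note op_remove = ops[THEN conjunct2, THEN conjunct1, THEN mp]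
      and op_append = ops[THEN conjunct2, THEN conjunct2, THEN conjunct1, THEN bspec, THEN mp]
      and op_length = ops[THEN conjunct2, THEN conjunct2, THEN conjunct2, THEN bspec, THEN mp]
    have top: "real (d * n ^ d) \<le> (1 + \<epsilon>) ^ (H * m)"
    proof -
      have "real (d * n ^ d) = real d * real n ^ d" by simp
      also have "\<dots> \<le> (1 + \<epsilon>) ^ (k * m) * ((1 + \<epsilon>) ^ m) ^ d"
      proof (intro mult_mono power_mono pow_m)
        have "(1 + \<epsilon>) ^ k \<le> (1 + \<epsilon>) ^ (k * m)"
          using assms(3) m1 by (intro power_increasing) auto
        with k show "real d \<le> (1 + \<epsilon>) ^ (k * m)" by linarith
      qed (use assms(3) in simp_all)
      also have "\<dots> = (1 + \<epsilon>) ^ (k * m + m * d)" by (simp add: power_add power_mult)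
      also have "\<dots> \<le> (1 + \<epsilon>) ^ (H * m)"
        using assms(3) by (intro power_increasing) (auto simp: H_def algebra_simps)
      finally show ?thesis .
    qed
    have mn: "H * m \<le> H * (a * n)" using a[of n] n2 by (simp add: m_def)
    interpret window_program C \<epsilon> T n m "H * m" D "rep T" H "K * n ^ K" "K * n" "d * n ^ d"
      "n + 1 + 2 * (H * m)" "c * n" "R n" "L n" "real c * time_bound \<epsilon> L R n"
    proof unfold_locales
      show "real (length (C T)) \<le> (1 + \<epsilon>) ^ (H * m)"
        using len top by linarith
      show "\<exists>s time. ds_new D T = (s, time) \<and> rep T s 1 (\<lambda>_. 0) \<and>
          real time \<le> real c * time_bound \<epsilon> L R n"
        using conjunct1[OF dsT] by (cases "ds_new D T") auto
      show "ds_space D s \<le> c * n" if "rep T s l r" for s l r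
        using ops[OF that] by (rule conjunct1)
      show "\<exists>s' time. ds_remove D s = (s', time) \<and> rep T s' (l + 1) r \<and> real time \<le> L n"
        if "rep T s l r" "\<forall>t \<in> {1..m}. l \<le> r t" "l \<le> n" for s l r
        using op_remove[OF that(1) conjI[OF that(2,3)]] by (cases "ds_remove D s") auto
      show "\<exists>s' time. ds_append D t s = (s', time) \<and> rep T s' l (r(t := r t + 1)) \<and> real time \<le> R n"
        if "rep T s l r" "t \<in> {1..m}" "r t < n" "t < m \<longrightarrow> r t < r (t + 1)" for s l r t
        using op_append[OF that(1,2) conjI[OF that(3,4)]] by (cases "ds_append D t s") auto
      show "\<exists>s' time. ds_length D t s = (substr_cost C T l (r t), s', time) \<and> rep T s' l r \<and>
          real time \<le> R n"
        if "rep T s l r" "t \<in> {1..m}" "l \<le> r t" for s l r t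
        using op_length[OF that] by (cases "ds_length D t s") (auto simp: substr_cost_def)
      show "0 \<le> real c * time_bound \<epsilon> L R n"
        using LR l0 by (simp add: time_bound_def)
      have "2 * H * (1 + c * n) \<le> 2 * H * (n + c * n)"
        using n2 by (intro mult_le_mono2) simp
      also have "\<dots> = (2 * H * (1 + c)) * n" by (simp add: algebra_simps)
      also have "\<dots> \<le> K * n" by (intro mult_le_mono1) (simp add: K_def)
      finally show "2 * H * (1 + c * n) \<le> K * n" .
      have "1 \<le> K" by (simp add: K_def)
      then have "n ^ 1 \<le> n ^ K" using n2 by (intro power_increasing) auto
      then show "K * n \<le> K * n ^ K" by simp
      \<comment> \<open>The four interleaved arrays share one index range, which costs 8 cells per
        power; the remaining \<open>5 * n + 8\<close> stays below \<open>14 * n\<close>.\<close>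
      have "n + (4 * (n + 1 + 2 * x) + 4) < 14 * n + 8 * y" if "x \<le> y" for x y
        using that n2 by (simp add: distrib_left)
      from this[OF mn] have "n + (4 * (n + 1 + 2 * (H * m)) + 4) < 14 * n + 8 * (H * (a * n))" .
      also have "\<dots> = (14 + 8 * H * a) * n" by (simp add: algebra_simps)
      also have "\<dots> \<le> K * n" by (intro mult_le_mono1) (simp add: K_def)
      finally show "n + (4 * (n + 1 + 2 * (H * m)) + 4) < K * n" .
      have "(n + 2) * (d * n ^ d) \<le> (3 * n) * (d * n ^ d)" using n2 by (intro mult_le_mono1) simp
      also have "\<dots> = (3 * d) * n ^ (d + 1)" by simp
      also have "\<dots> \<le> K * n ^ K"
        using n2 by (intro mult_le_mono power_increasing) (simp_all add: K_def)
      finally show "(n + 2) * (d * n ^ d) \<le> K * n ^ K" .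
    qed (use assms(2,3) n n2 m1 len LR in \<open>simp_all add: m_def H_def\<close>)
    let ?TB = "real n * L n + (real n * ?l) * R n"
    from wp_program obtain t \<sigma> where t: "exec D T \<epsilon> (K * n ^ K) (K * n) (program H) (initial_state n) t \<sigma>"
        "shortest_path (pruned_graph C \<epsilon> T) (edge_cost C T) 1 (output_path \<sigma>) (n + 1)"
        "real t \<le> total_credit"
      by (elim wpE) auto
    have "total_credit \<le> (1408 * H * b + 20 * b + 82 * H + 510 + 2 * H * c) * ?TB"
    proof (rule total_credit_le)
      show "real c * time_bound \<epsilon> L R n = real c * ?TB" by (simp add: time_bound_def)
      have "real m \<le> b * ?l" using b[OF n2] by (simp add: m_def)
      then have "(real n * real m) * R n \<le> (real n * (b * ?l)) * R n"
        using LR by (intro mult_right_mono mult_left_mono) auto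
      then show "real (n * m) * R n \<le> b * (real n * ?l * R n)" by (simp add: algebra_simps)
    qed (use LR l0 in simp_all)
    also have "\<dots> \<le> K * ?TB"
      using LR l0 by (intro mult_right_mono) (simp_all add: K_def)
    finally show ?thesis using t by (intro exI[of _ t] exI[of _ \<sigma>]) simp
  qed
  then show ?thesis
    by (intro exI[of _ "program H"] exI[of _ K]) (simp add: Let_def)
qed

end
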